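(* Let $m\ge1$, $0\le s\le m$, $I\subset\{0,\dots,m\}$ nonempty, and $\mu=(2^{(s)},1^{(2m-2s)},0^{(s)})\in X_*$. For $\tilde w\in\widetilde W/W_I$, $\tilde w$ is wedge-permissible if and only if $\tilde w$ is $\mu$-admissible in $\widetilde W/W_I$.
   Context: Notation: $(x^{(p)},y^{(q)},\dots)$ denotes $x$ repeated $p$ times, then $y$ repeated $q$ times, etc.; $\mathbf d=(d,\dots,d)$; for vectors $v\ge w$ means entrywise. Let $X_*=\{x\in\mathbb Z^{2m}: x_1+x_{2m}=x_2+x_{2m-1}=\dots=x_m+x_{m+1}\}$ and $V=X_*\otimes\mathbb R\subset\mathbb R^{2m}$. Put $j^*=2m+1-j$ and $S_{2m}^*=\{\sigma\in S_{2m}:\sigma(j^* )=\sigma(j)^*\ \forall j\}$. Let $\widetilde W=X_*\rtimes S_{2m}^*$, acting on $\mathbb R^{2m}$ by affine transformations ($t_\lambda\sigma: x\mapsto\lambda+\sigma x$, where $S_{2m}$ permutes coordinates). The affine root hyperplanes in $V$ are the zero loci of $x\mapsto x_i-x_j-k$ for $1\le i<j\le 2m$, $k\in\mathbb Z$; the affine Weyl group $W_a\subset\widetilde W$ is the subgroup generated by the affine reflections of $V$ (lying in $\widetilde W$) across these hyperplanes. Take as base alcove $A=\{x\in V: x_{2m}-1<x_1<x_2<\dots<x_m<x_{m+1}\}$, let $\Omega$ be its stabilizer in $\widetilde W$, so $\widetilde W=W_a\rtimes\Omega$; $W_a$ is a Coxeter group generated by the reflections across the walls of $A$, with Bruhat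 order $\le$, extended to $\widetilde W$ by: $x\omega\le x'\omega'$ ($x,x'\in W_a$, $\omega,\omega'\in\Omega$) iff $\omega=\omega'$ and $x\le x'$. For $i=2mb+c$, $0\le c<2m$, put $\omega_i=((-1)^{(c)},0^{(2m-c)})-\mathbf b$. Let $W_I$ be the stabilizer in $\widetilde W$ of all $\omega_i$, $i\in2m\mathbb Z\pm I$ (integers congruent mod $2m$ to an element of $I\cup(-I)$). The Bruhat order on $\widetilde W/W_I$ is defined by comparing the unique minimal-length representatives of cosets. For $\lambda\in X_*$ let $t_\lambda$ be the translation element. A coset $\tilde w\in\widetilde W/W_I$ is $\mu$-admissible if there is $\sigma\in S^*_{2m}$ with $\tilde w\le t_{\sigma\mu}W_I$. It is wedge-permissible if for all $i\in2m\mathbb Z\pm I$: (P'1) $\mathbf 0\le\tilde w\cdot\omega_i-\omega_i\le\mathbf 2$; (P'2) the entries of $\tilde w\cdot\omega_i-\omega_i$ sum to $2m$; (P'3) $\#\{j:(\tilde w\cdot\omega_i-\omega_i)(j)=0\}\le s$. (These conditions do not depend on the coset representative.) *)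

theory Defs
  imports Complex_Main "HOL-Combinatorics.Permutations"
begin

text \<open>Coordinates are indexed by 1..2m; vectors are functions nat => int / real
  that vanish outside 1..2m.  Elements of the extended affine Weyl group
  t_lambda sigma are pairs (lambda, sigma).\<close>

type_synonym elt = "(nat \<Rightarrow> int) \<times> (nat \<Rightarrow> nat)"

definition dual :: "nat \<Rightarrow> nat \<Rightarrow> nat" where
  "dual m j = 2*m + 1 - j"

definition Xs :: "nat \<Rightarrow> (nat \<Rightarrow> int) set" where
  "Xs m = {l. (\<forall>t. t \<notin> {1..2*m} \<longrightarrow> l t = 0) \<and>
              (\<forall>t\<in>{1..m}. l t + l (dual m t) = l 1 + l (2*m))}"

definition Sstar :: "nat \<Rightarrow> (nat \<Rightarrow> nat) set" where
  "Sstar m = {\<sigma>. \<sigma> permutes {1..2*m} \<and> (\<forall>j\<in>{1..2*m}. \<sigma> (dual m j) = dual m (\<sigma> j))}"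

definition pvec :: "(nat \<Rightarrow> nat) \<Rightarrow> (nat \<Rightarrow> 'a) \<Rightarrow> nat \<Rightarrow> 'a" where
  "pvec \<sigma> x = (\<lambda>i. x (inv \<sigma> i))"

definition Wt :: "nat \<Rightarrow> elt set" where
  "Wt m = Xs m \<times> Sstar m"

definition wmult :: "elt \<Rightarrow> elt \<Rightarrow> elt" where
  "wmult a b = ((\<lambda>i. fst a i + pvec (snd a) (fst b) i), snd a \<circ> snd b)"

definition wone :: elt where
  "wone = ((\<lambda>_. 0), id)"

definition winv :: "elt \<Rightarrow> elt" where
  "winv a = ((\<lambda>i. - fst a (snd a i)), inv (snd a))"

definition act :: "elt \<Rightarrow> (nat \<Rightarrow> real) \<Rightarrow> (nat \<Rightarrow> real)" where
  "act w x = (\<lambda>i. of_int (fst w i) + pvec (snd w) x i)"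

definition actZ :: "elt \<Rightarrow> (nat \<Rightarrow> int) \<Rightarrow> (nat \<Rightarrow> int)" where
  "actZ w x = (\<lambda>i. fst w i + pvec (snd w) x i)"

definition Vsp :: "nat \<Rightarrow> (nat \<Rightarrow> real) set" where
  "Vsp m = {x. (\<forall>t. t \<notin> {1..2*m} \<longrightarrow> x t = 0) \<and>
              (\<forall>t\<in>{1..m}. x t + x (dual m t) = x 1 + x (2*m))}"

definition root_idx :: "nat \<Rightarrow> nat \<Rightarrow> nat \<Rightarrow> bool" where
  "root_idx m i j \<longleftrightarrow> 1 \<le> i \<and> i < j \<and> j \<le> 2*m"

definition Hyp :: "nat \<Rightarrow> nat \<Rightarrow> nat \<Rightarrow> int \<Rightarrow> (nat \<Rightarrow> real) set" where
  "Hyp m i j k = {x \<in> Vsp m. x i - x j = of_int k}"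

text \<open>w in W~ acts on V as the affine reflection across Hyp m i j k: an involutive
  (isometric, as every element of W~) affine map of V whose fixed locus is exactly that hyperplane.\<close>
definition is_refl :: "nat \<Rightarrow> nat \<Rightarrow> nat \<Rightarrow> int \<Rightarrow> elt \<Rightarrow> bool" where
  "is_refl m i j k w \<longleftrightarrow> w \<in> Wt m \<and> (\<forall>x\<in>Vsp m. act w (act w x) = x) \<and>
      {x \<in> Vsp m. act w x = x} = Hyp m i j k"

definition Refl_all :: "nat \<Rightarrow> elt set" where
  "Refl_all m = {w. \<exists>i j k. root_idx m i j \<and> is_refl m i j k w}"

inductive_set gen :: "elt set \<Rightarrow> elt set" for S where
  gen_one: "wone \<in> gen S"
| gen_step: "a \<in> gen S \<Longrightarrow> s \<in> S \<Longrightarrow> wmult a s \<in> gen S"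
| gen_step_inv: "a \<in> gen S \<Longrightarrow> s \<in> S \<Longrightarrow> wmult a (winv s) \<in> gen S"

definition Wa :: "nat \<Rightarrow> elt set" where
  "Wa m = gen (Refl_all m)"

definition Aalc :: "nat \<Rightarrow> (nat \<Rightarrow> real) set" where
  "Aalc m = {x \<in> Vsp m. x (2*m) - 1 < x 1 \<and> (\<forall>i\<in>{1..m}. x i < x (Suc i))}"

definition clA :: "nat \<Rightarrow> (nat \<Rightarrow> real) set" where
  "clA m = {x \<in> Vsp m. \<forall>e>0. \<exists>a\<in>Aalc m. \<forall>t\<in>{1..2*m}. \<bar>x t - a t\<bar> < e}"

definition is_wall :: "nat \<Rightarrow> nat \<Rightarrow> nat \<Rightarrow> int \<Rightarrow> bool" where
  "is_wall m i j k \<longleftrightarrow> root_idx m i j \<and>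
     (\<exists>p\<in>Hyp m i j k. \<exists>d>0. \<forall>y\<in>Hyp m i j k.
        (\<forall>t\<in>{1..2*m}. \<bar>y t - p t\<bar> < d) \<longrightarrow> y \<in> clA m)"

definition Simple :: "nat \<Rightarrow> elt set" where
  "Simple m = {w. \<exists>i j k. is_wall m i j k \<and> is_refl m i j k w}"

definition wprod :: "elt list \<Rightarrow> elt" where
  "wprod ws = foldr wmult ws wone"

definition coxlen :: "nat \<Rightarrow> elt \<Rightarrow> nat" where
  "coxlen m w = (LEAST n. \<exists>ws. length ws = n \<and> set ws \<subseteq> Simple m \<and> wprod ws = w)"

definition Trefl :: "nat \<Rightarrow> elt set" where
  "Trefl m = {wmult (wmult u s) (winv u) | u s. u \<in> Wa m \<and> s \<in> Simple m}"

text \<open>Bruhat order on W_a (Bjorner--Brenti, Def. 2.1.1).\<close>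
inductive bruhat :: "nat \<Rightarrow> elt \<Rightarrow> elt \<Rightarrow> bool" for m where
  bruhat_refl: "x \<in> Wa m \<Longrightarrow> bruhat m x x"
| bruhat_step: "bruhat m x y \<Longrightarrow> t \<in> Trefl m \<Longrightarrow> coxlen m y < coxlen m (wmult y t)
                 \<Longrightarrow> bruhat m x (wmult y t)"

definition Omega :: "nat \<Rightarrow> elt set" where
  "Omega m = {w \<in> Wt m. act w ` Aalc m = Aalc m}"

definition ext_le :: "nat \<Rightarrow> elt \<Rightarrow> elt \<Rightarrow> bool" where
  "ext_le m w w' \<longleftrightarrow> (\<exists>x x' \<omega>. x \<in> Wa m \<and> x' \<in> Wa m \<and> \<omega> \<in> Omega m \<and>
      w = wmult x \<omega> \<and> w' = wmult x' \<omega> \<and> bruhat m x x')"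

definition ext_len :: "nat \<Rightarrow> elt \<Rightarrow> nat" where
  "ext_len m w = (LEAST n. \<exists>x \<omega>. x \<in> Wa m \<and> \<omega> \<in> Omega m \<and> w = wmult x \<omega> \<and> coxlen m x = n)"

definition omega_vec :: "nat \<Rightarrow> int \<Rightarrow> nat \<Rightarrow> int" where
  "omega_vec m i = (\<lambda>t. if 1 \<le> t \<and> t \<le> 2*m
      then (if int t \<le> i mod (2 * int m) then -1 else 0) - i div (2 * int m) else 0)"

definition idx :: "nat \<Rightarrow> nat set \<Rightarrow> int set" where
  "idx m I = {i. \<exists>a\<in>I. i mod (2 * int m) = int a mod (2 * int m) \<or>
                         i mod (2 * int m) = (- int a) mod (2 * int m)}"

definition WI :: "nat \<Rightarrow> nat set \<Rightarrow> elt set" where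
  "WI m I = {w \<in> Wt m. \<forall>i\<in>idx m I. actZ w (omega_vec m i) = omega_vec m i}"

definition coset :: "nat \<Rightarrow> nat set \<Rightarrow> elt \<Rightarrow> elt set" where
  "coset m I w = (\<lambda>u. wmult w u) ` WI m I"

definition is_minrep :: "nat \<Rightarrow> elt set \<Rightarrow> elt \<Rightarrow> bool" where
  "is_minrep m C w \<longleftrightarrow> w \<in> C \<and> (\<forall>u\<in>C. ext_len m w \<le> ext_len m u)"

definition coset_le :: "nat \<Rightarrow> elt set \<Rightarrow> elt set \<Rightarrow> bool" where
  "coset_le m C C' \<longleftrightarrow> (\<exists>w w'. is_minrep m C w \<and> is_minrep m C' w' \<and> ext_le m w w')"

definition mu_vec :: "nat \<Rightarrow> nat \<Rightarrow> nat \<Rightarrow> int" where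
  "mu_vec m s = (\<lambda>t. if 1 \<le> t \<and> t \<le> s then 2
                     else if s < t \<and> t \<le> 2*m - s then 1 else 0)"

definition mu_admissible :: "nat \<Rightarrow> nat \<Rightarrow> nat set \<Rightarrow> elt set \<Rightarrow> bool" where
  "mu_admissible m s I C \<longleftrightarrow>
     (\<exists>\<sigma>\<in>Sstar m. coset_le m C (coset m I (pvec \<sigma> (mu_vec m s), id)))"

definition wedge_permissible :: "nat \<Rightarrow> nat \<Rightarrow> nat set \<Rightarrow> elt \<Rightarrow> bool" where
  "wedge_permissible m s I w \<longleftrightarrow> (\<forall>i\<in>idx m I.
     (let v = (\<lambda>t. actZ w (omega_vec m i) t - omega_vec m i t) in
       (\<forall>t\<in>{1..2*m}. 0 \<le> v t \<and> v t \<le> 2) \<and>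
       (\<Sum>t=1..2*m. v t) = 2 * int m \<and>
       card {t\<in>{1..2*m}. v t = 0} \<le> s))"

end

theory Submission
  imports Defs
begin

text \<open>An element \<^term>\<open>w\<close> of the extended affine Weyl group is encoded by the affine permutation
  \<open>f = aff w\<close> of the integers, with \<open>f (a + N) = f a + N\<close> and \<open>f (1 - a) = c N + 1 - f a\<close> for
  \<open>N = 2 m\<close>; this describes how \<open>w\<close> pulls back points of \<open>V\<close>, extended to the integers by
  \<open>X (a + N) = X a + 1\<close>. Affine hyperplanes are the equations \<open>X a = X b\<close>, the base alcove consists of the
  increasing \<open>X\<close>, and a hyperplane separates the alcove of \<open>w\<close> from the base alcove iff \<open>(a, b)\<close> is an
  inversion of \<open>f\<close>. Deleting letters from words (strong exchange) shows that the Bruhat order is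
  generated by the steps that turn a non-inversion of \<open>f\<close> into an inversion.

  Such a step moves two entries of the vectors \<open>w \<omega>\<^sub>i - \<omega>\<^sub>i\<close> apart, so permissibility is inherited
  downwards, and translations by conjugates of \<open>\<mu>\<close> are permissible. Conversely, every permissible element
  that is not in the coset of such a translation admits a step to a larger permissible element. Say that a
  coordinate is high (low) if it takes both values 1 and 2 (0 and 1) as \<open>i\<close> varies. If one high
  coordinate falls where another one rises, they are merged into one that stays at 2 as long as possible.
  Otherwise choose a high coordinate that falls and a low one that falls next, as close together as possible; raise the
  former and lower the latter in between. If no coordinate varies, raise one of a dual pair of entries
  1 and lower the other. The displacement \<open>\<Sum> (f a - a)\<^sup>2\<close> grows in every step, so this ends at a
  translation. A chain of steps descends to minimal coset representatives because a representative
  without descents inside its coset is unique up to \<open>\<Omega>\<close>.\<close>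

text \<open>The entry of \<open>w \<omega>\<^sub>i - \<omega>\<^sub>i\<close> at \<open>a\<close> is
  \<open>(i - a) div N - (i - f a) div N\<close>. As \<open>i\<close> grows, it rises at the
  translates of \<open>a\<close> and falls at the translates of \<open>f a\<close>, so each
  coordinate takes at most two consecutive values and becomes an arc on a circle of length
  \<open>N\<close>. Bruhat steps exchange end points of such arcs. The obstacle is (P'3). A
  reflection always moves the mirror pair too, so spreading two entries may create two new zeros at
  one index. Choosing the closest pair excludes this, and it also supplies the room for one new
  zero: where a high entry has just fallen from 2, there are fewer twos than at the preceding index,
  and by (P'2) there are as many zeros as twos. Multiplying \<open>w\<close> by a reflection on the
  left permutes the arguments of \<open>f\<close>; multiplying it by \<open>W_I\<close> on the right
  permutes the values. Both sides can be read off one reflection since \<open>f\<close> conjugates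
  \<open>rfl a b\<close> into \<open>rfl (f a) (f b)\<close>. This is how steps inside a coset are
  told from steps between cosets.\<close>

definition zeta :: "int \<Rightarrow> int" where "zeta v = (if v = 0 then 1 else 0)"

section \<open>Congruence modulo \<open>N\<close> and the duality exchanging \<open>x\<close> and
  \<open>1 - x\<close>\<close>

locale affine_gsp =
  fixes m :: nat
  assumes m_pos: "1 \<le> m"
begin

definition N :: int where "N = 2 * int m"

lemma N_ge: "N \<ge> 2" "N > 0" "N \<noteq> 0" and even_N: "even N"
  using m_pos by (auto simp: N_def)

definition cg :: "int \<Rightarrow> int \<Rightarrow> bool" where "cg x y \<longleftrightarrow> x mod N = y mod N"

lemma cg_refl [simp]: "cg x x" by (simp add: cg_def)
lemma cg_sym: "cg x y \<Longrightarrow> cg y x" by (simp add: cg_def)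
lemma cg_commute: "cg x y \<longleftrightarrow> cg y x" by (auto simp: cg_def)

lemma cg_iff: "cg x y \<longleftrightarrow> (\<exists>k. x = y + k * N)"
proof
  assume "cg x y"
  then have "N dvd x - y" by (simp add: cg_def mod_eq_dvd_iff)
  then obtain k where "x - y = N * k" by (rule dvdE)
  then show "\<exists>k. x = y + k * N" by (intro exI[of _ k]) (simp add: algebra_simps)
qed (auto simp: cg_def)

lemma cgE: assumes "cg x y" obtains k where "x = y + k * N"
  using assms by (auto simp: cg_iff)

lemma cg_add [simp]: "cg (x + k * N) y \<longleftrightarrow> cg x y" "cg y (x + k * N) \<longleftrightarrow> cg y x"
  "cg (x + N) y \<longleftrightarrow> cg x y" "cg y (x + N) \<longleftrightarrow> cg y x"
  by (simp_all add: cg_def)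

lemma cg_diff1 [simp]: "cg (1 - x) (1 - y) \<longleftrightarrow> cg x y"
proof -
  have "cg (1 - x) (1 - y)" if "cg x y" for x y
    using that unfolding cg_def by (rule mod_diff_cong[OF refl])
  from this[of x y] this[of "1 - x" "1 - y"] show ?thesis by auto
qed

lemma cg_dual_swap: "cg (1 - x) y \<longleftrightarrow> cg x (1 - y)"
  using cg_diff1[of "1 - x" y] by (simp add: cg_commute)

text \<open>\<open>N\<close> is even while \<open>x - (1 - x)\<close> is odd.\<close>

lemma not_cg_dual [simp]: "\<not> cg x (1 - x)" "\<not> cg (1 - x) x"
proof -
  show "\<not> cg x (1 - x)"
  proof
    assume "cg x (1 - x)"
    then obtain k where "x = 1 - x + k * N" by (rule cgE)
    then have "2 * x - k * N = 1" by simp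
    moreover have "even (2 * x - k * N)" using even_N by simp
    ultimately show False by simp
  qed
  then show "\<not> cg (1 - x) x" using cg_sym by blast
qed

lemma cg_small: "cg x y \<Longrightarrow> x < y + N \<Longrightarrow> y < x + N \<Longrightarrow> x = y"
proof -
  assume "cg x y" and *: "x < y + N" "y < x + N"
  then obtain k where k: "x = y + k * N" by (auto elim: cgE)
  then have "k * N < 1 * N" "(- 1) * N < k * N" using * by simp_all
  then have "k < 1" "- 1 < k" using N_ge by (simp_all only: mult_less_cancel_right_pos)
  then show "x = y" using k by simp
qed

subsection \<open>Affine permutations and reflections\<close>

text \<open>The set of all \<open>aff w\<close>. The last clause combines the compatibility of the
  permutation with \<open>j \<mapsto> 2 m + 1 - j\<close> and the constancy of the sums of dual
  coordinates of the translation part; \<open>c\<close> is that common sum.\<close>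

definition AF :: "(int \<Rightarrow> int) set" where
  "AF = {f. bij f \<and> (\<forall>a. f (a + N) = f a + N) \<and> (\<exists>c. \<forall>a. f (1 - a) = c * N + 1 - f a)}"

lemma AF_bij: "f \<in> AF \<Longrightarrow> bij f" by (simp add: AF_def)
lemma AF_eq: "f \<in> AF \<Longrightarrow> f a = f b \<longleftrightarrow> a = b"
  by (meson AF_bij bij_is_inj injD)
lemma AF_N: "f \<in> AF \<Longrightarrow> f (a + N) = f a + N" by (simp add: AF_def)

lemma shift_fun:
  fixes F :: "int \<Rightarrow> 'a::comm_ring_1"
  assumes "\<And>a. F (a + N) = F a + c"
  shows "F (a + k * N) = F a + of_int k * c"
proof (induction k rule: int_induct[where k = 0])
  case (step1 i)
  have "F (a + (i + 1) * N) = F (a + i * N + N)" by (simp add: algebra_simps)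
  also have "\<dots> = F (a + i * N) + c" by (rule assms)
  finally show ?case unfolding step1(2) by (simp add: algebra_simps)
next
  case (step2 i)
  have "F (a + i * N) = F (a + (i - 1) * N + N)" by (simp add: algebra_simps)
  also have "\<dots> = F (a + (i - 1) * N) + c" by (rule assms)
  finally show ?case unfolding step2(2) by (simp add: algebra_simps)
qed simp

lemma periodic_fun:
  assumes "\<And>a. F (a + N) = F a"
  shows "F (a + k * N) = F a"
proof (induction k rule: int_induct[where k = 0])
  case (step1 i)
  have "F (a + (i + 1) * N) = F (a + i * N + N)" by (simp add: algebra_simps)
  also have "\<dots> = F (a + i * N)" by (rule assms)
  finally show ?case unfolding step1(2) .
next
  case (step2 i)
  have "F (a + i * N) = F (a + (i - 1) * N + N)" by (simp add: algebra_simps)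
  also have "\<dots> = F (a + (i - 1) * N)" by (rule assms)
  finally show ?case unfolding step2(2) ..
qed simp

lemma periodic_cg: "(\<And>a. F (a + N) = F a) \<Longrightarrow> cg a b \<Longrightarrow> F a = F b"
  by (auto elim!: cgE simp: periodic_fun)

lemma AF_shift: "f \<in> AF \<Longrightarrow> f (a + k * N) = f a + k * N"
  using shift_fun[of f N a k] by (simp add: AF_N)

lemma AF_cg: assumes "f \<in> AF" shows "cg (f a) (f b) \<longleftrightarrow> cg a b"
proof
  assume "cg (f a) (f b)"
  then obtain k where "f a = f b + k * N" by (rule cgE)
  then have "f a = f (b + k * N)" using assms by (simp add: AF_shift)
  then have "a = b + k * N" using AF_eq[OF assms] by blast
  then show "cg a b" by simp
next
  assume "cg a b"
  then show "cg (f a) (f b)" using assms by (auto elim!: cgE simp: AF_shift)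
qed

lemma AF_dual_cg: assumes "f \<in> AF" shows "cg (f x) (1 - f a) \<longleftrightarrow> cg x (1 - a)"
proof -
  obtain c where c: "\<And>a. f (1 - a) = c * N + 1 - f a" using assms by (auto simp: AF_def)
  have "1 - f a = f (1 - a) + (- c) * N" using c[of a] by simp
  then have "cg (f x) (1 - f a) \<longleftrightarrow> cg (f x) (f (1 - a))" by (simp only: cg_add)
  then show ?thesis using AF_cg[OF assms] by simp
qed

lemma AF_id: "id \<in> AF" by (auto simp: AF_def intro: exI[of _ 0])

lemma AF_comp: assumes "f \<in> AF" "g \<in> AF" shows "f \<circ> g \<in> AF"
proof -
  obtain c where c: "\<And>a. f (1 - a) = c * N + 1 - f a" using assms by (auto simp: AF_def)
  obtain d where d: "\<And>a. g (1 - a) = d * N + 1 - g a" using assms by (auto simp: AF_def)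
  have "(f \<circ> g) (1 - a) = (c + d) * N + 1 - (f \<circ> g) a" for a
  proof -
    have "f (g (1 - a)) = f (1 - g a + d * N)" by (simp add: d algebra_simps)
    also have "\<dots> = c * N + 1 - f (g a) + d * N" by (simp only: AF_shift[OF assms(1)] c)
    finally show ?thesis by (simp add: algebra_simps)
  qed
  then show ?thesis using assms by (auto simp: AF_def intro: bij_comp)
qed

lemma AF_inv: assumes "f \<in> AF" shows "inv f \<in> AF"
proof -
  obtain c where c: "\<And>a. f (1 - a) = c * N + 1 - f a" using assms by (auto simp: AF_def)
  have b: "bij f" by (rule AF_bij[OF assms])
  have fi: "f (inv f x) = x" for x by (simp add: b bij_is_surj surj_f_inv_f)
  have if': "inv f (f x) = x" for x by (simp add: b bij_is_inj)
  have "inv f (a + N) = inv f a + N" for a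
    using if'[of "inv f a + N"] AF_N[OF assms, of "inv f a"] fi[of a] by simp
  moreover have "inv f (1 - a) = (- c) * N * (- 1) * (- 1) + 1 - inv f a" for a
  proof -
    have "f (1 - inv f a + (- c) * N) = c * N + 1 - a + (- c) * N"
      by (simp only: AF_shift[OF assms] c fi)
    then have "f (1 - inv f a + (- c) * N) = 1 - a" by simp
    then have "inv f (1 - a) = 1 - inv f a + (- c) * N" using if' by metis
    then show ?thesis by simp
  qed
  ultimately show ?thesis using b by (auto simp: AF_def bij_imp_bij_inv simp del: mult_minus_left mult_minus_right)
qed

text \<open>To stay in \<open>AF\<close>, the exchange of \<open>a\<close> and \<open>b\<close> is
  repeated on all translates and on the mirror images \<open>1 - a\<close>, \<open>1 - b\<close>. If
  \<open>b\<close> is congruent to \<open>1 - a\<close>, the mirror classes coincide with the first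
  two and the formulas agree there.\<close>

definition rfl :: "int \<Rightarrow> int \<Rightarrow> int \<Rightarrow> int" where
  "rfl a b x = (if cg x a then x - a + b else if cg x b then x - b + a
     else if cg x (1 - a) then x + a - b else if cg x (1 - b) then x + b - a else x)"

lemma rfl_at [simp]: "rfl a b a = b" "\<not> cg a b \<Longrightarrow> rfl a b b = a"
  by (auto simp: rfl_def cg_commute)

lemma cg_plus: "cg (x + c) (y + c) \<longleftrightarrow> cg x y" "cg (x - c) (y - c) \<longleftrightarrow> cg x y"
  by (simp_all add: cg_def mod_eq_dvd_iff)

lemma rfl_swap: assumes "\<not> cg a b" shows "rfl b a = rfl a b"
proof
  fix x
  have "\<not> (cg x a \<and> cg x b)" "\<not> (cg x (1 - a) \<and> cg x (1 - b))"
    using assms cg_diff1[of a b] unfolding cg_def by auto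
  then show "rfl b a x = rfl a b x"
    unfolding rfl_def by (cases "cg x a"; cases "cg x b"; cases "cg x (1-a)"; cases "cg x (1-b)"; simp)
qed

lemma rfl_N: "rfl a b (x + N) = rfl a b x + N"
  by (simp add: rfl_def)

lemma rfl_dual: "\<not> cg a b \<Longrightarrow> rfl a b (1 - x) = 1 - rfl a b x"
proof -
  assume ab: "\<not> cg a b"
  have "cg (1 - x) a \<longleftrightarrow> cg x (1 - a)" "cg (1 - x) b \<longleftrightarrow> cg x (1 - b)"
     "cg (1 - x) (1 - a) \<longleftrightarrow> cg x a" "cg (1 - x) (1 - b) \<longleftrightarrow> cg x b"
    by (simp_all add: cg_dual_swap)
  note * = this
  have d: "\<not> (cg x a \<and> cg x (1 - a))" "\<not> (cg x b \<and> cg x (1 - b))" "\<not> (cg x a \<and> cg x b)"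
    "\<not> (cg x (1-a) \<and> cg x (1-b))"
    using ab not_cg_dual(1)[of a] not_cg_dual(1)[of b] cg_diff1[of a b] unfolding cg_def by auto
  then show ?thesis unfolding rfl_def *
    by (cases "cg x a"; cases "cg x b"; cases "cg x (1-a)"; cases "cg x (1-b)"; simp)
qed

lemma rfl_rfl: "\<not> cg a b \<Longrightarrow> rfl a b (rfl a b x) = x"
proof -
  assume ab: "\<not> cg a b"
  have ba: "\<not> cg b a" using ab cg_sym by blast
  have p: "cg (x - a + b) b \<longleftrightarrow> cg x a" "cg (x - b + a) a \<longleftrightarrow> cg x b"
     by (simp_all add: cg_def mod_eq_dvd_iff)
  have q: "cg (x + a - b) (1 - b) \<longleftrightarrow> cg x (1 - a)" "cg (x + b - a) (1 - a) \<longleftrightarrow> cg x (1 - b)"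
     by (simp_all add: cg_def mod_eq_dvd_iff algebra_simps)
  consider "cg x a" | "\<not> cg x a" "cg x b" | "\<not> cg x a" "\<not> cg x b" "cg x (1 - a)"
    | "\<not> cg x a" "\<not> cg x b" "\<not> cg x (1 - a)" "cg x (1 - b)"
    | "\<not> cg x a" "\<not> cg x b" "\<not> cg x (1 - a)" "\<not> cg x (1 - b)" by blast
  then show ?thesis
  proof cases
    case 1
    then have "cg (x - a + b) b" using p by simp
    moreover have "\<not> cg (x - a + b) a" using ba calculation unfolding cg_def by simp
    ultimately show ?thesis using 1 by (simp add: rfl_def)
  next
    case 2
    then have "cg (x - b + a) a" using p by simp
    then show ?thesis using 2 by (simp add: rfl_def)
  next
    case 3
    then have 1: "cg (x + a - b) (1 - b)" using q by simp
    then have n1: "\<not> cg (x + a - b) b" using not_cg_dual(1)[of a] not_cg_dual(1)[of b] unfolding cg_def by auto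
    have n2: "\<not> cg (x + a - b) (1 - a)" using 1 ab cg_diff1[of a b] unfolding cg_def by auto
    have n3: "\<not> cg (x + a - b) a"
    proof
      assume "cg (x + a - b) a"
      then have "cg (1 - b) a" using 1 unfolding cg_def by simp
      then have "cg b (1 - a)" by (simp add: cg_dual_swap)
      then show False using 3 unfolding cg_def by simp
    qed
    show ?thesis using 3 1 n1 n2 n3 by (simp add: rfl_def)
  next
    case 4
    then have 1: "cg (x + b - a) (1 - a)" using q by simp
    then have n1: "\<not> cg (x + b - a) a" using not_cg_dual(1)[of a] not_cg_dual(1)[of b] unfolding cg_def by auto
    have n3: "\<not> cg (x + b - a) b"
    proof
      assume "cg (x + b - a) b"
      then have "cg (1 - a) b" using 1 unfolding cg_def by simp
      then have "cg a (1 - b)" by (simp add: cg_dual_swap)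
      then show False using 4 unfolding cg_def by simp
    qed
    show ?thesis using 4 1 n1 n3 by (simp add: rfl_def)
  next
    case 5 then show ?thesis by (simp add: rfl_def)
  qed
qed

lemma rfl_o: "\<not> cg a b \<Longrightarrow> rfl a b \<circ> rfl a b = id"
  by (rule ext) (simp add: rfl_rfl)

lemma rfl_AF: "\<not> cg a b \<Longrightarrow> rfl a b \<in> AF"
  unfolding AF_def
  by (auto intro!: o_bij[OF rfl_o rfl_o] exI[of _ 0] simp: rfl_N rfl_dual)

lemma rfl_shift: "rfl (a + k * N) (b + k * N) = rfl a b"
proof -
  have "1 - (c + k * N) = 1 - c + (- k) * N" for c by simp
  then have "cg x (1 - (c + k * N)) \<longleftrightarrow> cg x (1 - c)" for x c by (metis cg_add(2))
  then show ?thesis by (intro ext) (simp add: rfl_def)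
qed

lemma rfl_mirror: "\<not> cg a b \<Longrightarrow> rfl (1 - a) (1 - b) = rfl a b"
proof (rule ext)
  fix x assume ab: "\<not> cg a b"
  have d: "\<not> (cg x a \<and> cg x (1 - a))" "\<not> (cg x b \<and> cg x (1 - b))" "\<not> (cg x a \<and> cg x b)"
    "\<not> (cg x (1-a) \<and> cg x (1-b))"
    using ab not_cg_dual(1)[of a] not_cg_dual(1)[of b] cg_diff1[of a b] unfolding cg_def by auto
  have e: "cg a (1 - b)" "x + a - b = x - b + a" if "cg x a" "cg x (1-b)" 
    using that unfolding cg_def by auto
  show "rfl (1 - a) (1 - b) x = rfl a b x"
    using d e by (cases "cg x a"; cases "cg x b"; cases "cg x (1-a)"; cases "cg x (1-b)"; simp add: rfl_def)
qed

lemma rfl_conj: assumes "f \<in> AF" shows "f (rfl a b x) = rfl (f a) (f b) (f x)"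
proof -
  obtain c where c: "\<And>a. f (1 - a) = c * N + 1 - f a" using assms by (auto simp: AF_def)
  have *: "f (y + z) = f w + f y - f w'" if "cg y w'" "w = w' + z" for y z w w'
  proof -
    obtain k where "y = w' + k * N" using \<open>cg y w'\<close> by (rule cgE)
    then have "y + z = w + k * N" "y = w' + k * N" using that by simp_all
    then show ?thesis by (simp only: AF_shift[OF assms])
  qed
  show ?thesis
    unfolding rfl_def AF_cg[OF assms] AF_dual_cg[OF assms]
    using *[of x a b "b - a"] *[of x b a "a - b"] *[of x "1 - a" "1 - b" "a - b"]
      *[of x "1 - b" "1 - a" "b - a"] c[of a] c[of b]
    by (simp add: algebra_simps)
qed

lemma rfl_conj': "f \<in> AF \<Longrightarrow> f \<circ> rfl a b = rfl (f a) (f b) \<circ> f"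
  by (rule ext) (simp add: rfl_conj)

lemma rfl_unique: assumes "\<not> cg c d" "rfl c d a = b" "a \<noteq> b" shows "rfl a b = rfl c d"
proof -
  consider "cg a c" | "cg a d" "\<not> cg a c" | "cg a (1 - c)" "\<not> cg a c" "\<not> cg a d"
    | "cg a (1 - d)" "\<not> cg a c" "\<not> cg a d" "\<not> cg a (1 - c)" 
    | "\<not> cg a c" "\<not> cg a d" "\<not> cg a (1 - c)" "\<not> cg a (1 - d)" by blast
  then show ?thesis
  proof cases
    case 1
    then obtain k where k: "a = c + k * N" by (rule cgE)
    then have "b = d + k * N" using assms(2) 1 by (simp add: rfl_def)
    then show ?thesis using k by (simp only: rfl_shift)
  next
    case 2
    then obtain k where k: "a = d + k * N" by (auto elim: cgE)
    then have "b = c + k * N" using assms(2) 2 by (simp add: rfl_def)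
    then show ?thesis using k rfl_swap[OF assms(1)] by (simp only: rfl_shift)
  next
    case 3
    then obtain k where k: "a = 1 - c + k * N" by (auto elim: cgE)
    then have "b = 1 - d + k * N" using assms(2) 3 by (auto simp: rfl_def)
    then show ?thesis using k rfl_mirror[OF assms(1)] by (simp only: rfl_shift)
  next
    case 4
    then obtain k where k: "a = 1 - d + k * N" by (auto elim: cgE)
    then have "b = 1 - c + k * N" using assms(2) 4 by (auto simp: rfl_def)
    moreover have "\<not> cg (1 - c) (1 - d)" using assms(1) by simp
    ultimately show ?thesis using k rfl_mirror[OF assms(1)] rfl_swap[of "1 - c" "1 - d"]
      by (simp only: rfl_shift simp_thms)
  next
    case 5
    then have "a = b" using assms(2) by (simp add: rfl_def)
    then show ?thesis using assms by simp
  qed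
qed

lemma rfl_adj_le: "\<not> cg c (c + 1) \<Longrightarrow> \<bar>rfl c (c + 1) x - x\<bar> \<le> 1"
  by (auto simp: rfl_def)

lemma not_cg_adj: "\<not> cg c (c + 1)" "\<not> cg (c + 1) c" 
proof -
  show "\<not> cg c (c + 1)"
  proof
    assume "cg c (c + 1)"
    then have "c = c + 1" using N_ge by (intro cg_small) auto
    then show False by simp
  qed
  then show "\<not> cg (c + 1) c" using cg_sym by blast
qed

text \<open>An adjacent reflection moves every integer by at most 1, so it can invert
  \<open>a < b\<close> only by exchanging the two.\<close>

lemma rfl_adj_inversion:
  assumes "a < b" "rfl c (c + 1) a > rfl c (c + 1) b"
  shows "rfl a b = rfl c (c + 1)"
proof -
  have n: "\<not> cg c (c + 1)" by (rule not_cg_adj)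
  have 1: "rfl c (c + 1) a \<noteq> rfl c (c + 1) b" using assms(2) by simp
  have "rfl c (c + 1) a \<le> a + 1" "rfl c (c + 1) b \<ge> b - 1"
    using rfl_adj_le[OF n, of a] rfl_adj_le[OF n, of b] by linarith+
  then have "rfl c (c + 1) a = b" using assms by linarith
  then show ?thesis using rfl_unique[OF n, of a b] assms(1) by simp
qed

section \<open>Sums over the residues modulo \<open>N\<close>\<close>

lemma sum_residues:
  fixes F :: "int \<Rightarrow> 'a::comm_monoid_add"
  assumes F: "\<And>a. F (a + N) = F a" and g: "\<And>x y. cg (g x) (g y) \<Longrightarrow> cg x y"
  shows "(\<Sum>x\<in>{1..N}. F (g x)) = (\<Sum>x\<in>{1..N}. F x)"
proof -
  let ?h = "\<lambda>x. (g x - 1) mod N + 1"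
  have hc: "cg (?h x) (g x)" for x
  proof -
    have "cg ((g x - 1) mod N) (g x - 1)" by (simp add: cg_def)
    then have "cg ((g x - 1) mod N + 1) (g x - 1 + 1)" by (simp only: cg_plus)
    then show ?thesis by simp
  qed
  have inj: "inj_on ?h {1..N}"
  proof (rule inj_onI)
    fix x y assume xy: "x \<in> {1..N}" "y \<in> {1..N}" "?h x = ?h y"
    then have "cg (g x) (g y)" using hc[of x] hc[of y] unfolding cg_def by simp
    then have "cg x y" by (rule g)
    then show "x = y" using xy by (intro cg_small) auto
  qed
  have sub: "?h ` {1..N} \<subseteq> {1..N}" 
  proof
    fix z assume "z \<in> ?h ` {1..N}"
    then obtain x where "z = ?h x" by auto
    then show "z \<in> {1..N}" using pos_mod_bound[OF N_ge(2), of "g x - 1"] pos_mod_sign[OF N_ge(2), of "g x - 1"]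
      unfolding atLeastAtMost_iff by linarith
  qed
  have img: "?h ` {1..N} = {1..N}"
    using endo_inj_surj[OF _ sub inj] by simp
  have "(\<Sum>x\<in>{1..N}. F (g x)) = (\<Sum>x\<in>{1..N}. F (?h x))"
    using periodic_cg[of F, OF F hc] by simp
  also have "\<dots> = (\<Sum>x\<in>{1..N}. F x)"
    using sum.reindex[OF inj, of F] img by simp
  finally show ?thesis .
qed

lemma sum_AF:
  fixes F :: "int \<Rightarrow> 'a::comm_monoid_add"
  assumes "\<And>a. F (a + N) = F a" "g \<in> AF"
  shows "(\<Sum>x\<in>{1..N}. F (g x)) = (\<Sum>x\<in>{1..N}. F x)"
  using assms by (intro sum_residues) (simp_all add: AF_cg)

lemma sum_dual:
  fixes F :: "int \<Rightarrow> 'a::comm_monoid_add"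
  assumes "\<And>a. F (a + N) = F a"
  shows "(\<Sum>x\<in>{1..N}. F (1 - x)) = (\<Sum>x\<in>{1..N}. F x)"
  using assms by (intro sum_residues) simp_all

text \<open>Inequalities between sums can thus be checked on the pairs \<open>x\<close>,
  \<open>rfl a b x\<close>; doubling the sum avoids a choice of orbit representatives.\<close>

lemma sum_pair:
  fixes F :: "int \<Rightarrow> 'a::comm_ring_1"
  assumes "\<And>a. F (a + N) = F a" "\<not> cg a b"
  shows "2 * (\<Sum>x\<in>{1..N}. F x) = (\<Sum>x\<in>{1..N}. F x + F (rfl a b x))"
  using sum_AF[of F, OF assms(1) rfl_AF[OF assms(2)]] by (simp add: sum.distrib)

lemma sum_indicator: "(\<Sum>x\<in>{1..N}. if cg x a then 1 else 0 :: int) = 1"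
proof -
  let ?r = "(a - 1) mod N + 1"
  have r: "?r \<in> {1..N}"
    using pos_mod_bound[OF N_ge(2), of "a - 1"] pos_mod_sign[OF N_ge(2), of "a - 1"]
    unfolding atLeastAtMost_iff by linarith
  have rc: "cg ?r a"
  proof -
    have "cg ((a - 1) mod N) (a - 1)" by (simp add: cg_def)
    then have "cg ((a - 1) mod N + 1) (a - 1 + 1)" by (simp only: cg_plus)
    then show ?thesis by simp
  qed
  have "cg x a \<longleftrightarrow> x = ?r" if "x \<in> {1..N}" for x
  proof
    assume "cg x a"
    then have "cg x ?r" using rc unfolding cg_def by simp
    then show "x = ?r" using cg_small[of x ?r] that r unfolding atLeastAtMost_iff by linarith
  qed (use rc in simp)
  then have "(\<Sum>x\<in>{1..N}. if cg x a then 1 else 0 :: int) = (\<Sum>x\<in>{1..N}. if x = ?r then 1 else 0)"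
    by (intro sum.cong) auto
  also have "\<dots> = 1" using r by simp
  finally show ?thesis .
qed

subsection \<open>Steps and permissibility\<close>

lemma div_N_eqI: "k * N \<le> x \<Longrightarrow> x < k * N + N \<Longrightarrow> x div N = k"
  using N_ge(2) by (intro int_div_pos_eq[where r = "x - k * N"]) (auto simp: algebra_simps)

lemma div_N_bounds: "N * (x div N) \<le> x" "x < N * (x div N) + N"
  using N_ge(2) pos_mod_bound[OF N_ge(2), of x] pos_mod_sign[OF N_ge(2), of x] mult_div_mod_eq[of N x]
  by linarith+

text \<open>\<open>Om i\<close> is the vector \<open>\<omega>\<^sub>i\<close>, extended to the integers, and \<open>V f i\<close> the vector \<open>w \<omega>\<^sub>i - \<omega>\<^sub>i\<close> for \<open>f = aff w\<close>.\<close>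

definition Om :: "int \<Rightarrow> int \<Rightarrow> int" where "Om i a = - 1 - (i - a) div N"

lemma Om_shift: "Om i (a + k * N) = Om i a + k"
proof -
  have "(i - (a + k * N)) div N = (i - a + (- k) * N) div N" by (simp add: algebra_simps)
  also have "\<dots> = - k + (i - a) div N" using N_ge(3) by (rule div_mult_self1)
  finally show ?thesis by (simp add: Om_def)
qed

lemma Om_shift': "Om (i + k * N) a = Om i a - k"
proof -
  have "(i + k * N - a) div N = (i - a + k * N) div N" by (simp add: algebra_simps)
  also have "\<dots> = k + (i - a) div N" using N_ge(3) by (rule div_mult_self1)
  finally show ?thesis by (simp add: Om_def)
qed

lemma Om_mono: "a \<le> b \<Longrightarrow> Om i a \<le> Om i b"
  using N_ge(2) by (simp add: Om_def zdiv_mono1)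

lemma Om_dual: "Om (- i) (1 - a) = - 1 - Om i a"
proof -
  define k where "k = (i - a) div N"
  have "N * k \<le> i - a" "i - a < N * k + N" unfolding k_def by (rule div_N_bounds)+
  then have "(- i - (1 - a)) div N = - 1 - k" by (intro div_N_eqI) (simp_all add: algebra_simps)
  then show ?thesis by (simp add: Om_def k_def)
qed

definition V :: "(int \<Rightarrow> int) \<Rightarrow> int \<Rightarrow> int \<Rightarrow> int" where "V f i a = Om i (f a) - Om i a"

lemma V_shift: "f \<in> AF \<Longrightarrow> V f i (a + k * N) = V f i a"
  by (simp add: V_def AF_shift Om_shift)

lemma V_N: "f \<in> AF \<Longrightarrow> V f i (a + N) = V f i a"
  using V_shift[of f i a 1] by simp

lemma V_shift': "V f (i + k * N) a = V f i a"
  by (simp add: V_def Om_shift')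

lemma V_div: "V f i a = (i - a) div N - (i - f a) div N"
  by (simp add: V_def Om_def)

lemma V_dual:
  assumes "f (1 - a) = c * N + 1 - f a"
  shows "V f (- i) (1 - a) = c - V f i a"
proof -
  have "f (1 - a) = 1 - f a + c * N" using assms by simp
  then show ?thesis by (simp only: V_def Om_shift Om_dual)
qed

lemma V_dual':
  assumes "f (1 - a) = c * N + 1 - f a"
  shows "V f i (1 - a) = c - V f (- i) a"
  using V_dual[OF assms, of "- i"] by simp

definition sumV where "sumV f i = (\<Sum>x\<in>{1..N}. V f i x)"

text \<open>\<open>Om i - Om j\<close> is periodic although \<open>Om i\<close> is not, so
  \<open>f\<close> merely permutes its values on the residues.\<close>

lemma sumV_indep: assumes "f \<in> AF" shows "sumV f i = sumV f j"
proof -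
  let ?F = "\<lambda>a. Om i a - Om j a"
  have "?F (a + N) = ?F a" for a
    using Om_shift[of i a 1] Om_shift[of j a 1] by simp
  then have "(\<Sum>x\<in>{1..N}. ?F (f x)) = (\<Sum>x\<in>{1..N}. ?F x)" by (rule sum_AF[OF _ assms])
  then have "(\<Sum>x\<in>{1..N}. ?F (f x) - ?F x) = 0" by (simp add: sum_subtractf)
  then have "(\<Sum>x\<in>{1..N}. V f i x - V f j x) = 0" by (simp add: V_def algebra_simps)
  then show ?thesis by (simp add: sumV_def sum_subtractf)
qed

text \<open>Pairing \<open>a\<close> with \<open>1 - a\<close> exchanges \<open>i\<close> and
  \<open>- i\<close>, and the sum is the same at both. This turns (P'2) into
  \<open>c = 2\<close>.\<close>

lemma sumV_dual:
  assumes "f \<in> AF" "\<And>a. f (1 - a) = c * N + 1 - f a"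
  shows "2 * sumV f i = c * N"
proof -
  have "sumV f (- i) = (\<Sum>x\<in>{1..N}. V f (- i) (1 - x))"
    unfolding sumV_def using sum_dual[of "V f (- i)"] V_N[OF assms(1)] by simp
  also have "\<dots> = c * N - sumV f i"
    using V_dual[of f _ c, OF assms(2)] N_ge(2) by (simp add: sumV_def sum_subtractf)
  finally show ?thesis using sumV_indep[OF assms(1), of i "- i"] by simp
qed

definition step :: "(int \<Rightarrow> int) \<Rightarrow> (int \<Rightarrow> int) \<Rightarrow> bool" where
  "step f g \<longleftrightarrow> (\<exists>a b. \<not> cg a b \<and> a < b \<and> f a < f b \<and> g = f \<circ> rfl a b)"

definition selfdual :: "int \<Rightarrow> (int \<Rightarrow> int) \<Rightarrow> bool" where
  "selfdual c f \<longleftrightarrow> f \<in> AF \<and> (\<forall>a. f (1 - a) = c * N + 1 - f a)"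

lemma selfdual_rfl: "selfdual c f \<Longrightarrow> \<not> cg a b \<Longrightarrow> selfdual c (f \<circ> rfl a b)"
  by (simp add: selfdual_def AF_comp rfl_AF rfl_dual)

lemma selfdualD: "selfdual c f \<Longrightarrow> f \<in> AF" "selfdual c f \<Longrightarrow> f (1 - a) = c * N + 1 - f a"
  by (simp_all add: selfdual_def)

lemma rfl_cases:
  assumes "\<not> cg a b"
  obtains (1) k where "cg x a" "x = a + k * N" "rfl a b x = b + k * N"
  | (2) k where "cg x b" "x = b + k * N" "rfl a b x = a + k * N"
  | (3) k where "\<not> cg x a" "\<not> cg x b" "x = 1 - a + k * N" "rfl a b x = 1 - b + k * N"
  | (4) k where "\<not> cg x a" "\<not> cg x b" "x = 1 - b + k * N" "rfl a b x = 1 - a + k * N"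
  | (5) "\<not> cg x a" "\<not> cg x b" "\<not> cg x (1 - a)" "\<not> cg x (1 - b)" "rfl a b x = x"
proof -
  consider "cg x a" | "\<not> cg x a" "cg x b" | "\<not> cg x a" "\<not> cg x b" "cg x (1 - a)"
    | "\<not> cg x a" "\<not> cg x b" "\<not> cg x (1 - a)" "cg x (1 - b)" 
    | "\<not> cg x a" "\<not> cg x b" "\<not> cg x (1 - a)" "\<not> cg x (1 - b)" by blast
  then show ?thesis
  proof cases
    case 1
    then show ?thesis by (auto simp: rfl_def elim!: cgE intro!: that(1))
  next
    case 2
    then show ?thesis by (auto simp: rfl_def elim!: cgE intro!: that(2))
  next
    case 3
    then obtain k where "x = 1 - a + k * N" by (auto elim: cgE)
    then show ?thesis using 3 by (intro that(3)[of k]) (auto simp: rfl_def)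
  next
    case 4
    then obtain k where "x = 1 - b + k * N" by (auto elim: cgE)
    then show ?thesis using 4 by (intro that(4)[of k]) (auto simp: rfl_def)
  next
    case 5
    then show ?thesis by (intro that(5)) (auto simp: rfl_def)
  qed
qed

definition zeros where "zeros f i = (\<Sum>x\<in>{1..N}. zeta (V f i x))"
definition twos where "twos f i = (\<Sum>x\<in>{1..N}. zeta (2 - V f i x))"

text \<open>By monotonicity of \<open>Om i\<close>, the new entries are the largest and the smallest
  of the four differences between \<open>Om i (f a)\<close>, \<open>Om i (f b)\<close> and
  \<open>Om i a\<close>, \<open>Om i b\<close>, with the same sum as the old ones. So the old
  entries lie between them; one old zero forces the smaller new entry to be zero, and two old zeros
  force both.\<close>

lemma step_pair:
  assumes "\<not> cg a b" "a < b" "f a < f b" and g: "g = f \<circ> rfl a b"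
    and "0 \<le> V g i b" "V g i a \<le> 2"
  shows "0 \<le> V f i a" "V f i a \<le> 2" "0 \<le> V f i b" "V f i b \<le> 2"
    "zeta (V f i a) + zeta (V f i b) \<le> zeta (V g i a) + zeta (V g i b)"
proof -
  have 1: "Om i a \<le> Om i b" "Om i (f a) \<le> Om i (f b)" using assms by (simp_all add: Om_mono)
  have 2: "V g i a = Om i (f b) - Om i a" "V g i b = Om i (f a) - Om i b"
    using assms(1) by (simp_all add: V_def g)
  show "0 \<le> V f i a" "V f i a \<le> 2" "0 \<le> V f i b" "V f i b \<le> 2" using 1 2 assms(5,6) by (simp_all add: V_def)
  show "zeta (V f i a) + zeta (V f i b) \<le> zeta (V g i a) + zeta (V g i b)"
    using 1 2 assms(5,6) by (auto simp: zeta_def V_def)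
qed

end

text \<open>\<open>K\<close> stands for the indices congruent to an element of \<open>I\<close> or
  \<open>- I\<close>, entering only through its two symmetries.\<close>

locale gsp_face = affine_gsp +
  fixes K :: "int set" and s :: int
  assumes K_shift: "i \<in> K \<Longrightarrow> i + k * N \<in> K" and K_minus: "i \<in> K \<Longrightarrow> - i \<in> K" and K_ne: "K \<noteq> {}"
begin

text \<open>(P'2) is hidden in \<open>selfdual 2\<close>, by \<open>sumV_dual\<close>.\<close>

definition permissible :: "(int \<Rightarrow> int) \<Rightarrow> bool" where
  "permissible f \<longleftrightarrow> selfdual 2 f \<and> (\<forall>i\<in>K. (\<forall>a. 0 \<le> V f i a \<and> V f i a \<le> 2) \<and> zeros f i \<le> s)"

lemma permissibleD: "permissible f \<Longrightarrow> selfdual 2 f" "permissible f \<Longrightarrow> f \<in> AF" "permissible f \<Longrightarrow> f (1 - a) = 2 * N + 1 - f a"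
  "permissible f \<Longrightarrow> i \<in> K \<Longrightarrow> 0 \<le> V f i a" "permissible f \<Longrightarrow> i \<in> K \<Longrightarrow> V f i a \<le> 2"
  "permissible f \<Longrightarrow> i \<in> K \<Longrightarrow> zeros f i \<le> s"
  by (auto simp: permissible_def selfdual_def)

lemma K_shift': "i \<in> K \<Longrightarrow> i + N \<in> K" "i \<in> K \<Longrightarrow> i - N \<in> K"
  using K_shift[of i 1] K_shift[of i "-1"] by simp_all

lemma permissible_step_down:
  assumes "step f g" "permissible g" shows "permissible f"
proof -
  obtain a b where ab: "\<not> cg a b" "a < b" "f a < f b" and g: "g = f \<circ> rfl a b"
    using assms(1) by (auto simp: step_def)
  have f: "f = g \<circ> rfl a b" unfolding g comp_assoc rfl_o[OF ab(1)] by simp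
  have sd: "selfdual 2 f" unfolding f by (rule selfdual_rfl[OF permissibleD(1)[OF assms(2)] ab(1)])
  note fAF = selfdualD(1)[OF sd] and fd = selfdualD(2)[OF sd] and gAF = permissibleD(2)[OF assms(2)]
  \<comment> \<open>The same reflection read at its mirror pair, again in increasing order with
    increasing values; so \<open>step_pair\<close> also covers the classes of \<open>1 - a\<close>
    and \<open>1 - b\<close>.\<close>
  let ?a = "1 - b" and ?b = "1 - a"
  have ab': "\<not> cg ?a ?b" "?a < ?b" "f ?a < f ?b" using ab cg_sym by (auto simp: fd)
  have g': "g = f \<circ> rfl ?a ?b" 
  proof -
    have "rfl ?a ?b = rfl ?b ?a" using ab(1) by (intro rfl_swap) simp
    also have "\<dots> = rfl a b" using ab(1) by (rule rfl_mirror)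
    finally show ?thesis using g by simp
  qed
  have main: "(0 \<le> V f i x \<and> V f i x \<le> 2) \<and> 
      zeta (V f i x) + zeta (V f i (rfl a b x)) \<le> zeta (V g i x) + zeta (V g i (rfl a b x))" if "i \<in> K" for i x
  proof -
    have gb: "0 \<le> V g i y" "V g i y \<le> 2" for y using permissibleD(4,5)[OF assms(2) that] by auto
    note p = step_pair[OF ab g gb(1) gb(2)] and p' = step_pair[OF ab' g' gb(1) gb(2)]
    show ?thesis
    proof (rule rfl_cases[OF ab(1), of x], goal_cases)
      case 5
      then have "g x = f x" by (simp add: g)
      then have "V g i x = V f i x" by (simp add: V_def)
      then show ?thesis using 5 gb[of x] by simp
    qed (use p p' in \<open>auto simp: V_shift[OF fAF] V_shift[OF gAF]\<close>)
  qed
  have "zeros f i \<le> s" if i: "i \<in> K" for i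
  proof -
    have "2 * zeros f i = (\<Sum>x\<in>{1..N}. zeta (V f i x) + zeta (V f i (rfl a b x)))"
      unfolding zeros_def by (rule sum_pair[OF _ ab(1)]) (simp add: V_N[OF fAF])
    also have "\<dots> \<le> (\<Sum>x\<in>{1..N}. zeta (V g i x) + zeta (V g i (rfl a b x)))"
      using main[OF i] by (intro sum_mono) blast
    also have "\<dots> = 2 * zeros g i"
      unfolding zeros_def by (rule sum_pair[OF _ ab(1), symmetric]) (simp add: V_N[OF gAF])
    finally show ?thesis using permissibleD(6)[OF assms(2) i] by simp
  qed
  then show ?thesis using main sd by (auto simp: permissible_def)
qed

lemma twos_eq_zeros: assumes "permissible f" "i \<in> K" shows "twos f i = zeros f i"
proof -
  have "2 * sumV f i = 2 * N" by (intro sumV_dual permissibleD assms)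
  then have "(\<Sum>x\<in>{1..N}. V f i x) = N" by (simp add: sumV_def)
  then have "(\<Sum>x\<in>{1..N}. V f i x - 1) = 0" using N_ge by (simp add: sum_subtractf)
  moreover have "V f i x - 1 = zeta (2 - V f i x) - zeta (V f i x)" for x
    using permissibleD(4,5)[OF assms, of x] by (auto simp: zeta_def)
  ultimately show ?thesis by (simp add: twos_def zeros_def sum_subtractf)
qed

lemma zeros_minus: assumes "permissible f" "i \<in> K" shows "zeros f (- i) = zeros f i"
proof -
  have "zeros f (- i) = (\<Sum>x\<in>{1..N}. zeta (V f (- i) (1 - x)))"
    unfolding zeros_def by (rule sum_dual[symmetric]) (simp add: V_N[OF permissibleD(2)[OF assms(1)]])
  also have "\<dots> = twos f i" by (simp add: twos_def V_dual[of f _ 2] permissibleD(3)[OF assms(1)])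
  finally show ?thesis using twos_eq_zeros[OF assms] by simp
qed

text \<open>\<open>Om i\<close> jumps by 1 directly after each translate of \<open>i\<close>, and a
  range of fewer than \<open>N\<close> integers contains at most one translate.\<close>

lemma Om_gap:
  assumes "p < q" "q < p + N"
  obtains "Om i q - Om i p = 0" | k where "Om i q - Om i p = 1" "p \<le> i + k * N" "i + k * N < q"
proof -
  define k where "k = - ((i - p) div N)"
  have k: "N * (- k) \<le> i - p" "i - p < N * (- k) + N" 
    using div_N_bounds[of "i - p"] by (simp_all add: k_def)
  show ?thesis
  proof (cases "i + k * N < q")
    case True
    have "(i - q) div N = - k - 1" by (rule div_N_eqI) (use k True assms in \<open>simp_all add: algebra_simps\<close>)
    then have "Om i q - Om i p = 1" by (simp add: Om_def k_def)
    then show ?thesis using True k by (intro that(2)) (simp_all add: algebra_simps)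
  next
    case False
    have "(i - q) div N = - k" by (rule div_N_eqI) (use k False assms in \<open>simp_all add: algebra_simps\<close>)
    then have "Om i q - Om i p = 0" by (simp add: Om_def k_def)
    then show ?thesis by (rule that(1))
  qed
qed

text \<open>The reflection raises the entry at \<open>x\<close> and lowers the entry at \<open>y\<close> by \<open>d i\<close>. It also acts on the
  mirror pair, hence by \<open>d (- i)\<close> at \<open>i\<close>; the number of zeros may grow by only one, so the two must not occur
  at the same \<open>i\<close> unless the pair is its own mirror image.\<close>

lemma swap_perm:
  assumes f: "permissible f" and xy: "\<not> cg x y" and lt: "f x < f y" "f y < f x + N"
    and g: "g = f \<circ> rfl x y"
    and d: "\<And>i. d i = Om i (f y) - Om i (f x)"
    and val: "\<And>i. i \<in> K \<Longrightarrow> d i = 1 \<Longrightarrow> V f i x = 1 \<and> (V f i y = 2 \<or>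
      V f i y = 1 \<and> zeros f i + 1 \<le> s \<and> (cg y (1 - x) \<or> d (- i) = 0))"
  shows "permissible g"
proof -
  have d01: "d i = 0 \<or> d i = 1" for i using Om_gap[OF lt, of i] d by metis
  have sd: "selfdual 2 g" unfolding g by (rule selfdual_rfl[OF permissibleD(1)[OF f] xy])
  note gAF = selfdualD(1)[OF sd] and gd = selfdualD(2)[OF sd]
  note fAF = permissibleD(2)[OF f] and fd = permissibleD(3)[OF f]
  have V1: "V g i x = V f i x + d i" "V g i y = V f i y - d i" for i
    using xy by (simp_all add: V_def g d)
  have V2: "V f i (1 - a) = 2 - V f (- i) a" "V g i (1 - a) = 2 - V g (- i) a" for i a
    using V_dual'[of f a 2 i] V_dual'[of g a 2 i] fd gd by simp_all
  have bd: "0 \<le> V g i x \<and> V g i x \<le> 2 \<and> 0 \<le> V g i y \<and> V g i y \<le> 2" if "i \<in> K" for i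
    using val[OF that] d01[of i] permissibleD(4,5)[OF f that, of x] permissibleD(4,5)[OF f that, of y] unfolding V1 by auto
  have bounds: "0 \<le> V g i t \<and> V g i t \<le> 2" if i: "i \<in> K" for i t
  proof (rule rfl_cases[OF xy, of t], goal_cases)
    case 5
    then have "V g i t = V f i t" by (simp add: V_def g)
    then show ?case using permissibleD(4,5)[OF f i] by simp
  qed (use bd[OF i] bd[OF K_minus[OF i]] in \<open>auto simp: V_shift[OF gAF] V2(2)\<close>)
  \<comment> \<open>\<open>e i\<close> counts the zero that lowering \<open>y\<close> from 1 to 0
    adds at \<open>i\<close>. \<open>l i\<close> does so for the mirror pair, whose new zeros at
    \<open>i\<close> are the new twos of the pair at \<open>- i\<close>; it is 0 for a pair that is
    its own mirror image, which is counted already. The hypothesis keeps \<open>e i\<close> and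
    \<open>l i\<close> from both being 1 when \<open>i\<close> is in \<open>K\<close>.\<close>
  define e where "e i = (if d i = 1 \<and> V f i y = 1 then 1 else 0 :: int)" for i
  define l where "l i = (if cg y (1 - x) then 0 else e (- i))" for i
  define h where "h i t = (if cg t x then e i else 0) + (if cg t y then e i else 0)
    + (if cg t (1 - x) then l i else 0) + (if cg t (1 - y) then l i else 0)" for i t
  have e0: "e i \<ge> 0" "l i \<ge> 0" for i by (simp_all add: e_def l_def)
  have pair: "zeta (V g i x) + zeta (V g i y) \<le> zeta (V f i x) + zeta (V f i y) + e i"
    "zeta (2 - V g i x) + zeta (2 - V g i y) \<le> zeta (2 - V f i x) + zeta (2 - V f i y) + e i"
    if "i \<in> K" for i
    using d01[of i] val[OF that] unfolding V1 e_def by (auto simp: zeta_def)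
  have main: "zeta (V g i t) + zeta (V g i (rfl x y t)) \<le> zeta (V f i t) + zeta (V f i (rfl x y t)) + h i t"
    if i: "i \<in> K" for i t
  proof (rule rfl_cases[OF xy, of t], goal_cases)
    case (1 k)
    then have "h i t \<ge> e i" using e0[of i] by (simp add: h_def)
    then show ?case using 1 pair(1)[OF i] by (simp add: V_shift[OF fAF] V_shift[OF gAF])
  next
    case (2 k)
    then have "h i t \<ge> e i" using e0[of i] by (simp add: h_def)
    then show ?case using 2 pair(1)[OF i] by (simp add: V_shift[OF fAF] V_shift[OF gAF])
  next
    case (3 k)
    have "\<not> cg y (1 - x)" using 3 by (auto simp: cg_commute)
    then have "h i t \<ge> e (- i)" using e0[of i] e0[of "- i"] 3 by (simp add: h_def l_def)
    then show ?case using 3 pair(2)[OF K_minus[OF i]] by (simp add: V_shift[OF fAF] V_shift[OF gAF] V2)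
  next
    case (4 k)
    have "cg y (1 - x) \<Longrightarrow> cg (1 - y) x" using cg_sym cg_dual_swap by blast
    then have "\<not> cg y (1 - x)" using 4 by auto
    then have "h i t \<ge> e (- i)" using e0[of i] e0[of "- i"] 4 by (simp add: h_def l_def)
    then show ?case using 4 pair(2)[OF K_minus[OF i]] by (simp add: V_shift[OF fAF] V_shift[OF gAF] V2)
  next
    case 5
    then have "V g i t = V f i t" by (simp add: V_def g)
    then show ?case using 5 e0[of i] by (simp add: h_def)
  qed
  have "zeros g i \<le> s" if i: "i \<in> K" for i
  proof -
    have sumc: "(\<Sum>t\<in>{1..N}. if cg t a then c else 0) = (c::int)" for a c
    proof -
      have "(\<Sum>t\<in>{1..N}. if cg t a then c else 0) = (\<Sum>t\<in>{1..N}. c * (if cg t a then 1 else 0))"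
        by (intro sum.cong) auto
      also have "\<dots> = c" by (simp only: sum_distrib_left[symmetric] sum_indicator mult_1_right)
      finally show ?thesis .
    qed
    have "2 * zeros g i = (\<Sum>t\<in>{1..N}. zeta (V g i t) + zeta (V g i (rfl x y t)))"
      unfolding zeros_def by (rule sum_pair[OF _ xy]) (simp add: V_N[OF gAF])
    also have "\<dots> \<le> (\<Sum>t\<in>{1..N}. zeta (V f i t) + zeta (V f i (rfl x y t)) + h i t)"
      using main[OF i] by (intro sum_mono) blast
    also have "\<dots> = (\<Sum>t\<in>{1..N}. zeta (V f i t) + zeta (V f i (rfl x y t))) + (\<Sum>t\<in>{1..N}. h i t)"
      by (rule sum.distrib)
    also have "(\<Sum>t\<in>{1..N}. zeta (V f i t) + zeta (V f i (rfl x y t))) = 2 * zeros f i"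
      unfolding zeros_def by (rule sum_pair[OF _ xy, symmetric]) (simp add: V_N[OF fAF])
    also have "(\<Sum>t\<in>{1..N}. h i t) = 2 * e i + 2 * l i"
      unfolding h_def by (simp add: sum.distrib sumc)
    finally have le: "zeros g i \<le> zeros f i + e i + l i" by simp
    have 1: "e i = 0 \<or> e i = 1 \<and> zeros f i + 1 \<le> s \<and> l i = 0"
      using val[OF i] by (auto simp: e_def l_def)
    have 2: "l i = 0 \<or> l i = 1 \<and> zeros f i + 1 \<le> s"
      using val[OF K_minus[OF i]] zeros_minus[OF f i] by (auto simp: e_def l_def)
    show ?thesis using le 1 2 permissibleD(6)[OF f i] by linarith
  qed
  then show ?thesis using sd bounds by (auto simp: permissible_def)
qed

text \<open>By \<open>Om_gap\<close> only indices with a translate in \<open>[f x, f y)\<close> are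
  affected. As \<open>V\<close> and \<open>zeros\<close> are periodic in the index, testing the
  integers in this interval is enough.\<close>

lemma swap_gap:
  assumes f: "permissible f" and "x < y" and lt: "f x < f y" "f y < f x + N"
    and val: "\<And>i. i \<in> K \<Longrightarrow> f x \<le> i \<Longrightarrow> i < f y \<Longrightarrow> V f i x = 1 \<and> (V f i y = 2 \<or>
      V f i y = 1 \<and> zeros f i + 1 \<le> s \<and> (cg y (1 - x) \<or> (\<forall>k. \<not> (f x \<le> - i + k * N \<and> - i + k * N < f y))))"
  shows "\<exists>g. step f g \<and> permissible g"
proof -
  have xy: "\<not> cg x y"
  proof
    assume "cg x y"
    then have "cg (f x) (f y)" using AF_cg[OF permissibleD(2)[OF f]] by blast
    then have "f x = f y" using lt N_ge by (intro cg_small) auto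
    then show False using lt by simp
  qed
  define d where "d i = Om i (f y) - Om i (f x)" for i
  have per: "V f (i + k * N) t = V f i t" "zeros f (i + k * N) = zeros f i" for i k t
    by (simp_all add: V_shift' zeros_def)
  have "permissible (f \<circ> rfl x y)"
  proof (rule swap_perm[OF f xy lt refl d_def])
    fix i assume i: "i \<in> K" and d1: "d i = 1"
    obtain k where k: "f x \<le> i + k * N" "i + k * N < f y"
      using Om_gap[OF lt, of i] d1 unfolding d_def by auto
    have *: "d (- i) = 0" if "\<forall>l. \<not> (f x \<le> - (i + k * N) + l * N \<and> - (i + k * N) + l * N < f y)"
    proof (rule Om_gap[OF lt, of "- i"])
      fix l assume "f x \<le> - i + l * N" "- i + l * N < f y"
      moreover have "- i + l * N = - (i + k * N) + (k + l) * N" by (simp add: algebra_simps)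
      ultimately show ?thesis using that by metis
    qed (simp add: d_def)
    show "V f i x = 1 \<and> (V f i y = 2 \<or> V f i y = 1 \<and> zeros f i + 1 \<le> s \<and> (cg y (1 - x) \<or> d (- i) = 0))"
      using val[OF K_shift[OF i] k] * unfolding per by blast
  qed
  then show ?thesis using xy assms(2) lt(1) unfolding step_def by blast
qed

lemma div_jump:
  assumes "(i1 - x) div N < (i2 - x) div N"
  obtains k where "i1 < x + k * N" "x + k * N \<le> i2"
proof -
  define k where "k = (i2 - x) div N"
  have "\<not> N * k \<le> i1 - x"
  proof
    assume "N * k \<le> i1 - x"
    then have "(N * k) div N \<le> (i1 - x) div N" using N_ge by (intro zdiv_mono1) auto
    then show False using assms N_ge by (simp add: k_def)
  qed
  moreover have "N * k \<le> i2 - x" unfolding k_def by (rule div_N_bounds)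
  ultimately show ?thesis by (intro that[of k]) (auto simp: algebra_simps)
qed

text \<open>\<open>(i - x) div N\<close> never decreases as \<open>i\<close> grows, so a drop must
  come from \<open>i\<close> reaching a translate of \<open>f x\<close>.\<close>

lemma fall_lift:
  assumes "i1 < i2" "V f i1 x > V f i2 x"
  obtains k where "i1 < f x + k * N" "f x + k * N \<le> i2"
proof (rule div_jump)
  have "(i1 - x) div N \<le> (i2 - x) div N" using assms(1) N_ge by (intro zdiv_mono1) auto
  then show "(i1 - f x) div N < (i2 - f x) div N" using assms(2) by (simp add: V_div)
qed

lemma rise_lift:
  assumes "i1 < i2" "V f i1 x < V f i2 x"
  obtains k where "i1 < x + k * N" "x + k * N \<le> i2"
proof (rule div_jump)
  have "(i1 - f x) div N \<le> (i2 - f x) div N" using assms(1) N_ge by (intro zdiv_mono1) auto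
  then show "(i1 - x) div N < (i2 - x) div N" using assms(2) by (simp add: V_div)
qed

lemma div_N_D: "x div N = k \<Longrightarrow> k * N \<le> x \<and> x < k * N + N"
  using div_N_bounds[of x] by (auto simp: algebra_simps)

text \<open>Modulo \<open>N\<close>, the entry at \<open>x\<close> is 2 on an arc of indices that
  ends between \<open>i1\<close> and \<open>i2\<close>, and the entry at \<open>y\<close> on an arc
  that begins there. A swap replaces the two arcs by their union and their intersection. At every
  affected index of \<open>K\<close> it only trades a 1 against a 2, so no zero is gained.\<close>

lemma merge_step:
  assumes f: "permissible f" and i: "i1 \<in> K" "i2 \<in> K" "i1 < i2" and nc: "\<And>i. i \<in> K \<Longrightarrow> i1 < i \<Longrightarrow> i2 \<le> i"
    and x: "V f i1 x = 2" "V f i2 x = 1" and y: "V f i1 y = 1" "V f i2 y = 2"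
  shows "\<exists>g. step f g \<and> permissible g"
proof -
  note fAF = permissibleD(2)[OF f]
  have i2: "i2 \<le> i1 + N" using nc[OF K_shift'(1)[OF i(1)]] N_ge by simp
  obtain k where k: "i1 < f x + k * N" "f x + k * N \<le> i2" using fall_lift[OF i(3), of f x] x by auto
  \<comment> \<open>The extra turn puts \<open>f X\<close> into \<open>(i1 + N, i2 + N]\<close> and
    \<open>X\<close> itself at or before \<open>i1\<close>, hence before \<open>Y\<close>. The arcs
    of value 2 are then \<open>[X + N, f X)\<close> and \<open>[Y + N, f Y)\<close>.\<close>
  define X where "X = x + (k + 1) * N"
  have X: "i1 + N < f X" "f X \<le> i2 + N" "V f i1 X = 2" "V f i2 X = 1"
  proof -
    have "f X = f x + k * N + N" unfolding X_def AF_shift[OF fAF] by (simp add: algebra_simps)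
    then show "i1 + N < f X" "f X \<le> i2 + N" using k by simp_all
    show "V f i1 X = 2" "V f i2 X = 1" using x by (simp_all only: X_def V_shift[OF fAF])
  qed
  obtain l where l: "i1 < y + l * N" "y + l * N \<le> i2" using rise_lift[OF i(3), of f y] y by auto
  define Y where "Y = y + l * N"
  have Y: "i1 < Y" "Y \<le> i2" "V f i1 Y = 1" "V f i2 Y = 2"
    using l y by (simp_all only: Y_def V_shift[OF fAF])
  have a1: "(i1 - f X) div N = - 2" "(i2 - f X) div N = - 1" by (rule div_N_eqI; use X i2 i(3) in simp)+
  have "(i1 - X) div N = 0" using X(3) a1 by (simp add: V_div)
  then have X1: "X \<le> i1" by (auto dest!: div_N_D)
  have "(i2 - X) div N = 0" using X(4) a1 by (simp add: V_div)
  then have X2: "i2 < X + N" by (auto dest!: div_N_D)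
  have b1: "(i1 - Y) div N = - 1" "(i2 - Y) div N = 0" by (rule div_N_eqI; use Y i2 i(3) in simp)+
  have "(i1 - f Y) div N = - 2" using Y(3) b1 by (simp add: V_div)
  then have Y1: "f Y \<le> i1 + 2 * N" by (auto dest!: div_N_D)
  have "(i2 - f Y) div N = - 2" using Y(4) b1 by (simp add: V_div)
  then have Y2: "i2 + N < f Y" by (auto dest!: div_N_D)
  have nc': "i \<le> i1 + N \<or> i2 + N \<le> i" if "i \<in> K" for i
    using nc[OF K_shift'(2)[OF that]] by linarith
  show ?thesis
  \<comment> \<open>If the two arcs together make at most one turn, \<open>X\<close> takes over
    \<open>f Y\<close> and is 2 on their union. Otherwise they overlap at the far end: exchanging
    \<open>Y - N\<close> with \<open>X\<close> makes the former 2 on all of \<open>K\<close> and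
    leaves \<open>X\<close> the overlap.\<close>
  proof (cases "f Y \<le> X + 2 * N")
    case True
    show ?thesis
    proof (rule swap_gap[OF f, of X Y])
      fix j assume j: "j \<in> K" "f X \<le> j" "j < f Y"
      have j2: "i2 + N \<le> j" using nc'[OF j(1)] j(2) X(1) by linarith
      have "(j - Y) div N = 1" by (rule div_N_eqI; use j j2 Y1 Y2 Y i i2 in linarith)
      moreover have "(j - f Y) div N = - 1" by (rule div_N_eqI; use j j2 Y1 Y2 Y i i2 in linarith)
      moreover have "(j - X) div N = 1" by (rule div_N_eqI; use j j2 X1 X2 True i i2 in linarith)
      moreover have "(j - f X) div N = 0" by (rule div_N_eqI; use j j2 X X1 X2 Y1 i i2 in linarith)
      ultimately show "V f j X = 1 \<and> (V f j Y = 2 \<or>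
        V f j Y = 1 \<and> zeros f j + 1 \<le> s \<and> (cg Y (1 - X) \<or> (\<forall>k. \<not> (f X \<le> - j + k * N \<and> - j + k * N < f Y))))"
        by (simp add: V_div)
    qed (use X X1 X2 Y Y1 Y2 i2 in linarith)+
  next
    case False
    define Z where "Z = Y - N"
    have fZ: "f Z = f Y - N" using AF_shift[OF fAF, of Y "-1"] by (simp add: Z_def)
    show ?thesis
    proof (rule swap_gap[OF f, of Z X])
      fix j assume j: "j \<in> K" "f Z \<le> j" "j < f X"
      have j2: "j \<le> i1 + N" using nc'[OF j(1)] j(3) X(2) by linarith
      have "(j - Z) div N = 1" by (rule div_N_eqI; use j j2 Y1 Y2 Y i i2 fZ Z_def False in linarith)
      moreover have "(j - f Z) div N = 0" by (rule div_N_eqI; use j j2 Y1 Y2 Y X i i2 fZ Z_def in linarith)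
      moreover have "(j - X) div N = 1" by (rule div_N_eqI; use j j2 X1 X2 False fZ i i2 in linarith)
      moreover have "(j - f X) div N = - 1" by (rule div_N_eqI; use j j2 X X1 X2 Y1 Y2 fZ i i2 in linarith)
      ultimately show "V f j Z = 1 \<and> (V f j X = 2 \<or>
        V f j X = 1 \<and> zeros f j + 1 \<le> s \<and> (cg X (1 - Z) \<or> (\<forall>k. \<not> (f Z \<le> - j + k * N \<and> - j + k * N < f X))))"
        by (simp add: V_div)
    qed (use X X1 X2 Y Y1 Y2 i2 fZ Z_def False in linarith)+
  qed
qed

end

context affine_gsp begin

subsection \<open>Existence of ascending steps\<close>

text \<open>The floor of a sum exceeds the sum of the floors by 0 or 1. Hence a varying entry of a
  permissible \<open>f\<close> takes either the values 1 and 2 or the values 0 and 1 on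
  \<open>K\<close>.\<close>

lemma V_two: "(f a - a) div N \<le> V f i a \<and> V f i a \<le> (f a - a) div N + 1"
proof -
  define p r where "p = (i - f a) div N" and "r = (f a - a) div N"
  have b: "N * p \<le> i - f a" "i - f a < N * p + N" "N * r \<le> f a - a" "f a - a < N * r + N"
    unfolding p_def r_def by (rule div_N_bounds)+
  have "(i - a) div N = p + r \<or> (i - a) div N = p + r + 1"
  proof (cases "i - a < N * (p + r) + N")
    case True
    have "(i - a) div N = p + r" by (rule div_N_eqI) (use b True in \<open>simp_all add: algebra_simps\<close>)
    then show ?thesis ..
  next
    case False
    have "(i - a) div N = p + r + 1" by (rule div_N_eqI) (use b False in \<open>simp_all add: algebra_simps\<close>)
    then show ?thesis ..
  qed
  then show ?thesis
    by (auto simp: V_div p_def r_def)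
qed

lemma residue_shift: obtains k where "p \<le> i + k * N" "i + k * N < p + N"
proof -
  have "N * ((i - p) div N) \<le> i - p" "i - p < N * ((i - p) div N) + N" by (rule div_N_bounds)+
  then show ?thesis by (intro that[of "- ((i - p) div N)"]) (simp_all add: algebra_simps)
qed

lemma large_shift: obtains k where "b < a + k * N"
proof -
  define n where "n = max 0 (b - a + 1)"
  have "n * 1 \<le> n * N" using N_ge by (intro mult_left_mono) (auto simp: n_def)
  then show ?thesis by (intro that[of n]) (auto simp: n_def)
qed

lemma residue_ex: obtains t where "t \<in> {1..N}" "cg t a"
proof -
  obtain k where "1 \<le> a + k * N" "a + k * N < 1 + N" by (rule residue_shift)
  then show ?thesis by (intro that[of "a + k * N"]) auto
qed

lemma sum_eq_residues:
  fixes F G :: "int \<Rightarrow> int"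
  assumes "\<And>a. F (a + N) = F a" "\<And>a. G (a + N) = G a" "\<And>a. F a \<le> G a"
    and "(\<Sum>x\<in>{1..N}. F x) = (\<Sum>x\<in>{1..N}. G x)"
  shows "F a = G a"
proof -
  obtain t where t: "t \<in> {1..N}" "cg t a" by (rule residue_ex)
  have "(\<Sum>x\<in>{1..N}. G x - F x) = 0" using assms(4) by (simp add: sum_subtractf)
  then have "\<forall>x\<in>{1..N}. G x - F x = 0" using assms(3) by (subst (asm) sum_nonneg_eq_0_iff) auto
  then have "F t = G t" using t by auto
  then show ?thesis using periodic_cg[of F, OF assms(1) t(2)] periodic_cg[of G, OF assms(2) t(2)] by simp
qed

end

context gsp_face begin

definition hi where "hi f x \<longleftrightarrow> (\<exists>i\<in>K. V f i x = 2) \<and> (\<exists>i\<in>K. V f i x = 1)"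
definition lo where "lo f x \<longleftrightarrow> (\<exists>i\<in>K. V f i x = 0) \<and> (\<exists>i\<in>K. V f i x = 1)"

lemma hi_shift: "f \<in> AF \<Longrightarrow> hi f (x + k * N) = hi f x"
  and lo_shift: "f \<in> AF \<Longrightarrow> lo f (x + k * N) = lo f x"
  by (simp_all add: hi_def lo_def V_shift)

lemma lo_dual: assumes "permissible f" "hi f x" shows "lo f (1 - x)"
proof -
  have d: "V f (- i) (1 - x) = 2 - V f i x" for i by (simp add: V_dual[of f _ 2] permissibleD(3)[OF assms(1)])
  obtain i j where "i \<in> K" "V f i x = 2" "j \<in> K" "V f j x = 1" using assms(2) by (auto simp: hi_def)
  then show ?thesis using d[of i] d[of j] K_minus unfolding lo_def by force
qed

lemma hi_dual: assumes "permissible f" "lo f x" shows "hi f (1 - x)"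
proof -
  have d: "V f (- i) (1 - x) = 2 - V f i x" for i by (simp add: V_dual[of f _ 2] permissibleD(3)[OF assms(1)])
  obtain i j where "i \<in> K" "V f i x = 0" "j \<in> K" "V f j x = 1" using assms(2) by (auto simp: lo_def)
  then show ?thesis using d[of i] d[of j] K_minus unfolding hi_def by force
qed

lemma fall_hi_lo:
  assumes f: "permissible f" and i: "i \<in> K" "j \<in> K" "V f i z > V f j z"
  shows "hi f z \<or> lo f z"
proof -
  have "V f i z = 2 \<and> V f j z = 1 \<or> V f i z = 1 \<and> V f j z = 0"
    using V_two[of f z i] V_two[of f z j] permissibleD(5)[OF f i(1), of z] permissibleD(4)[OF f i(2), of z] i(3) by linarith
  then show ?thesis using i(1,2) unfolding hi_def lo_def by blast
qed

text \<open>Minimality of \<open>f y - f x\<close> excludes every further fall at the indices of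
  \<open>K\<close> in \<open>[f x, f y)\<close>; since the sum of the entries does not depend on the
  index, nothing rises there either. In this stretch \<open>x\<close> has already fallen to 1 and
  \<open>y\<close> has not yet fallen to 0. The hypothesis \<open>nm\<close> says that no merging is
  possible.\<close>

lemma fill_step:
  assumes f: "permissible f" and h: "hi f x0"
    and nm: "\<And>i1 i2 x y. \<lbrakk>i1 \<in> K; i2 \<in> K; i1 < i2; \<And>i. i \<in> K \<Longrightarrow> i1 < i \<Longrightarrow> i2 \<le> i;
      V f i1 x = 2; V f i2 x = 1; V f i1 y = 1; V f i2 y = 2\<rbrakk> \<Longrightarrow> False"
  shows "\<exists>g. step f g \<and> permissible g"
proof -
  note fAF = permissibleD(2)[OF f]
  define pr where "pr x y \<longleftrightarrow> hi f x \<and> lo f y \<and> f x < f y \<and> (\<exists>i\<in>K. f x \<le> i \<and> i < f y)" for x y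
  have "\<exists>x y. pr x y"
  proof -
    obtain i where i: "i \<in> K" using K_ne by blast
    obtain k where k: "f x0 \<le> i + k * N" using residue_shift[of "f x0" i] by blast
    obtain n where n: "i + k * N < f (1 - x0) + n * N" by (rule large_shift)
    have "pr x0 (1 - x0 + n * N)"
      unfolding pr_def lo_shift[OF fAF] AF_shift[OF fAF]
      using h lo_dual[OF f h] k n K_shift[OF i, of k] by (intro conjI bexI[of _ "i + k * N"]) auto
    then show ?thesis by blast
  qed
  then obtain a b where "pr a b" by blast
  then have "pr (fst (a, b)) (snd (a, b))" by simp
  from ex_has_least_nat[of "\<lambda>p. pr (fst p) (snd p)", OF this, of "\<lambda>p. nat (f (snd p) - f (fst p))"]
  obtain q where q: "pr (fst q) (snd q)"
    "\<And>q'. pr (fst q') (snd q') \<Longrightarrow> nat (f (snd q) - f (fst q)) \<le> nat (f (snd q') - f (fst q'))" by blast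
  define x y where "x = fst q" and "y = snd q"
  have xy: "pr x y" and min0: "\<And>x' y'. pr x' y' \<Longrightarrow> nat (f y - f x) \<le> nat (f y' - f x')"
    using q(1) q(2)[of "(_, _)"] by (simp_all add: x_def y_def)
  have lt: "f x < f y" and hx: "hi f x" and ly: "lo f y" using xy by (auto simp: pr_def)
  have min: "f y - f x \<le> f y' - f x'" if "pr x' y'" for x' y'
  proof -
    have "f x' < f y'" using that by (simp add: pr_def)
    then show ?thesis using min0[OF that] lt by linarith
  qed
  have nofall: "V f j1 z \<le> V f j2 z" if j: "j1 \<in> K" "j2 \<in> K" "f x \<le> j1" "j1 < j2" "j2 < f y" for j1 j2 z
  proof (rule ccontr)
    assume "\<not> ?thesis"
    then have c: "V f j1 z > V f j2 z" by simp
    obtain k where "j1 < f z + k * N" "f z + k * N \<le> j2" by (rule fall_lift[OF j(4) c])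
    then have Z: "j1 < f (z + k * N)" "f (z + k * N) \<le> j2" by (simp_all add: AF_shift[OF fAF])
    have "hi f (z + k * N) \<or> lo f (z + k * N)"
      using fall_hi_lo[OF f j(1,2) c] hi_shift[OF fAF] lo_shift[OF fAF] by simp
    then show False
    proof
      assume "hi f (z + k * N)"
      then have "pr (z + k * N) y" unfolding pr_def using ly Z j by (intro conjI bexI[of _ j2]) auto
      then show False using min[of "z + k * N" y] Z j by linarith
    next
      assume "lo f (z + k * N)"
      then have "pr x (z + k * N)" unfolding pr_def using hx Z j by (intro conjI bexI[of _ j1]) auto
      then show False using min[of x "z + k * N"] Z j by linarith
    qed
  qed
  \<comment> \<open>No entry falls from \<open>j1\<close> to \<open>j2\<close>, and both indices
    have the same sum.\<close>
  have const: "V f j1 z = V f j2 z" if j: "j1 \<in> K" "j2 \<in> K" "f x \<le> j1" "j1 < j2" "j2 < f y" for j1 j2 z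
    by (rule sum_eq_residues[of "V f j1" "V f j2"])
      (use sumV_indep[OF fAF, of j1 j2] nofall[OF j] in \<open>simp_all add: V_N[OF fAF] sumV_def\<close>)
  have hx1: "(f x - x) div N = 1"
  proof -
    obtain i j where "i \<in> K" "j \<in> K" "V f i x = 2" "V f j x = 1" using hx by (auto simp: hi_def)
    then show ?thesis using V_two[of f x i] V_two[of f x j] by linarith
  qed
  then have xb: "x + N \<le> f x" "f x < x + 2 * N" by (auto dest!: div_N_D)
  have ly1: "(f y - y) div N = 0"
  proof -
    obtain i j where "i \<in> K" "j \<in> K" "V f i y = 0" "V f j y = 1" using ly by (auto simp: lo_def)
    then show ?thesis using V_two[of f y i] V_two[of f y j] by linarith
  qed
  then have yb: "y \<le> f y" "f y < y + N" by (auto dest!: div_N_D)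
  have rep: "\<exists>j\<in>K. q \<le> j \<and> j < q + N \<and> V f j z = V f i z" if "i \<in> K" for i q z
    using residue_shift[of q i] K_shift[OF that] V_shift' by metis
  obtain u where u: "u \<in> K" "f x \<le> u" "u < f x + N" "V f u x = 1"
    using hx rep[of _ "f x" x] unfolding hi_def by metis
  obtain w where w: "w \<in> K" "f x \<le> w" "w < f x + N" "V f w x = 2"
    using hx rep[of _ "f x" x] unfolding hi_def by metis
  obtain v where "v \<in> K" "f y - N \<le> v" "v < f y - N + N" "V f v y = 1"
    using ly rep[of _ "f y - N" y] unfolding lo_def by metis
  then have v: "v \<in> K" "f y - N \<le> v" "v < f y" "V f v y = 1" by simp_all
  have u0: "(u - f x) div N = 0" "(w - f x) div N = 0" "(v - f y) div N = - 1"
    by (rule div_N_eqI; use u w v in linarith)+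
  have "(u - x) div N = 1" using u(4) u0 by (simp add: V_div)
  then have u1: "u < x + 2 * N" by (auto dest!: div_N_D)
  have "(w - x) div N = 2" using w(4) u0 by (simp add: V_div)
  then have w1: "x + 2 * N \<le> w" by (auto dest!: div_N_D)
  have "(v - y) div N = 0" using v(4) u0 by (simp add: V_div)
  then have v1: "y \<le> v" by (auto dest!: div_N_D)
  \<comment> \<open>The entry at \<open>x\<close> is 1 at \<open>u\<close> and 2 at the later index
    \<open>w\<close>; if both were below \<open>f y\<close>, they would contradict constancy. As
    \<open>w < f x + N\<close>, the interval \<open>[f x, f y)\<close> is shorter than
    \<open>N\<close>.\<close>
  have fyw: "f y \<le> w" using const[of u w x] u w u1 w1 by force
  have gx: "V f j x = 1" if j: "j \<in> K" "f x \<le> j" "j < f y" for j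
  proof -
    have 0: "(j - f x) div N = 0" by (rule div_N_eqI; use j fyw w in linarith)
    show ?thesis
    proof (cases "j < x + 2 * N")
      case True
      have "(j - x) div N = 1" by (rule div_N_eqI; use j xb True in linarith)
      then show ?thesis using 0 by (simp add: V_div)
    next
      case False
      then show ?thesis using const[of u j x] u u1 j by simp
    qed
  qed
  have gy: "V f j y = 1" if j: "j \<in> K" "f x \<le> j" "j < f y" for j
  proof -
    have 0: "(j - f y) div N = - 1" by (rule div_N_eqI; use j fyw w in linarith)
    show ?thesis
    proof (cases "y \<le> j")
      case True
      have "(j - y) div N = 0" by (rule div_N_eqI; use j yb True in linarith)
      then show ?thesis using 0 by (simp add: V_div)
    next
      case False
      then show ?thesis using const[of j v y] v v1 j by simp
    qed
  qed
  obtain g where g: "g \<in> K" "f x \<le> g" "g < f y" using xy by (auto simp: pr_def)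
  have xlty: "x < y"
  proof -
    have 0: "(g - f x) div N = 0" "(g - f y) div N = - 1" by (rule div_N_eqI; use g fyw w in linarith)+
    have "(g - y) div N = 0" "(g - x) div N = 1" using gx[OF g] gy[OF g] 0 by (simp_all add: V_div)
    then show ?thesis by (auto dest!: div_N_D)
  qed
  \<comment> \<open>\<open>i1\<close> and \<open>i0\<close> are the neighbours of \<open>f x\<close>
    in \<open>K\<close>, before it and at or after it. Between them \<open>x\<close> drops from 2 to
    1 and by \<open>nm\<close> no entry rises to 2. So there are fewer twos, hence fewer zeros, at
    \<open>i0\<close> than at \<open>i1\<close>, and constancy carries this on to
    \<open>j\<close>.\<close>
  have zg: "zeros f j + 1 \<le> s" if j: "j \<in> K" "f x \<le> j" "j < f y" for j
  proof -
    define S where "S = {i \<in> K. f x \<le> i \<and> i \<le> j}"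
    have "finite S" by (rule finite_subset[of _ "{f x..j}"]) (auto simp: S_def)
    moreover have "j \<in> S" using j by (simp add: S_def)
    ultimately have S: "Min S \<in> S" "\<And>i. i \<in> S \<Longrightarrow> Min S \<le> i" by (auto intro!: Min_in)
    define i0 where "i0 = Min S"
    have i0_aux: "i0 \<in> K \<and> f x \<le> i0 \<and> i0 \<le> j" "i \<in> K \<Longrightarrow> f x \<le> i \<Longrightarrow> i0 \<le> i" for i
    proof -
      show 1: "i0 \<in> K \<and> f x \<le> i0 \<and> i0 \<le> j" using S(1) unfolding i0_def by (simp add: S_def)
      show "i0 \<le> i" if "i \<in> K" "f x \<le> i"
      proof (cases "i \<le> j")
        case True
        then show ?thesis using S(2)[of i] that by (simp add: i0_def S_def)
      qed (use 1 in linarith)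
    qed
    have i0: "i0 \<in> K" "f x \<le> i0" "i0 \<le> j" "\<And>i. i \<in> K \<Longrightarrow> f x \<le> i \<Longrightarrow> i0 \<le> i"
      using i0_aux by auto
    \<comment> \<open>The window starts at \<open>w - N\<close>, where the entry at \<open>x\<close>
      is 2. So \<open>T\<close> is nonempty, and \<open>i1\<close> lies after the rise at
      \<open>x + N\<close>.\<close>
    define T where "T = {i \<in> K. w - N \<le> i \<and> i < f x}"
    have "finite T" by (rule finite_subset[of _ "{w - N..f x}"]) (auto simp: T_def)
    moreover have "w - N \<in> T" using w K_shift'(2)[OF w(1)] by (simp add: T_def)
    ultimately have T: "Max T \<in> T" "\<And>i. i \<in> T \<Longrightarrow> i \<le> Max T" by (auto intro!: Max_in)
    define i1 where "i1 = Max T"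
    have i1_aux: "i1 \<in> K \<and> w - N \<le> i1 \<and> i1 < f x" "i \<in> K \<Longrightarrow> i < f x \<Longrightarrow> i \<le> i1" for i
    proof -
      show 1: "i1 \<in> K \<and> w - N \<le> i1 \<and> i1 < f x" using T(1) unfolding i1_def by (simp add: T_def)
      show "i \<le> i1" if "i \<in> K" "i < f x"
      proof (cases "w - N \<le> i")
        case True
        then show ?thesis using T(2)[of i] that by (simp add: i1_def T_def)
      qed (use 1 in linarith)
    qed
    have i1: "i1 \<in> K" "w - N \<le> i1" "i1 < f x" "\<And>i. i \<in> K \<Longrightarrow> i < f x \<Longrightarrow> i \<le> i1"
      using i1_aux by auto
    have nc: "i0 \<le> i" if "i \<in> K" "i1 < i" for i using i0(4)[OF that(1)] i1(4)[OF that(1)] that by linarith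
    have "(i1 - x) div N = 1" by (rule div_N_eqI; use i1 w1 xb in linarith)
    moreover have "(i1 - f x) div N = - 1" by (rule div_N_eqI; use i1 w in linarith)
    ultimately have x2: "V f i1 x = 2" by (simp add: V_div)
    have x1: "V f i0 x = 1" using gx[OF i0(1,2)] i0(3) j by linarith
    have i10: "i1 < i0" using i0 i1 by linarith
    have le: "zeta (2 - V f i0 t) \<le> zeta (2 - V f i1 t)" for t
    proof -
      have "V f i1 t = 2" if "V f i0 t = 2"
      proof -
        have "V f i1 t = 1 \<or> V f i1 t = 2"
          using V_two[of f t i0] V_two[of f t i1] that permissibleD(5)[OF f i1(1), of t] by linarith
        then show ?thesis using nm[OF i1(1) i0(1) i10 nc x2 x1 _ that] by blast
      qed
      then show ?thesis by (simp add: zeta_def)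
    qed
    obtain t where t: "t \<in> {1..N}" "cg t x" by (rule residue_ex)
    have "V f i t = V f i x" for i using periodic_cg[of "V f i", OF V_N[OF fAF] t(2)] .
    then have "zeta (2 - V f i0 t) < zeta (2 - V f i1 t)" using x1 x2 by (simp add: zeta_def)
    then have "twos f i0 < twos f i1" unfolding twos_def using le t(1) by (intro sum_strict_mono_ex1) auto
    then have "zeros f i0 + 1 \<le> s" using twos_eq_zeros[OF f i0(1)] twos_eq_zeros[OF f i1(1)] permissibleD(6)[OF f i1(1)] by simp
    moreover have "zeros f i0 = zeros f j"
    proof (cases "i0 = j")
      case False
      then show ?thesis using const[OF i0(1) j(1)] i0 j by (simp add: zeros_def)
    qed simp
    ultimately show ?thesis by simp
  qed
  \<comment> \<open>If the mirror pair affects \<open>j\<close> too, then suitable translates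
    \<open>x'\<close>, \<open>y'\<close> of \<open>1 - y\<close>, \<open>1 - x\<close> bound an
    interval of the same length around \<open>j\<close>. Combining an end of one interval with an
    end of the other gives a closer pair, unless the intervals coincide; then the pair is its own
    mirror image.\<close>
  have disj: "cg y (1 - x) \<or> (\<forall>k. \<not> (f x \<le> - j + k * N \<and> - j + k * N < f y))"
    if j: "j \<in> K" "f x \<le> j" "j < f y" for j
  proof (rule ccontr)
    assume "\<not> ?thesis"
    then obtain k where k: "f x \<le> - j + k * N" "- j + k * N < f y" and n: "\<not> cg y (1 - x)" by blast
    define x' y' where "x' = 1 - y + (k - 2) * N" and "y' = 1 - x + (k - 2) * N"
    have fx': "f x' = k * N + 1 - f y" and fy': "f y' = k * N + 1 - f x"
      unfolding x'_def y'_def AF_shift[OF fAF] permissibleD(3)[OF f] by (simp_all add: algebra_simps)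
    have h': "hi f x'" "lo f y'" using hi_dual[OF f ly] lo_dual[OF f hx]
      by (simp_all add: x'_def y'_def hi_shift[OF fAF] lo_shift[OF fAF])
    have r: "f x' \<le> j" "j < f y'" using k fx' fy' by linarith+
    consider "f x < f x'" | "f x' < f x" | "f x' = f x" by linarith
    then show False
    proof cases
      case 1
      then have "pr x' y" using h' ly r j by (auto simp: pr_def)
      then show False using min[of x' y] 1 by linarith
    next
      case 2
      then have "pr x y'" using h' hx r j by (auto simp: pr_def)
      then show False using min[of x y'] 2 fx' fy' by linarith
    next
      case 3
      then have "x' = x" using AF_eq[OF fAF] by blast
      then have "cg x (1 - y)" unfolding x'_def using cg_add(1)[of "1 - y" "k - 2" "1 - y"] by simp
      then have "cg (1 - x) y" by (simp add: cg_dual_swap)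
      then show False using n cg_sym by blast
    qed
  qed
  show ?thesis
  proof (rule swap_gap[OF f xlty lt])
    show "f y < f x + N" using fyw w by linarith
  qed (use gx gy zg disj in blast)
qed

text \<open>Some entry is 1, since otherwise the zeros and the equally many twos would fill all
  \<open>N\<close> places, against \<open>zeros f i < s\<close> and \<open>2 * s \<le> N\<close>.
  The dual entry is then 1 as well. Swapping these two is its own mirror image, so it adds only one
  zero.\<close>

lemma const_step:
  assumes f: "permissible f" and s: "2 * s \<le> N" and c: "\<And>i j a. i \<in> K \<Longrightarrow> j \<in> K \<Longrightarrow> V f i a = V f j a"
    and i: "i \<in> K" "zeros f i < s"
  shows "\<exists>g. step f g \<and> permissible g"
proof -
  note fAF = permissibleD(2)[OF f]
  have zs: "zeros f j + 1 \<le> s" if "j \<in> K" for j using c[OF that i(1)] i(2) by (simp add: zeros_def)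
  have "\<exists>x. V f i x = 1"
  proof (rule ccontr)
    assume "\<not> ?thesis"
    then have "zeta (V f i x) + zeta (2 - V f i x) = 1" for x
    proof -
      have "V f i x = 0 \<or> V f i x = 2"
        using permissibleD(4,5)[OF f i(1), of x] \<open>\<not> (\<exists>x. V f i x = 1)\<close>[simplified, rule_format, of x] by linarith
      then show ?thesis by (auto simp: zeta_def)
    qed
    then have "zeros f i + twos f i = N" using N_ge(2) by (simp add: zeros_def twos_def sum.distrib[symmetric])
    then show False using twos_eq_zeros[OF f i(1)] i(2) s by simp
  qed
  then obtain x where "V f i x = 1" by blast
  then have x1: "V f j x = 1" if "j \<in> K" for j using c[OF i(1) that] by simp
  have y1: "V f j (1 - x) = 1" if "j \<in> K" for j
    using V_dual'[of f x 2 j] permissibleD(3)[OF f] x1[OF K_minus[OF that]] by simp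
  obtain k where k: "f x \<le> f (1 - x) + k * N" "f (1 - x) + k * N < f x + N" by (rule residue_shift)
  define y where "y = 1 - x + k * N"
  have fy: "f y = f (1 - x) + k * N" by (simp add: y_def AF_shift[OF fAF])
  have cy: "cg y (1 - x)" by (simp add: y_def)
  have ne: "x \<noteq> y" using cy by auto
  then have ne': "f x \<noteq> f y" using AF_eq[OF fAF] by simp
  have y2: "V f j y = 1" if "j \<in> K" for j using y1[OF that] by (simp add: y_def V_shift[OF fAF])
  show ?thesis
  \<comment> \<open>The choice of \<open>k\<close> orders the values only. If the arguments come in
    the wrong order, the next translate of \<open>x\<close> serves as the upper partner of
    \<open>y\<close>.\<close>
  proof (cases "x < y")
    case True
    show ?thesis
    proof (rule swap_gap[OF f True])
      show "f x < f y" "f y < f x + N" using k fy ne' by linarith+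
    qed (use x1 y2 zs cy in blast)
  next
    case False
    have fx: "f (x + N) = f x + N" by (rule AF_N[OF fAF])
    have "cg (1 - y) x" using cy cg_dual_swap cg_sym by blast
    then have cx: "cg (x + N) (1 - y)" using cg_sym by simp
    have x3: "V f j (x + N) = 1" if "j \<in> K" for j using x1[OF that] by (simp add: V_N[OF fAF])
    show ?thesis
    proof (rule swap_gap[OF f, of y "x + N"])
      show "y < x + N" using False N_ge by linarith
      show "f y < f (x + N)" "f (x + N) < f y + N" using k fy ne' fx by linarith+
    qed (use x3 y2 zs cx in blast)
  qed
qed

text \<open>Translations have entries independent of the index; \<open>final\<close> elements share
  these entries with a translation by a conjugate of \<open>\<mu>\<close>, hence lie in its
  coset.\<close>

definition final where
  "final f \<longleftrightarrow> (\<forall>i\<in>K. \<forall>j\<in>K. \<forall>a. V f i a = V f j a) \<and> (\<forall>i\<in>K. zeros f i = s)"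

lemma permissible_step_up:
  assumes f: "permissible f" and s: "2 * s \<le> N" and "\<not> final f"
  shows "\<exists>g. step f g \<and> permissible g"
proof (cases "\<forall>i\<in>K. \<forall>j\<in>K. \<forall>a. V f i a = V f j a")
  case True
  then obtain i where "i \<in> K" "zeros f i \<noteq> s" using assms(3) unfolding final_def by blast
  then have "zeros f i < s" using permissibleD(6)[OF f, of i] by simp
  show ?thesis by (rule const_step[OF f s _ \<open>i \<in> K\<close> \<open>zeros f i < s\<close>]) (use True in blast)
next
  case False
  then obtain i j a where ij: "i \<in> K" "j \<in> K" "V f i a \<noteq> V f j a" by blast
  then have "V f j a < V f i a \<or> V f i a < V f j a" by linarith
  then have "hi f a \<or> lo f a" using fall_hi_lo[OF f] ij(1,2) by blast
  then obtain x where x: "hi f x" using hi_dual[OF f] by blast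
  show ?thesis
  proof (rule ccontr)
    assume no: "\<not> ?thesis"
    have "\<exists>g. step f g \<and> permissible g"
    proof (rule fill_step[OF f x])
      fix i1 i2 x y
      assume a: "i1 \<in> K" "i2 \<in> K" "i1 < i2" "\<And>i. i \<in> K \<Longrightarrow> i1 < i \<Longrightarrow> i2 \<le> i"
        "V f i1 x = 2" "V f i2 x = 1" "V f i1 y = 1" "V f i2 y = 2"
      show False using merge_step[OF f a] no by simp
    qed
    then show False using no by simp
  qed
qed

text \<open>The images under \<open>aff\<close> of the elements of \<open>W_I\<close>. They act on
  values: \<open>h \<circ> f\<close> with varying \<open>h\<close> runs through one coset.\<close>

definition face_fix where "face_fix h \<longleftrightarrow> h \<in> AF \<and> (\<forall>i\<in>K. \<forall>a. Om i (h a) = Om i a)"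

lemma face_fix_rfl:
  assumes pq: "\<not> cg p q" and "\<And>i. i \<in> K \<Longrightarrow> Om i p = Om i q" shows "face_fix (rfl p q)"
proof -
  have d: "Om i (1 - a) = - 1 - Om (- i) a" for i a using Om_dual[of "- i" a] by simp
  have "Om i (rfl p q a) = Om i a" if "i \<in> K" for i a
    by (rule rfl_cases[OF pq, of a]) (use assms(2) that K_minus[OF that] in \<open>simp_all add: Om_shift d\<close>)
  then show ?thesis using rfl_AF[OF pq] by (simp add: face_fix_def)
qed

lemma face_fix_comp: "face_fix g \<Longrightarrow> face_fix h \<Longrightarrow> face_fix (g \<circ> h)"
  by (simp add: face_fix_def AF_comp)

lemma face_fix_less:
  assumes "face_fix h" "i \<in> K" "Om i a \<noteq> Om i b" "a < b" shows "h a < h b"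
proof (rule ccontr)
  assume "\<not> ?thesis"
  then have "Om i (h b) \<le> Om i (h a)" by (intro Om_mono) simp
  moreover have "Om i a \<le> Om i b" using assms(4) by (intro Om_mono) simp
  ultimately show False using assms by (simp add: face_fix_def)
qed

end

context affine_gsp begin

definition displ :: "(int \<Rightarrow> int) \<Rightarrow> int" where "displ f = (\<Sum>x\<in>{1..N}. (f x - x)\<^sup>2)"

text \<open>Rearrangement: exchanging the values adds \<open>2 * (f b - f a) * (b - a)\<close> to
  the two squares at \<open>a\<close> and \<open>b\<close>, and as much at the mirror pair.\<close>

lemma displ_step:
  assumes f: "f \<in> AF" and "step f g" shows "displ f < displ g"
proof -
  obtain a b where ab: "\<not> cg a b" "a < b" "f a < f b" and g: "g = f \<circ> rfl a b"
    using assms(2) by (auto simp: step_def)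
  have gAF: "g \<in> AF" unfolding g by (rule AF_comp[OF f rfl_AF[OF ab(1)]])
  define F G where "F x = (f x - x)\<^sup>2" and "G x = (g x - x)\<^sup>2" for x
  have FG: "F (x + N) = F x" "G (x + N) = G x" for x by (simp_all add: F_def G_def AF_N[OF f] AF_N[OF gAF])
  have FGk: "F (x + k * N) = F x" "G (x + k * N) = G x" for x k 
    using FG by (simp_all add: periodic_fun[of F] periodic_fun[of G])
  obtain c where c: "\<And>a. f (1 - a) = c * N + 1 - f a" using f by (auto simp: AF_def)
  have gd: "g (1 - x) = c * N + 1 - g x" for x by (simp add: g rfl_dual[OF ab(1)] c)
  have gab: "g a = f b" "g b = f a" using ab(1) by (simp_all add: g)
  have "G a + G b - F a - F b = 2 * ((f b - f a) * (b - a))"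
    by (simp add: F_def G_def gab power2_eq_square algebra_simps)
  moreover have "(f b - f a) * (b - a) > 0" using ab by (intro mult_pos_pos) auto
  ultimately have 1: "F a + F b < G a + G b" by linarith
  have "G (1-a) + G (1-b) - F (1-a) - F (1-b) = 2 * ((f b - f a) * (b - a))"
    by (simp add: F_def G_def gd c gab power2_eq_square algebra_simps)
  then have 2: "F (1-a) + F (1-b) < G (1-a) + G (1-b)" using \<open>(f b - f a) * (b - a) > 0\<close> by linarith
  have main: "F x + F (rfl a b x) \<le> G x + G (rfl a b x)" for x
  proof (rule rfl_cases[OF ab(1), of x], goal_cases)
    case 5
    then show ?case by (simp add: F_def G_def g)
  qed (use 1 2 in \<open>simp_all add: FGk\<close>)
  obtain t where t: "t \<in> {1..N}" "cg t a" by (rule residue_ex)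
  then obtain k where k: "t = a + k * N" by (auto elim: cgE)
  have "rfl a b t = b + k * N" using AF_shift[OF rfl_AF[OF ab(1)], of a k] k by simp
  then have strict: "F t + F (rfl a b t) < G t + G (rfl a b t)" using 1 k by (simp add: FGk)
  have "2 * (\<Sum>x\<in>{1..N}. F x) = (\<Sum>x\<in>{1..N}. F x + F (rfl a b x))" by (rule sum_pair[of F, OF FG(1) ab(1)])
  also have "\<dots> < (\<Sum>x\<in>{1..N}. G x + G (rfl a b x))"
    using main strict t(1) by (intro sum_strict_mono_ex1) auto
  also have "\<dots> = 2 * (\<Sum>x\<in>{1..N}. G x)" by (rule sum_pair[of G, OF FG(2) ab(1), symmetric])
  finally show ?thesis by (simp add: displ_def F_def G_def)
qed

lemma displ_nonneg: "0 \<le> displ f" by (simp add: displ_def sum_nonneg)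

end

context gsp_face begin

text \<open>By \<open>V_two\<close> and (P'1), \<open>(f x - x) div N\<close> lies between -1 and 2,
  which explains the constant \<open>3 * N\<close>. Together with \<open>displ_step\<close> this
  bounds the length of ascending chains.\<close>

lemma displ_bound: assumes f: "permissible f" shows "displ f \<le> N * (3 * N)\<^sup>2"
proof -
  obtain i where i: "i \<in> K" using K_ne by blast
  have "(f x - x)\<^sup>2 \<le> (3 * N)\<^sup>2" for x
  proof -
    define r where "r = (f x - x) div N"
    have r: "- 1 \<le> r" "r \<le> 2" using V_two[of f x i] permissibleD(4,5)[OF f i, of x] unfolding r_def by linarith+
    have "N * (- 1) \<le> N * r" "N * r \<le> N * 2" by (rule mult_left_mono; use r N_ge in linarith)+
    then have "\<bar>f x - x\<bar> \<le> \<bar>3 * N\<bar>" using div_N_bounds[of "f x - x"] N_ge unfolding r_def[symmetric] by linarith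
    then show ?thesis by (simp only: abs_le_square_iff)
  qed
  then have "displ f \<le> (\<Sum>x\<in>{1..N}. (3 * N)\<^sup>2)" unfolding displ_def by (intro sum_mono) auto
  then show ?thesis using N_ge(2) by simp
qed

text \<open>Steps between values not distinguished by any \<^term>\<open>Om i\<close> stay inside one coset and are skipped:
  they need not remain steps after changing the representative.\<close>

lemma permissible_chain:
  assumes "permissible f" and s: "2 * s \<le> N"
  shows "\<exists>g. permissible g \<and> final g \<and> (\<forall>h. face_fix h \<longrightarrow> (\<exists>h'. face_fix h' \<and> step\<^sup>*\<^sup>* (h' \<circ> f) (h \<circ> g)))"
  using assms(1)
proof (induction "nat (N * (3 * N)\<^sup>2 - displ f)" arbitrary: f rule: less_induct)
  case less
  show ?case
  proof (cases "final f")
    case True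
    then show ?thesis using less.prems by blast
  next
    case False
    obtain f1 where f1: "step f f1" "permissible f1" using permissible_step_up[OF less.prems s False] by blast
    note fAF = permissibleD(2)[OF less.prems]
    have "displ f < displ f1" by (rule displ_step[OF fAF f1(1)])
    then have "nat (N * (3 * N)\<^sup>2 - displ f1) < nat (N * (3 * N)\<^sup>2 - displ f)"
      using displ_bound[OF f1(2)] by linarith
    from less.hyps[OF this f1(2)] obtain g where g: "permissible g" "final g"
      "\<And>h. face_fix h \<Longrightarrow> \<exists>h'. face_fix h' \<and> step\<^sup>*\<^sup>* (h' \<circ> f1) (h \<circ> g)" by blast
    obtain a b where ab: "\<not> cg a b" "a < b" "f a < f b" and f1': "f1 = f \<circ> rfl a b"
      using f1(1) by (auto simp: step_def)
    \<comment> \<open>The representative at the top is arbitrary, and the one below is adapted to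
      it. This freedom allows the chain to end at a minimal representative.\<close>
    have "\<exists>h'. face_fix h' \<and> step\<^sup>*\<^sup>* (h' \<circ> f) (h \<circ> g)" if h: "face_fix h" for h
    proof -
      obtain h1 where h1: "face_fix h1" "step\<^sup>*\<^sup>* (h1 \<circ> f1) (h \<circ> g)" using g(3)[OF h] by blast
      show ?thesis
      proof (cases "\<exists>i\<in>K. Om i (f a) \<noteq> Om i (f b)")
        case True
        then have "h1 (f a) < h1 (f b)" using face_fix_less[OF h1(1)] ab(3) by blast
        then have "step (h1 \<circ> f) (h1 \<circ> f1)" unfolding step_def f1' using ab by (auto simp: comp_assoc)
        then show ?thesis using h1 converse_rtranclp_into_rtranclp[of step] by blast
      next
        case False
        then have "face_fix (rfl (f a) (f b))" using ab(1) AF_cg[OF fAF] by (intro face_fix_rfl) auto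
        moreover have "h1 \<circ> f1 = (h1 \<circ> rfl (f a) (f b)) \<circ> f"
          by (simp add: f1' rfl_conj'[OF fAF] comp_assoc)
        ultimately show ?thesis using h1 face_fix_comp by metis
      qed
    qed
    then show ?thesis using g by blast
  qed
qed

end

context affine_gsp begin

subsection \<open>The extended affine Weyl group as affine permutations\<close>

text \<open>Division with remainders in \<open>1..N\<close>, matching the numbering of the
  coordinates.\<close>

definition res :: "int \<Rightarrow> nat" where "res x = nat ((x - 1) mod N) + 1"
definition quo :: "int \<Rightarrow> int" where "quo x = (x - 1) div N"

lemma res_quo: "x = int (res x) + N * quo x" "res x \<in> {1..2*m}"
proof -
  have b: "0 \<le> (x - 1) mod N" "(x - 1) mod N < N" using N_ge by simp_all
  then have "int (res x) = (x - 1) mod N + 1" by (simp add: res_def)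
  then show "x = int (res x) + N * quo x" using mult_div_mod_eq[of N "x - 1"] unfolding quo_def by linarith
  have "int (res x) \<le> N" "1 \<le> int (res x)" using b \<open>int (res x) = _\<close> by linarith+
  then show "res x \<in> {1..2*m}" by (auto simp: N_def)
qed

lemma res_quo_eq:
  assumes "j \<in> {1..2*m}" "x = int j + N * k"
  shows "res x = j" "quo x = k"
proof -
  have j: "1 \<le> int j" "int j \<le> N" using assms(1) by (auto simp: N_def)
  have "(x - 1) div N = k" using j assms(2) by (intro div_N_eqI) (simp_all add: algebra_simps)
  then show q: "quo x = k" by (simp add: quo_def)
  then show "res x = j" using res_quo(1)[of x] assms(2) by simp
qed

lemma res_int [simp]: "j \<in> {1..2*m} \<Longrightarrow> res (int j) = j" "j \<in> {1..2*m} \<Longrightarrow> quo (int j) = 0"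
  using res_quo_eq[of j "int j" 0] by simp_all

lemma res_shift [simp]: "res (x + k * N) = res x" "quo (x + k * N) = quo x + k"
  using res_quo_eq[OF res_quo(2)[of x], of "x + k * N" "quo x + k"] res_quo(1)[of x]
  by (simp_all add: algebra_simps)

lemma res_N [simp]: "res (x + N) = res x" "quo (x + N) = quo x + 1"
  using res_shift[of x 1] by simp_all

lemma dual_in: "j \<in> {1..2*m} \<Longrightarrow> dual m j \<in> {1..2*m}" "j \<in> {1..2*m} \<Longrightarrow> dual m (dual m j) = j"
  "j \<in> {1..2*m} \<Longrightarrow> int (dual m j) = N + 1 - int j"
  by (auto simp: dual_def N_def)

lemma res_dual: "res (1 - x) = dual m (res x)" "quo (1 - x) = - quo x - 1"
proof -
  have "1 - x = int (dual m (res x)) + N * (- quo x - 1)"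
    using res_quo(1)[of x] dual_in(3)[OF res_quo(2)[of x]] by (simp add: algebra_simps)
  from res_quo_eq[OF dual_in(1)[OF res_quo(2)] this]
  show "res (1 - x) = dual m (res x)" "quo (1 - x) = - quo x - 1" by simp_all
qed

lemma cg_res: "cg x y \<longleftrightarrow> res x = res y"
proof
  assume "cg x y" then show "res x = res y" by (auto elim!: cgE)
next
  assume "res x = res y"
  then have "x = y + (quo x - quo y) * N" using res_quo(1)[of x] res_quo(1)[of y] by (simp add: algebra_simps)
  then show "cg x y" unfolding cg_iff by blast
qed

lemma SstarD: assumes "\<sigma> \<in> Sstar m"
  shows "\<sigma> permutes {1..2*m}" "bij \<sigma>" "inv \<sigma> \<in> Sstar m" "j \<in> {1..2*m} \<Longrightarrow> \<sigma> j \<in> {1..2*m}"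
    "j \<in> {1..2*m} \<Longrightarrow> \<sigma> (dual m j) = dual m (\<sigma> j)" "inv \<sigma> (\<sigma> x) = x" "\<sigma> (inv \<sigma> x) = x"
proof -
  show p: "\<sigma> permutes {1..2*m}" using assms by (simp add: Sstar_def)
  show "bij \<sigma>" by (rule permutes_bij[OF p])
  show i: "j \<in> {1..2*m} \<Longrightarrow> \<sigma> j \<in> {1..2*m}" for j using permutes_in_image[OF p, of j] by simp
  show d: "j \<in> {1..2*m} \<Longrightarrow> \<sigma> (dual m j) = dual m (\<sigma> j)" for j using assms by (simp add: Sstar_def)
  show e: "inv \<sigma> (\<sigma> x) = x" "\<sigma> (inv \<sigma> x) = x" for x using permutes_inverses[OF p] by simp_all
  have p': "inv \<sigma> permutes {1..2*m}" by (rule permutes_inv[OF p])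
  have "inv \<sigma> (dual m j) = dual m (inv \<sigma> j)" if j: "j \<in> {1..2*m}" for j
  proof -
    have "inv \<sigma> j \<in> {1..2*m}" using permutes_in_image[OF p', of j] j by simp
    then have "\<sigma> (dual m (inv \<sigma> j)) = dual m j" using d e by simp
    then show ?thesis using e(1) by metis
  qed
  then show "inv \<sigma> \<in> Sstar m" using p' by (simp add: Sstar_def)
qed

lemma Sstar_comp: "\<sigma> \<in> Sstar m \<Longrightarrow> \<tau> \<in> Sstar m \<Longrightarrow> \<sigma> \<circ> \<tau> \<in> Sstar m"
  using SstarD(4) by (auto simp: Sstar_def intro: permutes_compose)

lemma dual_sum_iff:
  fixes l :: "nat \<Rightarrow> 'a::ab_group_add"
  shows "(\<forall>t\<in>{1..m}. l t + l (dual m t) = l 1 + l (2*m)) \<longleftrightarrow> (\<exists>c. \<forall>t\<in>{1..2*m}. l (dual m t) = c - l t)"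
proof
  assume l: "\<forall>t\<in>{1..m}. l t + l (dual m t) = l 1 + l (2*m)"
  have "l (dual m t) = l 1 + l (2*m) - l t" if "t \<in> {1..2*m}" for t
  proof (cases "t \<le> m")
    case True
    then have "l t + l (dual m t) = l 1 + l (2*m)" using l that by simp
    then show ?thesis by (metis add_diff_cancel_left')
  next
    case False
    then have "dual m t \<in> {1..m}" using that by (auto simp: dual_def)
    then have "l (dual m t) + l t = l 1 + l (2*m)" using l dual_in(2)[OF that] by force
    then show ?thesis by (metis add_diff_cancel_right')
  qed
  then show "\<exists>c. \<forall>t\<in>{1..2*m}. l (dual m t) = c - l t" by blast
next
  assume "\<exists>c. \<forall>t\<in>{1..2*m}. l (dual m t) = c - l t"
  then obtain c where c: "\<And>t. t \<in> {1..2*m} \<Longrightarrow> l (dual m t) = c - l t" by blast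
  have "l (2*m) = c - l 1" using c[of 1] m_pos by (simp add: dual_def)
  then show "\<forall>t\<in>{1..m}. l t + l (dual m t) = l 1 + l (2*m)" using c by auto
qed

lemma Xs_iff: "l \<in> Xs m \<longleftrightarrow> (\<forall>t. t \<notin> {1..2*m} \<longrightarrow> l t = 0) \<and> (\<exists>c. \<forall>t\<in>{1..2*m}. l (dual m t) = c - l t)"
  unfolding Xs_def mem_Collect_eq dual_sum_iff ..

lemma Wt_closed:
  assumes a: "a \<in> Wt m"
  shows "winv a \<in> Wt m" "b \<in> Wt m \<Longrightarrow> wmult a b \<in> Wt m"
proof -
  obtain l \<sigma> where a': "a = (l, \<sigma>)" and l: "l \<in> Xs m" and s: "\<sigma> \<in> Sstar m" using a by (auto simp: Wt_def)
  obtain c where l0: "\<And>t. t \<notin> {1..2*m} \<Longrightarrow> l t = 0" and lc: "\<And>t. t \<in> {1..2*m} \<Longrightarrow> l (dual m t) = c - l t"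
    using l unfolding Xs_iff by blast
  have o: "\<sigma> t = t" "inv \<sigma> t = t" if "t \<notin> {1..2*m}" for t
    using permutes_not_in[OF SstarD(1)[OF s] that] permutes_not_in[OF SstarD(1)[OF SstarD(3)[OF s]] that] by simp_all
  have "(\<lambda>i. - l (\<sigma> i)) \<in> Xs m" unfolding Xs_iff
    using l0 lc o SstarD(4,5)[OF s] by (auto intro!: exI[of _ "- c"])
  then show "winv a \<in> Wt m" using SstarD(3)[OF s] by (simp add: winv_def Wt_def a')
  show "wmult a b \<in> Wt m" if b: "b \<in> Wt m"
  proof -
    obtain l' \<tau> where b': "b = (l', \<tau>)" and l': "l' \<in> Xs m" and t: "\<tau> \<in> Sstar m" using b by (auto simp: Wt_def)
    obtain c' where l0': "\<And>t. t \<notin> {1..2*m} \<Longrightarrow> l' t = 0" and lc': "\<And>t. t \<in> {1..2*m} \<Longrightarrow> l' (dual m t) = c' - l' t"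
      using l' unfolding Xs_iff by blast
    have "(\<lambda>i. l i + l' (inv \<sigma> i)) \<in> Xs m" unfolding Xs_iff
      using l0 lc o l0' lc' SstarD(4,5)[OF SstarD(3)[OF s]] by (auto intro!: exI[of _ "c + c'"])
    then show ?thesis using Sstar_comp[OF s t] by (simp add: wmult_def Wt_def a' b' pvec_def)
  qed
qed

lemma id_Sstar: "id \<in> Sstar m" by (simp add: Sstar_def permutes_id)

lemma wone_Wt: "wone \<in> Wt m"
  by (auto simp: wone_def Wt_def Xs_def id_Sstar)

text \<open>The inverse permutation occurs because \<open>aff w\<close> pulls points back:
  \<open>lift (act w X)\<close> is \<open>lift X \<circ> aff w\<close>. Therefore \<open>aff\<close>
  reverses products.\<close>

definition aff :: "elt \<Rightarrow> int \<Rightarrow> int" where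
  "aff w x = int (inv (snd w) (res x)) + N * (fst w (res x) + quo x)"

lemma aff_res: assumes "w \<in> Wt m"
  shows "res (aff w x) = inv (snd w) (res x)" "quo (aff w x) = fst w (res x) + quo x"
proof -
  have "snd w \<in> Sstar m" using assms by (auto simp: Wt_def)
  then have "inv (snd w) (res x) \<in> {1..2*m}" using SstarD(3,4) res_quo(2) by blast
  from res_quo_eq[OF this aff_def] show "res (aff w x) = inv (snd w) (res x)" "quo (aff w x) = fst w (res x) + quo x" .
qed

lemma aff_mult: assumes "a \<in> Wt m" "b \<in> Wt m" shows "aff (wmult a b) = aff b \<circ> aff a"
proof
  fix x
  have s: "snd a \<in> Sstar m" "snd b \<in> Sstar m" using assms by (auto simp: Wt_def)
  have i: "inv (snd a \<circ> snd b) = inv (snd b) \<circ> inv (snd a)"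
    by (rule o_inv_distrib[OF SstarD(2)[OF s(1)] SstarD(2)[OF s(2)]])
  show "aff (wmult a b) x = (aff b \<circ> aff a) x"
    unfolding comp_apply aff_def[of "wmult a b"] aff_def[of b] aff_res[OF assms(1)]
    by (simp add: wmult_def pvec_def i del: o_apply, simp add: algebra_simps)
qed

lemma aff_one: "aff wone = id"
  using res_quo(1) by (auto simp: aff_def wone_def fun_eq_iff)

lemma wmult_winv: assumes "a \<in> Wt m" shows "wmult a (winv a) = wone" "wmult (winv a) a = wone"
proof -
  have s: "snd a \<in> Sstar m" using assms by (auto simp: Wt_def)
  note i = SstarD(6,7)[OF s]
  have "inv (inv (snd a)) = snd a" by (rule inv_inv_eq[OF SstarD(2)[OF s]])
  then show "wmult a (winv a) = wone" "wmult (winv a) a = wone"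
    using i by (auto simp: wmult_def winv_def wone_def pvec_def fun_eq_iff)
qed

lemma aff_winv: assumes "a \<in> Wt m" shows "aff (winv a) \<circ> aff a = id" "aff a \<circ> aff (winv a) = id"
  using aff_mult[OF assms Wt_closed(1)[OF assms]] aff_mult[OF Wt_closed(1)[OF assms] assms]
    wmult_winv[OF assms] aff_one by simp_all

lemma aff_AF: assumes w: "w \<in> Wt m" shows "aff w \<in> AF"
proof -
  obtain l \<sigma> where a': "w = (l, \<sigma>)" and l: "l \<in> Xs m" and s: "\<sigma> \<in> Sstar m" using w by (auto simp: Wt_def)
  obtain c where lc: "\<And>t. t \<in> {1..2*m} \<Longrightarrow> l (dual m t) = c - l t"
    using l unfolding Xs_iff by blast
  have b: "bij (aff w)" using o_bij[OF aff_winv[OF w]] .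
  have "aff w (1 - x) = c * N + 1 - aff w x" for x
  proof -
    have r: "res x \<in> {1..2*m}" by (rule res_quo)
    have r': "inv \<sigma> (res x) \<in> {1..2*m}" using SstarD(4)[OF SstarD(3)[OF s]] r by blast
    have "aff w (1 - x) = int (inv \<sigma> (dual m (res x))) + N * (l (dual m (res x)) + (- quo x - 1))"
      by (simp add: aff_def a' res_dual)
    also have "\<dots> = N + 1 - int (inv \<sigma> (res x)) + N * (c - l (res x) - quo x - 1)"
      unfolding SstarD(5)[OF SstarD(3)[OF s] r] lc[OF r] dual_in(3)[OF r'] by (simp add: algebra_simps)
    also have "\<dots> = c * N + 1 - aff w x" by (simp add: aff_def a' algebra_simps)
    finally show ?thesis .
  qed
  moreover have "aff w (x + N) = aff w x + N" for x by (simp add: aff_def algebra_simps)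
  ultimately show ?thesis using b unfolding AF_def by blast
qed

lemma aff_inj: assumes "a \<in> Wt m" "b \<in> Wt m" "aff a = aff b" shows "a = b"
proof -
  have s: "snd a \<in> Sstar m" "snd b \<in> Sstar m" using assms by (auto simp: Wt_def)
  have l: "fst a \<in> Xs m" "fst b \<in> Xs m" using assms by (auto simp: Wt_def)
  have 1: "inv (snd a) t = inv (snd b) t" "fst a t = fst b t" if "t \<in> {1..2*m}" for t
    using aff_res[OF assms(1), of "int t"] aff_res[OF assms(2), of "int t"] assms(3) that by simp_all
  have "inv (snd a) t = inv (snd b) t" for t
    using 1 permutes_not_in[OF SstarD(1)[OF SstarD(3)[OF s(1)]], of t] permutes_not_in[OF SstarD(1)[OF SstarD(3)[OF s(2)]], of t]
    by (cases "t \<in> {1..2*m}") simp_all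
  then have "inv (snd a) = inv (snd b)" by (rule ext)
  then have "snd a = snd b" using inv_inv_eq[OF SstarD(2)[OF s(1)]] inv_inv_eq[OF SstarD(2)[OF s(2)]] by metis
  moreover have "fst a t = fst b t" for t
    using 1 l unfolding Xs_iff by (cases "t \<in> {1..2*m}") simp_all
  ultimately show ?thesis by (auto simp: prod_eq_iff fun_eq_iff)
qed

lemma aff_surj: assumes f: "f \<in> AF" obtains w where "w \<in> Wt m" "aff w = f"
proof -
  obtain c where c: "\<And>a. f (1 - a) = c * N + 1 - f a" using f by (auto simp: AF_def)
  define \<tau> where "\<tau> t = (if t \<in> {1..2*m} then res (f (int t)) else t)" for t
  define l where "l t = (if t \<in> {1..2*m} then quo (f (int t)) else 0)" for t
  have inj: "inj_on \<tau> {1..2*m}"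
  proof (rule inj_onI)
    fix x y assume xy: "x \<in> {1..2*m}" "y \<in> {1..2*m}" "\<tau> x = \<tau> y"
    then have "cg (f (int x)) (f (int y))" by (simp add: \<tau>_def cg_res)
    then have "cg (int x) (int y)" using AF_cg[OF f] by simp
    then show "x = y" using xy by (simp add: cg_res)
  qed
  have "\<tau> ` {1..2*m} \<subseteq> {1..2*m}" using res_quo(2) by (auto simp: \<tau>_def)
  then have "\<tau> ` {1..2*m} = {1..2*m}" using endo_inj_surj[OF _ _ inj] by simp
  then have p: "\<tau> permutes {1..2*m}" using inj by (intro bij_imp_permutes) (auto simp: bij_betw_def \<tau>_def)
  have fd: "f (int (dual m t)) = 1 - f (int t) + (c + 1) * N" if "t \<in> {1..2*m}" for t
  proof -
    have "int (dual m t) = 1 - int t + 1 * N" using dual_in(3)[OF that] by simp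
    then show ?thesis by (simp only: AF_shift[OF f] c) (simp add: algebra_simps)
  qed
  have ts: "\<tau> \<in> Sstar m"
    unfolding Sstar_def using p fd dual_in(1) by (auto simp: \<tau>_def res_dual)
  have "l (dual m t) = c - l t" if "t \<in> {1..2*m}" for t
    using fd[OF that] dual_in(1)[OF that] that by (simp add: l_def res_dual)
  then have "l \<in> Xs m" unfolding Xs_iff by (auto simp: l_def)
  then have w: "(l, inv \<tau>) \<in> Wt m" using SstarD(3)[OF ts] by (simp add: Wt_def)
  have "aff (l, inv \<tau>) x = f x" for x
  proof -
    have r: "res x \<in> {1..2*m}" by (rule res_quo)
    have "inv (inv \<tau>) = \<tau>" by (rule inv_inv_eq[OF SstarD(2)[OF ts]])
    then have "aff (l, inv \<tau>) x = int (res (f (int (res x)))) + N * quo (f (int (res x))) + quo x * N"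
      using r by (simp add: aff_def \<tau>_def l_def algebra_simps)
    also have "\<dots> = f (int (res x)) + quo x * N" using res_quo(1) by simp
    also have "\<dots> = f (int (res x) + quo x * N)" by (simp add: AF_shift[OF f])
    also have "\<dots> = f x" using res_quo(1)[of x] by (simp add: mult.commute)
    finally show ?thesis .
  qed
  then show ?thesis using w by (intro that[of "(l, inv \<tau>)"]) auto
qed

definition lift :: "(nat \<Rightarrow> real) \<Rightarrow> int \<Rightarrow> real" where "lift X x = X (res x) + of_int (quo x)"
definition pt :: "(int \<Rightarrow> real) \<Rightarrow> nat \<Rightarrow> real" where "pt L t = (if t \<in> {1..2*m} then L (int t) else 0)"

text \<open>The functions \<open>lift X\<close> with \<open>X\<close> in \<open>V\<close>;
  \<open>C + 1\<close> is the common sum of dual coordinates.\<close>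

definition quasi :: "(int \<Rightarrow> real) \<Rightarrow> bool" where
  "quasi L \<longleftrightarrow> (\<forall>x. L (x + N) = L x + 1) \<and> (\<exists>C. \<forall>x. L (1 - x) = C - L x)"

lemma quasi_shift: "quasi L \<Longrightarrow> L (x + k * N) = L x + of_int k"
  using shift_fun[of L 1 x k] by (simp add: quasi_def)

lemma lift_shift: "lift X (x + k * N) = lift X x + of_int k" by (simp add: lift_def)

lemma lift_int: "t \<in> {1..2*m} \<Longrightarrow> lift X (int t) = X t" by (simp add: lift_def)

lemma Vsp_iff: "X \<in> Vsp m \<longleftrightarrow> (\<forall>t. t \<notin> {1..2*m} \<longrightarrow> X t = 0) \<and> (\<exists>c. \<forall>t\<in>{1..2*m}. X (dual m t) = c - X t)"
  unfolding Vsp_def mem_Collect_eq dual_sum_iff ..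

lemma lift_quasi: assumes "X \<in> Vsp m" shows "quasi (lift X)"
proof -
  obtain c where c: "\<And>t. t \<in> {1..2*m} \<Longrightarrow> X (dual m t) = c - X t" using assms unfolding Vsp_iff by blast
  have "lift X (1 - x) = (c - 1) - lift X x" for x
    using c[OF res_quo(2)[of x]] by (simp add: lift_def res_dual)
  moreover have "lift X (x + N) = lift X x + 1" for x by (simp add: lift_def)
  ultimately show ?thesis unfolding quasi_def by blast
qed

lemma pt_Vsp: assumes "quasi L" shows "pt L \<in> Vsp m" "lift (pt L) = L"
proof -
  obtain C where C: "\<And>x. L (1 - x) = C - L x" using assms by (auto simp: quasi_def)
  have "L (int (dual m t)) = (C + 1) - L (int t)" if "t \<in> {1..2*m}" for t
  proof -
    have "int (dual m t) = 1 - int t + 1 * N" using dual_in(3)[OF that] by simp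
    then show ?thesis by (simp add: quasi_shift[OF assms, of _ 1, simplified] C)
  qed
  then show "pt L \<in> Vsp m" unfolding Vsp_iff using dual_in(1) by (auto simp: pt_def)
  show "lift (pt L) = L"
  proof
    fix x
    have "L x = L (int (res x) + quo x * N)" using res_quo(1)[of x] by (simp add: mult.commute)
    then show "lift (pt L) x = L x" using res_quo(2)[of x] by (simp only: quasi_shift[OF assms] lift_def pt_def if_True)
  qed
qed

lemma Vsp_eqI: assumes "X \<in> Vsp m" "Y \<in> Vsp m" "lift X = lift Y" shows "X = Y"
proof
  fix t show "X t = Y t"
    using assms lift_int[of t X] lift_int[of t Y] unfolding Vsp_iff by (cases "t \<in> {1..2*m}") auto
qed

lemma lift_act: assumes "w \<in> Wt m" shows "lift (act w X) = lift X \<circ> aff w"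
  by (rule ext) (simp add: lift_def aff_res[OF assms] act_def pvec_def)

lemma quasi_comp: assumes "quasi L" "f \<in> AF" shows "quasi (L \<circ> f)"
proof -
  obtain C where C: "\<And>x. L (1 - x) = C - L x" using assms by (auto simp: quasi_def)
  obtain c where c: "\<And>a. f (1 - a) = c * N + 1 - f a" using assms by (auto simp: AF_def)
  have "L (f (1 - x)) = (C + of_int c) - L (f x)" for x
  proof -
    have "f (1 - x) = 1 - f x + c * N" using c by simp
    then show ?thesis by (simp only: quasi_shift[OF assms(1)] C)
  qed
  moreover have "L (f (x + N)) = L (f x) + 1" for x
    using assms by (simp add: AF_N quasi_def)
  ultimately show ?thesis by (auto simp: quasi_def)
qed

lemma act_Vsp: assumes "w \<in> Wt m" "X \<in> Vsp m" shows "act w X \<in> Vsp m"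
proof -
  have "act w X = pt (lift X \<circ> aff w)"
  proof
    fix t
    show "act w X t = pt (lift X \<circ> aff w) t"
    proof (cases "t \<in> {1..2*m}")
      case True
      then show ?thesis using lift_int[OF True, of "act w X"] by (simp add: pt_def lift_act[OF assms(1)])
    next
      case False
      obtain l \<sigma> where a': "w = (l, \<sigma>)" and l: "l \<in> Xs m" and s: "\<sigma> \<in> Sstar m" using assms(1) by (auto simp: Wt_def)
      have "inv \<sigma> t = t" using permutes_not_in[OF SstarD(1)[OF SstarD(3)[OF s]] False] .
      moreover have "l t = 0" "X t = 0" using False l assms(2) unfolding Xs_iff Vsp_iff by blast+
      ultimately show ?thesis using False by (simp only: act_def pvec_def a' pt_def if_False fst_conv snd_conv of_int_0 add_0)
    qed
  qed
  then show ?thesis using pt_Vsp(1)[OF quasi_comp[OF lift_quasi[OF assms(2)] aff_AF[OF assms(1)]]] by simp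
qed

subsection \<open>Hyperplanes and reflections\<close>

text \<open>Equally spaced values: a point of the base alcove lying on no affine root
  hyperplane.\<close>

definition p0 :: "int \<Rightarrow> real" where "p0 x = of_int x / of_int N"

lemma N_real: "real_of_int N > 0" "real_of_int N \<noteq> 0" using N_ge by simp_all

lemma quasi_p0: "quasi p0"
proof -
  have "p0 (1 - x) = 1 / of_int N - p0 x" for x by (simp add: p0_def diff_divide_distrib)
  moreover have "p0 (x + N) = p0 x + 1" for x using N_real by (simp add: p0_def add_divide_distrib)
  ultimately show ?thesis unfolding quasi_def by blast
qed

lemma p0_less: "p0 x < p0 y \<longleftrightarrow> x < y" using N_real by (simp add: p0_def divide_less_cancel)

text \<open>\<open>mid a b\<close> is a point of the hyperplane of \<open>a\<close> and \<open>b\<close>, and \<open>wall_dir a b\<close> a direction in it that is generic: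
  it separates all residues not exchanged by the reflection.\<close>

definition mid :: "int \<Rightarrow> int \<Rightarrow> int \<Rightarrow> real" where "mid a b x = (p0 x + p0 (rfl a b x)) / 2"

text \<open>A function on residues that is injective, changes sign under duality and, being
  odd-valued, never vanishes; the raw material for generic directions.\<close>

definition centred :: "int \<Rightarrow> int" where "centred x = 2 * int (res x) - (N + 1)"

lemma centred: "centred (x + k * N) = centred x" "centred (1 - x) = - centred x" "centred x = centred y \<longleftrightarrow> cg x y" "centred x \<noteq> 0" "\<bar>centred x\<bar> \<le> N"
proof -
  show "centred (x + k * N) = centred x" by (simp add: centred_def)
  show "centred (1 - x) = - centred x" using dual_in(3)[OF res_quo(2)[of x]] by (simp add: centred_def res_dual)
  show "centred x = centred y \<longleftrightarrow> cg x y" by (simp add: centred_def cg_res)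
  have "odd (centred x)" using even_N by (simp add: centred_def)
  then show "centred x \<noteq> 0" by auto
  have "1 \<le> int (res x)" "int (res x) \<le> N" using res_quo(2)[of x] by (auto simp: N_def)
  then show "\<bar>centred x\<bar> \<le> N" by (simp add: centred_def)
qed

definition wall_dir :: "int \<Rightarrow> int \<Rightarrow> int \<Rightarrow> int" where
  "wall_dir a b x = (if cg x a \<or> cg x b then (if cg b (1 - a) then 0 else centred a)
     else if cg x (1 - a) \<or> cg x (1 - b) then - centred a else centred x)"

lemma wall_dir_bound: "\<bar>wall_dir a b x\<bar> \<le> N"
  using centred(5)[of a] centred(5)[of x] N_ge by (simp add: wall_dir_def)

lemma wall_dir_shift: "wall_dir a b (x + k * N) = wall_dir a b x" by (simp add: wall_dir_def centred(1))

lemma cg_eqs: "cg x y \<Longrightarrow> cg z x \<longleftrightarrow> cg z y" "cg x y \<Longrightarrow> cg x z \<longleftrightarrow> cg y z"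
  by (simp_all add: cg_def)

lemma cg_dual_imp: "cg y (1 - x) \<Longrightarrow> cg x (1 - y)" 
  using cg_dual_swap[of x y] by (simp add: cg_commute)

lemma wall_dir_dual: assumes "\<not> cg a b" shows "wall_dir a b (1 - x) = - wall_dir a b x"
proof -
  have *: "cg (1 - x) a \<longleftrightarrow> cg x (1 - a)" "cg (1 - x) b \<longleftrightarrow> cg x (1 - b)" by (simp_all add: cg_dual_swap)
  show ?thesis
  proof (cases "cg b (1 - a)")
    case True
    then have "cg x (1 - a) \<longleftrightarrow> cg x b" "cg x (1 - b) \<longleftrightarrow> cg x a"
      using cg_eqs(1)[OF True, of x] cg_eqs(1)[OF cg_dual_imp[OF True], of x] by simp_all
    then show ?thesis using True by (auto simp: wall_dir_def * centred(2))
  next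
    case False
    have "\<not> (cg x a \<and> cg x (1 - a))" "\<not> (cg x a \<and> cg x (1 - b))" 
      "\<not> (cg x b \<and> cg x (1 - a))" "\<not> (cg x b \<and> cg x (1 - b))"
      using False not_cg_dual(1)[of a] not_cg_dual(1)[of b] cg_dual_imp[of a b] unfolding cg_def by auto
    then show ?thesis using False by (auto simp: wall_dir_def * centred(2))
  qed
qed

lemma wall_dir_rfl: assumes ab: "\<not> cg a b" shows "wall_dir a b (rfl a b x) = wall_dir a b x"
proof (rule rfl_cases[OF ab, of x], goal_cases)
  case (3 k)
  have "\<not> cg b (1 - a)" "\<not> cg a (1 - b)" using 3 cg_dual_imp[of a b] by (auto simp: cg_commute)
  then show ?case using 3 by (simp add: wall_dir_shift) (simp add: wall_dir_def cg_commute)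
next
  case (4 k)
  have "\<not> cg b (1 - a)" "\<not> cg a (1 - b)" using 4 cg_dual_imp[of b a] by (auto simp: cg_commute)
  then show ?case using 4 by (simp add: wall_dir_shift) (simp add: wall_dir_def cg_commute)
qed (simp_all add: wall_dir_shift, simp_all add: wall_dir_def cg_commute)

text \<open>This is genericity. Since \<open>centred\<close> is injective and nonzero, the common
  value on the classes of \<open>a\<close> and \<open>b\<close> occurs on no other class; duality
  and the symmetry in \<open>x\<close> and \<open>y\<close> reduce the mirror classes to this, and
  elsewhere \<open>wall_dir\<close> is \<open>centred\<close>.\<close>

lemma wall_dir_eq: assumes ab: "\<not> cg a b" and e: "wall_dir a b x = wall_dir a b y" shows "cg y x \<or> cg y (rfl a b x)"
proof -
  have P: "cg y x \<or> cg y (rfl a b x)" if x: "cg x a \<or> cg x b" and "cg y a \<or> cg y b" for x y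
  proof -
    have "cg (rfl a b x) a" if "cg x b" using that ab
      by (auto elim!: cgE simp: AF_shift[OF rfl_AF[OF ab]])
    moreover have "cg (rfl a b x) b" if "cg x a" using that
      by (auto elim!: cgE simp: AF_shift[OF rfl_AF[OF ab]])
    ultimately show ?thesis using that unfolding cg_def by auto
  qed
  have d: "wall_dir a b z = (if cg b (1 - a) then 0 else centred a)" if "cg z a \<or> cg z b" for z using that by (simp add: wall_dir_def)
  have d': "wall_dir a b z = (if cg b (1 - a) then 0 else centred (1 - a))" if "cg z (1 - a) \<or> cg z (1 - b)" for z
  proof -
    have "cg (1 - z) a \<or> cg (1 - z) b" using that by (simp add: cg_dual_swap)
    from d[OF this] show ?thesis using wall_dir_dual[OF ab, of z] by (simp add: centred(2) split: if_splits)
  qed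
  have d'': "wall_dir a b z = centred z" if "\<not> (cg z a \<or> cg z b)" "\<not> (cg z (1 - a) \<or> cg z (1 - b))" for z
    using that by (simp add: wall_dir_def)
  have n: "cg z b \<or> cg z a" if "cg z (1 - a) \<or> cg z (1 - b)" "cg b (1 - a)" for z
    using that cg_dual_imp[OF that(2)] unfolding cg_def by auto
  let ?P = "\<lambda>z. cg z a \<or> cg z b" and ?Q = "\<lambda>z. cg z (1 - a) \<or> cg z (1 - b)"
  have *: "cg y x \<or> cg y (rfl a b x)" if "?P x" "wall_dir a b x = wall_dir a b y" for x y
  proof -
    have "?P y"
    proof (rule ccontr)
      assume y: "\<not> ?P y"
      show False
      proof (cases "?Q y")
        case True
        then have "centred a = centred (1 - a)" using n[of y] y that(2) d[OF that(1)] d'[OF True] by (auto split: if_splits)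
        then show False by (simp add: centred(3))
      next
        case False
        then have "centred y = (if cg b (1 - a) then 0 else centred a)" using that(2) d[OF that(1)] d''[OF y False] by simp
        then show False using centred(3)[of y a] centred(4)[of y] y by (simp split: if_splits)
      qed
    qed
    then show ?thesis using P that(1) by blast
  qed
  have sym: "cg y x \<or> cg y (rfl a b x)" if "cg x y \<or> cg x (rfl a b y)" for x y
  proof -
    have "cg (rfl a b x) (rfl a b (rfl a b y))" if "cg x (rfl a b y)" using that AF_cg[OF rfl_AF[OF ab]] by blast
    then show ?thesis using that rfl_rfl[OF ab, of y] cg_sym by force
  qed
  have dm: "cg (1 - y) (1 - x) \<or> cg (1 - y) (rfl a b (1 - x)) \<Longrightarrow> ?thesis" by (simp add: rfl_dual[OF ab])
  have e': "wall_dir a b (1 - x) = wall_dir a b (1 - y)" using e wall_dir_dual[OF ab] by simp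
  consider "?P x" | "?P y" | "?P (1 - x)" | "?P (1 - y)" | "\<not> ?P x" "\<not> ?P y" "\<not> ?Q x" "\<not> ?Q y"
    by (auto simp: cg_dual_swap)
  then show ?thesis
  proof cases
    case 1 then show ?thesis by (rule *[OF _ e])
  next
    case 2 then show ?thesis by (rule sym[OF *[OF _ e[symmetric]]])
  next
    case 3 then show ?thesis by (rule dm[OF *[OF _ e']])
  next
    case 4 then show ?thesis by (rule dm[OF sym[OF *[OF _ e'[symmetric]]]])
  next
    case 5
    then have "centred x = centred y" using e d'' by simp
    then show ?thesis using cg_sym by (simp add: centred(3))
  qed
qed

lemma quasi_mid: assumes ab: "\<not> cg a b" shows "quasi (mid a b)" "mid a b (rfl a b x) = mid a b x"
proof -
  have r: "quasi (p0 \<circ> rfl a b)" by (rule quasi_comp[OF quasi_p0 rfl_AF[OF ab]])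
  obtain C where C: "\<And>x. p0 (1 - x) = C - p0 x" using quasi_p0 by (auto simp: quasi_def)
  have "mid a b (1 - x) = C - mid a b x" for x
    unfolding mid_def rfl_dual[OF ab] C by (simp add: field_simps)
  moreover have "mid a b (x + N) = mid a b x + 1" for x
    using quasi_p0 by (simp add: mid_def rfl_N quasi_def add_divide_distrib)
  ultimately show "quasi (mid a b)" by (auto simp: quasi_def)
  show "mid a b (rfl a b x) = mid a b x" by (simp add: mid_def rfl_rfl[OF ab] add.commute)
qed

lemma quasi_perturb: assumes ab: "\<not> cg a b" and "quasi L" shows "quasi (\<lambda>x. L x + e * of_int (wall_dir a b x))"
proof -
  obtain C where C: "\<And>x. L (1 - x) = C - L x" using assms by (auto simp: quasi_def)
  have "wall_dir a b (x + N) = wall_dir a b x" for x using wall_dir_shift[of a b x 1] by simp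
  moreover have "L (x + N) = L x + 1" for x using assms(2) by (simp add: quasi_def)
  moreover have "L (1 - x) + e * of_int (wall_dir a b (1 - x)) = C - (L x + e * of_int (wall_dir a b x))" for x
    using C wall_dir_dual[OF ab] by simp
  ultimately show ?thesis unfolding quasi_def by (intro conjI allI exI[of _ C]) simp_all
qed

lemma root_idxD:
  assumes "root_idx m i j"
  shows "i \<in> {1..2*m}" "j \<in> {1..2*m}" "\<not> cg (int i) (int j + N * k)"
proof -
  show i: "i \<in> {1..2*m}" "j \<in> {1..2*m}" using assms by (auto simp: root_idx_def)
  have "res (int j + N * k) = j" by (rule res_quo_eq(1)[OF i(2) refl])
  then show "\<not> cg (int i) (int j + N * k)" using i assms by (simp add: cg_res root_idx_def)
qed

lemma Hyp_iff:
  assumes "root_idx m i j"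
  shows "X \<in> Hyp m i j k \<longleftrightarrow> X \<in> Vsp m \<and> lift X (int i) = lift X (int j + N * k)"
  using lift_int[OF root_idxD(1)[OF assms], of X] lift_int[OF root_idxD(2)[OF assms], of X]
    lift_shift[of X "int j" k] by (auto simp: Hyp_def mult.commute)

lemma quasi_rfl_eq:
  assumes L: "quasi L" and ab: "\<not> cg a b" and e: "L a = L b"
  shows "L (rfl a b x) = L x"
proof -
  obtain C where C: "\<And>x. L (1 - x) = C - L x" using L by (auto simp: quasi_def)
  show ?thesis
    by (rule rfl_cases[OF ab, of x]) (simp_all add: quasi_shift[OF L] C e)
qed

lemma act_eq_iff:
  assumes "w \<in> Wt m" "X \<in> Vsp m"
  shows "act w X = X \<longleftrightarrow> lift X \<circ> aff w = lift X"
  using Vsp_eqI[OF act_Vsp[OF assms] assms(2)] lift_act[OF assms(1), of X] by auto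

lemma is_refl_aff:
  assumes r: "root_idx m i j" and w: "w \<in> Wt m" and f: "aff w = rfl (int i) (int j + N * k)"
  shows "is_refl m i j k w"
proof -
  let ?a = "int i" and ?b = "int j + N * k"
  note ab = root_idxD(3)[OF r, of k]
  have "act w (act w X) = X" if X: "X \<in> Vsp m" for X
    by (rule Vsp_eqI) (simp_all add: act_Vsp w X lift_act f comp_assoc rfl_o[OF ab])
  moreover have "{X \<in> Vsp m. act w X = X} = Hyp m i j k"
  proof -
    have "lift X \<circ> rfl ?a ?b = lift X \<longleftrightarrow> lift X ?a = lift X ?b" if "X \<in> Vsp m" for X
    proof
      assume "lift X \<circ> rfl ?a ?b = lift X"
      from fun_cong[OF this, of ?b] show "lift X ?a = lift X ?b" using ab by simp
    next
      assume "lift X ?a = lift X ?b"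
      from quasi_rfl_eq[OF lift_quasi[OF that] ab this] show "lift X \<circ> rfl ?a ?b = lift X" by auto
    qed
    then show ?thesis using act_eq_iff[OF w] Hyp_iff[OF r] f by auto
  qed
  ultimately show ?thesis using w by (auto simp: is_refl_def)
qed

text \<open>\<open>w\<close> fixes the hyperplane pointwise. Testing it on \<open>mid a b\<close>
  and on the shift of this point along \<open>wall_dir a b\<close> shows that \<open>f x\<close> is
  \<open>x\<close> or \<open>rfl a b x\<close> for every \<open>x\<close>. Duality makes the choices
  consistent, and the identity is excluded because it would fix the point \<open>p0\<close> off the
  hyperplane.\<close>

lemma aff_is_refl:
  assumes r: "root_idx m i j" and "is_refl m i j k w"
  shows "w \<in> Wt m" "aff w = rfl (int i) (int j + N * k)"
proof -
  define a b where "a = int i" and "b = int j + N * k"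
  have ab: "\<not> cg a b" unfolding a_def b_def by (rule root_idxD(3)[OF r])
  show w: "w \<in> Wt m" using assms by (simp add: is_refl_def)
  define f where "f = aff w"
  have fAF: "f \<in> AF" unfolding f_def by (rule aff_AF[OF w])
  have fixX: "act w X = X \<longleftrightarrow> lift X a = lift X b" if "X \<in> Vsp m" for X
    using assms(2) that Hyp_iff[OF r, of X k] unfolding is_refl_def a_def b_def by blast
  have fixL: "L (f x) = L x" if L: "quasi L" and "L a = L b" for L x
  proof -
    have "act w (pt L) = pt L" using fixX[OF pt_Vsp(1)[OF L]] pt_Vsp(2)[OF L] that(2) by simp
    then have "L \<circ> f = L" using act_eq_iff[OF w pt_Vsp(1)[OF L]] pt_Vsp(2)[OF L] by (simp add: f_def)
    then show ?thesis by (metis comp_apply)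
  qed
  have mab: "mid a b a = mid a b b" using quasi_mid(2)[OF ab, of b] ab by simp
  have dab: "wall_dir a b a = wall_dir a b b" using wall_dir_rfl[OF ab, of b] ab by simp
  have fx: "f x = x \<or> f x = rfl a b x" for x
  proof -
    have 1: "mid a b (f x) = mid a b x" by (rule fixL[OF quasi_mid(1)[OF ab] mab])
    have "mid a b (f x) + 1 * of_int (wall_dir a b (f x)) = mid a b x + 1 * of_int (wall_dir a b x)"
      by (rule fixL[OF quasi_perturb[OF ab quasi_mid(1)[OF ab]]]) (simp add: mab dab)
    then have "wall_dir a b x = wall_dir a b (f x)" using 1 by simp
    from wall_dir_eq[OF ab this] show ?thesis
    proof
      assume "cg (f x) x"
      then obtain k where k: "f x = x + k * N" by (rule cgE)
      then have "k = 0" using 1 quasi_shift[OF quasi_mid(1)[OF ab], of x k] by simp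
      then show ?thesis using k by simp
    next
      assume "cg (f x) (rfl a b x)"
      then obtain k where k: "f x = rfl a b x + k * N" by (rule cgE)
      then have "k = 0" using 1 quasi_shift[OF quasi_mid(1)[OF ab], of "rfl a b x" k] quasi_mid(2)[OF ab, of x] by simp
      then show ?thesis using k by simp
    qed
  qed
  obtain c where c: "\<And>a. f (1 - a) = c * N + 1 - f a" using fAF by (auto simp: AF_def)
  have rd: "rfl a b (1 - a) = 1 - b" "rfl a b (1 - b) = 1 - a" using ab by (simp_all add: rfl_dual[OF ab])
  \<comment> \<open>The two candidates \<open>1 - a\<close> and \<open>1 - b\<close> for
    \<open>f (1 - z)\<close> are not congruent, so duality modulo \<open>N\<close> decides between
    them.\<close>
  have n: "f (1 - z) = 1 - f z" if z: "f z = a \<or> f z = b" "z = a \<or> z = b" for z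
  proof -
    have "f (1 - z) = 1 - a \<or> f (1 - z) = 1 - b" using fx[of "1 - z"] z(2) rd by auto
    moreover have "cg (f (1 - z)) (1 - f z)" 
  proof -
    have "f (1 - z) = 1 - f z + c * N" using c by simp
    then show ?thesis by (simp only: cg_add cg_refl)
  qed
    ultimately show ?thesis using z(1) ab cg_diff1[of a b] unfolding cg_def by auto
  qed
  have fa: "f a = a \<or> f a = b" using fx[of a] by simp
  have fb: "f b = b \<or> f b = a" using fx[of b] ab by simp
  have ne: "a \<noteq> b" using ab by auto
  have inj: "f a \<noteq> f b" using AF_eq[OF fAF] ne by simp
  have "f a \<noteq> a"
  proof
    assume 1: "f a = a"
    then have 2: "f b = b" using fb inj by auto
    have "f x = x" for x
      by (rule rfl_cases[OF ab, of x]) (use fx[of x] n[of a] n[of b] 1 2 in \<open>simp_all add: AF_shift[OF fAF]\<close>)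
    then have "f = id" by auto
    then have "act w (pt p0) = pt p0" using act_eq_iff[OF w pt_Vsp(1)[OF quasi_p0]] by (simp add: f_def)
    then have "p0 a = p0 b" using fixX[OF pt_Vsp(1)[OF quasi_p0]] pt_Vsp(2)[OF quasi_p0] by simp
    then show False using p0_less[of a b] p0_less[of b a] ne by linarith
  qed
  then have 1: "f a = b" using fa by simp
  then have 2: "f b = a" using fb inj by auto
  have "f x = rfl a b x" for x
    by (rule rfl_cases[OF ab, of x]) (use fx[of x] n[of a] n[of b] 1 2 in \<open>simp_all add: AF_shift[OF fAF]\<close>)
  then show "aff w = rfl (int i) (int j + N * k)" by (auto simp: f_def a_def b_def)
qed

subsection \<open>The base alcove and its walls\<close>

lemma strict_mono_int: "(\<And>x::int. L x < (L (x + 1) :: real)) \<Longrightarrow> x < y \<Longrightarrow> L x < L y"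
proof -
  assume s: "\<And>x::int. L x < L (x + 1)" and "x < y"
  from this(2) show "L x < L y"
  proof (induction y rule: int_gr_induct)
    case (step i)
    then show ?case using s[of i] by linarith
  qed (rule s)
qed

lemma mono_int: "(\<And>x::int. L x \<le> (L (x + 1) :: real)) \<Longrightarrow> x \<le> y \<Longrightarrow> L x \<le> L y"
proof -
  assume s: "\<And>x::int. L x \<le> L (x + 1)" and "x \<le> y"
  from this(2) show "L x \<le> L y"
  proof (induction y rule: int_ge_induct)
    case (step i)
    then show ?case using s[of i] by linarith
  qed simp
qed

lemma lift_succ:
  assumes "res x < 2 * m"
  shows "lift X x = X (res x) + quo x" "lift X (x + 1) = X (res x + 1) + quo x"
proof -
  have "x + 1 = int (res x + 1) + N * quo x" using res_quo(1)[of x] by simp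
  moreover have "res x + 1 \<in> {1..2*m}" using assms by simp
  ultimately have "res (x + 1) = res x + 1" "quo (x + 1) = quo x" using res_quo_eq by blast+
  then show "lift X x = X (res x) + quo x" "lift X (x + 1) = X (res x + 1) + quo x" by (simp_all add: lift_def)
qed

lemma lift_succ_top:
  assumes "res x = 2 * m"
  shows "lift X x = X (2 * m) + quo x" "lift X (x + 1) = X 1 + quo x + 1"
proof -
  have "x + 1 = int 1 + N * (quo x + 1)" using res_quo(1)[of x] assms by (simp add: N_def algebra_simps)
  moreover have "1 \<in> {1..2*m}" using m_pos by simp
  ultimately have "res (x + 1) = 1" "quo (x + 1) = quo x + 1" using res_quo_eq by blast+
  then show "lift X x = X (2 * m) + quo x" "lift X (x + 1) = X 1 + quo x + 1" using assms by (simp_all add: lift_def)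
qed

text \<open>Duality carries the inequalities of the first half of the coordinates to the second
  half, and \<open>x (2 * m) - 1 < x 1\<close> links one period to the next.\<close>

lemma Aalc_iff: "X \<in> Aalc m \<longleftrightarrow> X \<in> Vsp m \<and> (\<forall>x y. x < y \<longrightarrow> lift X x < lift X y)"
proof
  assume X: "X \<in> Aalc m"
  then have V: "X \<in> Vsp m" and top: "X (2*m) - 1 < X 1" and up: "\<And>i. i \<in> {1..m} \<Longrightarrow> X i < X (Suc i)"
    by (auto simp: Aalc_def)
  obtain c where c: "\<And>t. t \<in> {1..2*m} \<Longrightarrow> X (dual m t) = c - X t" using V unfolding Vsp_iff by blast
  have "X t < X (t + 1)" if t: "1 \<le> t" "t < 2 * m" for t
  proof (cases "t \<le> m")
    case True then show ?thesis using up[of t] t by simp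
  next
    case False
    have d: "dual m (t + 1) \<in> {1..m}" "Suc (dual m (t + 1)) = dual m t" using t False by (auto simp: dual_def)
    have "c - X (t + 1) < c - X t" using up[OF d(1)] c[of t] c[of "t + 1"] t d(2) by simp
    then show ?thesis by simp
  qed
  then have "lift X x < lift X (x + 1)" for x
    using lift_succ[of x X] lift_succ_top[of x X] res_quo(2)[of x] top by (cases "res x < 2 * m") auto
  then show "X \<in> Vsp m \<and> (\<forall>x y. x < y \<longrightarrow> lift X x < lift X y)" using V strict_mono_int by blast
next
  assume X: "X \<in> Vsp m \<and> (\<forall>x y. x < y \<longrightarrow> lift X x < lift X y)"
  have "X i < X (Suc i)" if "i \<in> {1..m}" for i
  proof -
    have "i \<in> {1..2*m}" "Suc i \<in> {1..2*m}" using that m_pos by auto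
    moreover have "lift X (int i) < lift X (int (Suc i))" using X by simp
    ultimately show ?thesis by (simp only: lift_int)
  qed
  moreover have "X (2*m) - 1 < X 1"
  proof -
    have "lift X (int (2*m)) < lift X (int 1 + 1 * N)" using X by (simp add: N_def)
    then show ?thesis using lift_int[of "2*m" X] lift_int[of 1 X] m_pos lift_shift[of X "int 1" 1] by simp
  qed
  ultimately show "X \<in> Aalc m" using X by (auto simp: Aalc_def)
qed

lemma lift_dist:
  assumes "\<forall>t\<in>{1..2*m}. \<bar>X t - Y t\<bar> < e"
  shows "\<bar>lift X x - lift Y x\<bar> < e"
  using assms res_quo(2)[of x] by (simp add: lift_def)

lemma clA_mono:
  assumes "X \<in> clA m" "x \<le> y" shows "lift X x \<le> lift X y"
proof (cases "x = y")
  case False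
  show ?thesis
  proof (rule ccontr)
    assume "\<not> ?thesis"
    then have "(lift X x - lift X y) / 2 > 0" by simp
    then obtain a where a: "a \<in> Aalc m" "\<forall>t\<in>{1..2*m}. \<bar>X t - a t\<bar> < (lift X x - lift X y) / 2"
      using assms(1) unfolding clA_def by blast
    have "lift a x < lift a y" using a(1) False assms(2) by (simp add: Aalc_iff)
    then show False using lift_dist[OF a(2), of x] lift_dist[OF a(2), of y] by argo
  qed
qed simp

lemma p0_Aalc: "pt p0 \<in> Aalc m"
  using pt_Vsp[OF quasi_p0] by (simp add: Aalc_iff p0_less)

text \<open>Moving a weakly increasing point slightly towards \<open>p0\<close> makes it strictly
  increasing; \<open>M\<close> bounds the distance to \<open>p0\<close> and thus determines how
  slightly.\<close>

lemma mono_clA: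
  assumes X: "X \<in> Vsp m" and mono: "\<And>x. lift X x \<le> lift X (x + 1)"
  shows "X \<in> clA m"
proof -
  have mono': "x \<le> y \<Longrightarrow> lift X x \<le> lift X y" for x y using mono_int[of "lift X"] mono by blast
  have "\<exists>a\<in>Aalc m. \<forall>t\<in>{1..2*m}. \<bar>X t - a t\<bar> < e" if e: "e > 0" for e
  proof -
    define M where "M = 1 + (\<Sum>t\<in>{1..2*m}. \<bar>X t - p0 (int t)\<bar>)"
    have M: "M \<ge> 1" "\<And>t. t \<in> {1..2*m} \<Longrightarrow> \<bar>X t - p0 (int t)\<bar> < M"
      using member_le_sum[of _ "{1..2*m}" "\<lambda>t. \<bar>X t - p0 (int t)\<bar>"] by (force simp: M_def sum_nonneg)+
    define \<epsilon> where "\<epsilon> = min 1 (e / M)"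
    have eps: "0 < \<epsilon>" "\<epsilon> \<le> 1" "\<epsilon> \<le> e / M" using e M(1) by (auto simp: \<epsilon>_def)
    define L where "L x = (1 - \<epsilon>) * lift X x + \<epsilon> * p0 x" for x
    obtain C where C: "\<And>x. lift X (1 - x) = C - lift X x" using lift_quasi[OF X] by (auto simp: quasi_def)
    obtain D where D: "\<And>x. p0 (1 - x) = D - p0 x" using quasi_p0 by (auto simp: quasi_def)
    have "L (1 - x) = ((1 - \<epsilon>) * C + \<epsilon> * D) - L x" for x by (simp add: L_def C D algebra_simps)
    moreover have "L (x + N) = L x + 1" for x
      using lift_quasi[OF X] quasi_p0 by (simp add: quasi_def L_def algebra_simps)
    ultimately have qL: "quasi L" unfolding quasi_def by blast
    have "L x < L y" if "x < y" for x y
    proof -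
      have "(1 - \<epsilon>) * lift X x \<le> (1 - \<epsilon>) * lift X y" using mono'[of x y] that eps by (intro mult_left_mono) auto
      moreover have "\<epsilon> * p0 x < \<epsilon> * p0 y" using that eps by (intro mult_strict_left_mono) (simp_all add: p0_less)
      ultimately show ?thesis by (simp add: L_def)
    qed
    then have A: "pt L \<in> Aalc m" using pt_Vsp[OF qL] by (simp add: Aalc_iff)
    have "\<bar>X t - pt L t\<bar> < e" if t: "t \<in> {1..2*m}" for t
    proof -
      have "X t - pt L t = \<epsilon> * (X t - p0 (int t))" using t lift_int[OF t, of X] by (simp add: pt_def L_def algebra_simps)
      then have "\<bar>X t - pt L t\<bar> = \<epsilon> * \<bar>X t - p0 (int t)\<bar>" using eps by (simp add: abs_mult)
      also have "\<dots> < \<epsilon> * M" using M(2)[OF t] eps by (intro mult_strict_left_mono) auto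
      also have "\<dots> \<le> e" using eps(3) M(1) by (simp add: pos_le_divide_eq)
      finally show ?thesis .
    qed
    then show ?thesis using A by blast
  qed
  then show ?thesis using X by (auto simp: clA_def)
qed

text \<open>For \<open>c\<close> strictly between \<open>a\<close> and \<open>b\<close>, a point of
  the hyperplane in the closed alcove takes the same value at \<open>a\<close>, \<open>c\<close> and
  \<open>b\<close>. An open piece of the hyperplane allows a move along \<open>wall_dir a b\<close>,
  which separates \<open>c\<close> from \<open>a\<close> unless \<open>c\<close> is congruent to
  \<open>a\<close> or \<open>b\<close>; but then the values differ by a nonzero integer.\<close>

lemma wall_adjacent:
  assumes "is_wall m i j k"
  defines "a \<equiv> int i" and "b \<equiv> int j + N * k"
  shows "\<bar>a - b\<bar> = 1"
proof (rule ccontr)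
  assume na: "\<bar>a - b\<bar> \<noteq> 1"
  have r: "root_idx m i j" using assms by (simp add: is_wall_def)
  have ab: "\<not> cg a b" unfolding a_def b_def by (rule root_idxD(3)[OF r])
  then have "a \<noteq> b" by auto
  then obtain c where c: "(a < c \<and> c < b) \<or> (b < c \<and> c < a)"
    using na that[of "min a b + 1"] by (cases "a < b") auto
  obtain p d where p: "p \<in> Hyp m i j k" and d: "d > 0"
    and ball: "\<And>y. y \<in> Hyp m i j k \<Longrightarrow> (\<forall>t\<in>{1..2*m}. \<bar>y t - p t\<bar> < d) \<Longrightarrow> y \<in> clA m"
    using assms(1) unfolding is_wall_def by blast
  have pV: "p \<in> Vsp m" and pe: "lift p a = lift p b" using p unfolding Hyp_iff[OF r] a_def b_def by blast+
  have squeeze: "lift y c = lift y a" if y: "y \<in> clA m" "lift y a = lift y b" for y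
    using c clA_mono[OF y(1), of a c] clA_mono[OF y(1), of c b] clA_mono[OF y(1), of b c] clA_mono[OF y(1), of c a] y(2)
    by force
  \<comment> \<open>\<open>wall_dir\<close> is bounded by \<open>N\<close>, so the perturbation
    stays within \<open>d / 2\<close>.\<close>
  define \<epsilon> where "\<epsilon> = d / (2 * of_int N)"
  have eps: "\<epsilon> > 0" using d N_real by (simp add: \<epsilon>_def)
  define L where "L x = lift p x + \<epsilon> * of_int (wall_dir a b x)" for x
  have qL: "quasi L" unfolding L_def by (rule quasi_perturb[OF ab lift_quasi[OF pV]])
  have dab: "wall_dir a b a = wall_dir a b b" using wall_dir_rfl[OF ab, of b] ab by simp
  have e: "L a = L b" by (simp add: L_def pe dab)
  have H: "pt L \<in> Hyp m i j k" unfolding Hyp_iff[OF r] using pt_Vsp[OF qL] e by (simp add: a_def b_def)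
  have "\<bar>pt L t - p t\<bar> < d" if t: "t \<in> {1..2*m}" for t
  proof -
    have "pt L t - p t = \<epsilon> * of_int (wall_dir a b (int t))" using t lift_int[OF t, of p] by (simp add: pt_def L_def)
    then have "\<bar>pt L t - p t\<bar> = \<epsilon> * of_int \<bar>wall_dir a b (int t)\<bar>" using eps by (simp add: abs_mult)
    also have "\<dots> \<le> \<epsilon> * of_int N" using wall_dir_bound[of a b "int t"] eps by (intro mult_left_mono) (simp_all only: of_int_le_iff order_less_imp_le)
    also have "\<dots> < d" using d N_real by (simp add: \<epsilon>_def)
    finally show ?thesis .
  qed
  then have "pt L \<in> clA m" using ball[OF H] by blast
  then have 1: "L c = L a" using squeeze[of "pt L"] pt_Vsp(2)[OF qL] e by simp
  have "p \<in> clA m" using ball[OF p] d by simp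
  then have 2: "lift p c = lift p a" using squeeze pe by blast
  have "wall_dir a b a = wall_dir a b c" using 1 2 eps by (simp add: L_def)
  from wall_dir_eq[OF ab this] have "cg c a \<or> cg c b" by simp
  then show False
  proof
    assume "cg c a"
    then obtain l where l: "c = a + l * N" by (rule cgE)
    then have "l = 0" using 2 lift_shift[of p a l] by simp
    then show False using l c by simp
  next
    assume "cg c b"
    then obtain l where l: "c = b + l * N" by (rule cgE)
    then have "l = 0" using 2 pe lift_shift[of p b l] by simp
    then show False using l c by simp
  qed
qed

text \<open>At \<open>mid a b\<close>, consecutive values differ by at least \<open>1 / N\<close>
  unless the reflection exchanges them. So the points of the hyperplane within
  \<open>1 / (4 N)\<close> of it are still weakly increasing.\<close>

lemma adjacent_wall:
  assumes r: "root_idx m i j" and ad: "\<bar>int i - (int j + N * k)\<bar> = 1"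
  shows "is_wall m i j k"
proof -
  define a b where "a = int i" and "b = int j + N * k"
  have ab: "\<not> cg a b" unfolding a_def b_def by (rule root_idxD(3)[OF r])
  define c where "c = min a b"
  have rc: "rfl a b = rfl c (c + 1)"
  proof (cases "a < b")
    case True
    then have "c = a" "b = c + 1" using ad by (auto simp: c_def a_def b_def)
    then show ?thesis by simp
  next
    case False
    then have "c = b" "a = c + 1" using ad by (auto simp: c_def a_def b_def)
    then show ?thesis using rfl_swap[of c "c + 1"] not_cg_adj by simp
  qed
  have mab: "mid a b a = mid a b b" using quasi_mid(2)[OF ab, of b] ab by simp
  note qm = quasi_mid(1)[OF ab]
  define p where "p = pt (mid a b)"
  have lp: "lift p = mid a b" unfolding p_def by (rule pt_Vsp(2)[OF qm])
  have p: "p \<in> Hyp m i j k"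
    using pt_Vsp[OF qm] mab unfolding Hyp_iff[OF r] p_def by (simp add: a_def b_def)
  define d where "d = 1 / (4 * of_int N :: real)"
  have "y \<in> clA m" if y: "y \<in> Hyp m i j k" "\<forall>t\<in>{1..2*m}. \<bar>y t - p t\<bar> < d" for y
  proof (rule mono_clA)
    show yV: "y \<in> Vsp m" using y(1) by (simp add: Hyp_def)
    have ye: "lift y a = lift y b" using y(1) unfolding Hyp_iff[OF r] by (simp add: a_def b_def)
    fix x
    show "lift y x \<le> lift y (x + 1)"
    proof (cases "rfl a b x > rfl a b (x + 1)")
      case True
      then have "rfl x (x + 1) = rfl a b" unfolding rc by (intro rfl_adj_inversion) auto
      then have "rfl a b x = x + 1" by (metis rfl_at(1))
      then show ?thesis using quasi_rfl_eq[OF lift_quasi[OF yV] ab ye, of x] by simp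
    next
      case False
      moreover have "rfl a b x \<noteq> rfl a b (x + 1)" using AF_eq[OF rfl_AF[OF ab]] by simp
      ultimately have "rfl a b (x + 1) \<ge> rfl a b x + 1" by linarith
      then have "p0 (rfl a b x + 1) \<le> p0 (rfl a b (x + 1))" using p0_less by (metis not_le)
      moreover have p01: "p0 (z + 1) = p0 z + 4 * d" for z using N_real by (simp add: p0_def d_def add_divide_distrib)
      ultimately have "mid a b (x + 1) \<ge> mid a b x + 4 * d"
        unfolding mid_def p01 by argo
      then show ?thesis using lift_dist[OF y(2), of x] lift_dist[OF y(2), of "x + 1"] unfolding lp by linarith
    qed
  qed
  moreover have "d > 0" using N_real by (simp add: d_def)
  ultimately show ?thesis unfolding is_wall_def using r p by blast
qed

section \<open>Simple reflections and the generation of \<open>W_a\<close>\<close>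

lemma Simple_aff: assumes "w \<in> Simple m" obtains c where "w \<in> Wt m" "aff w = rfl c (c + 1)"
proof -
  obtain i j k where ijk: "is_wall m i j k" "is_refl m i j k w" using assms by (auto simp: Simple_def)
  then have r: "root_idx m i j" by (simp add: is_wall_def)
  note w = aff_is_refl[OF r ijk(2)]
  have ad: "\<bar>int i - (int j + N * k)\<bar> = 1" by (rule wall_adjacent[OF ijk(1)])
  show ?thesis
  proof (cases "int i < int j + N * k")
    case True
    then have "int j + N * k = int i + 1" using ad by simp
    then show ?thesis using w by (intro that[of "int i"]) simp_all
  next
    case False
    then have e: "int i = (int j + N * k) + 1" using ad by simp
    then have "aff w = rfl (int j + N * k) (int j + N * k + 1)"
      using w(2) rfl_swap[OF not_cg_adj(1)[of "int j + N * k"]] by simp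
    then show ?thesis using w by (intro that[of "int j + N * k"]) simp_all
  qed
qed

lemma Simple_ex: obtains w where "w \<in> Simple m" "aff w = rfl c (c + 1)"
proof -
  note thesisI = that
  have r: "res c \<in> {1..2*m}" by (rule res_quo)
  have ex: thesis if root: "root_idx m i j" and ad: "\<bar>int i - (int j + N * k)\<bar> = 1"
    and e: "rfl (int i) (int j + N * k) = rfl c (c + 1)" for i j k
  proof -
    obtain w where w: "w \<in> Wt m" "aff w = rfl (int i) (int j + N * k)"
      by (rule aff_surj[OF rfl_AF[OF root_idxD(3)[OF root]]])
    then have "w \<in> Simple m" using adjacent_wall[OF root ad] is_refl_aff[OF root w] by (auto simp: Simple_def)
    then show thesis using w(2) e by (intro thesisI[of w]) simp_all
  qed
  show thesis
  proof (cases "res c < 2 * m")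
    case True
    have "c = int (res c) + quo c * N" "c + 1 = int (res c + 1) + N * 0 + quo c * N"
      using res_quo(1)[of c] by (simp_all add: mult.commute)
    then have "rfl (int (res c)) (int (res c + 1) + N * 0) = rfl c (c + 1)" using rfl_shift by metis
    then show thesis using True r by (intro ex[of "res c" "res c + 1" 0]) (simp_all add: root_idx_def)
  next
    case False
    \<comment> \<open>The affine simple reflection, at the wall
      \<open>x 1 - x (2 * m) = - 1\<close>; hence the root \<open>(1, 2 * m)\<close> with constant
      -1.\<close>
    then have rc: "res c = 2 * m" using r by simp
    then have "c = (int (2 * m) + N * (- 1)) + (quo c + 1) * N" "c + 1 = int 1 + (quo c + 1) * N"
      using res_quo(1)[of c] by (simp_all add: N_def algebra_simps)
    then have "rfl c (c + 1) = rfl (int (2 * m) + N * (- 1)) (int 1)" using rfl_shift by metis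
    moreover have ri: "root_idx m 1 (2 * m)" using m_pos by (simp add: root_idx_def)
    moreover have "rfl (int (2 * m) + N * (- 1)) (int 1) = rfl (int 1) (int (2 * m) + N * (- 1))"
      by (rule rfl_swap[OF root_idxD(3)[OF ri]])
    ultimately show thesis by (intro ex[of 1 "2 * m" "- 1"]) (simp_all add: N_def)
  qed
qed

lemma Wt_assoc: assumes "a \<in> Wt m" "b \<in> Wt m" "c \<in> Wt m" shows "wmult (wmult a b) c = wmult a (wmult b c)"
  by (rule aff_inj) (use assms in \<open>simp_all add: Wt_closed aff_mult comp_assoc\<close>)

lemma Wt_one: assumes "a \<in> Wt m" shows "wmult a wone = a" "wmult wone a = a"
  by (rule aff_inj; use assms in \<open>simp add: Wt_closed aff_mult aff_one wone_Wt\<close>)+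

lemma wprod_simps [simp]: "wprod [] = wone" "wprod (w # ws) = wmult w (wprod ws)"
  by (simp_all add: wprod_def)

lemma Simple_Wt: "w \<in> Simple m \<Longrightarrow> w \<in> Wt m" using Simple_aff by blast

lemma wprod_Wt: "set ws \<subseteq> Simple m \<Longrightarrow> wprod ws \<in> Wt m"
  by (induction ws) (auto simp: wone_Wt Wt_closed Simple_Wt)

lemma wprod_append: "set ws \<subseteq> Simple m \<Longrightarrow> set vs \<subseteq> Simple m \<Longrightarrow> wprod (ws @ vs) = wmult (wprod ws) (wprod vs)"
  by (induction ws) (simp_all add: Wt_one wprod_Wt Wt_assoc Simple_Wt)

definition Wgen :: "elt set" where "Wgen = {wprod ws |ws. set ws \<subseteq> Simple m}"

lemma Wgen_Wt: "w \<in> Wgen \<Longrightarrow> w \<in> Wt m" by (auto simp: Wgen_def wprod_Wt)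

lemma Wgen_mult: assumes "a \<in> Wgen" "b \<in> Wgen" shows "wmult a b \<in> Wgen"
proof -
  obtain ws vs where "a = wprod ws" "set ws \<subseteq> Simple m" "b = wprod vs" "set vs \<subseteq> Simple m"
    using assms by (auto simp: Wgen_def)
  then have "wmult a b = wprod (ws @ vs)" "set (ws @ vs) \<subseteq> Simple m" using wprod_append by auto
  then show ?thesis unfolding Wgen_def by blast
qed

lemma Simple_simple_gen: assumes "s \<in> Simple m" shows "s \<in> Wgen"
proof -
  have "s = wprod [s]" using assms by (simp add: Wt_one Simple_Wt)
  then show ?thesis unfolding Wgen_def using assms by (metis (mono_tags, lifting) mem_Collect_eq list.set(1) list.simps(15) insert_subset empty_subsetI)
qed

lemma refl_winv: assumes "w \<in> Wt m" "aff w \<circ> aff w = id" shows "winv w = w"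
proof (rule aff_inj)
  have "aff (winv w) = aff (winv w) \<circ> (aff w \<circ> aff w)" using assms by simp
  also have "\<dots> = aff w" using aff_winv(1)[OF assms(1)] by (simp add: comp_assoc[symmetric])
  finally show "aff (winv w) = aff w" .
qed (use assms in \<open>simp_all add: Wt_closed\<close>)

lemma Wgen_winv: assumes "a \<in> Wgen" shows "winv a \<in> Wgen"
proof -
  obtain ws where "a = wprod ws" "set ws \<subseteq> Simple m" using assms by (auto simp: Wgen_def)
  then show ?thesis
  proof (induction ws arbitrary: a)
    case Nil
    have "winv wone = wone" by (rule refl_winv) (simp_all add: wone_Wt aff_one)
    moreover have "wone \<in> Wgen" unfolding Wgen_def by (auto intro!: exI[of _ "[]"])
    ultimately show ?case using Nil by simp
  next
    case (Cons s ws)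
    have s: "s \<in> Simple m" "set ws \<subseteq> Simple m" using Cons.prems by auto
    obtain c where c: "s \<in> Wt m" "aff s = rfl c (c + 1)" by (rule Simple_aff[OF s(1)])
    have ss: "aff s \<circ> aff s = id" by (simp add: c rfl_o not_cg_adj)
    have w: "wprod ws \<in> Wt m" by (rule wprod_Wt[OF s(2)])
    have "winv a = wmult (winv (wprod ws)) s"
    proof (rule aff_inj)
      have a: "a \<in> Wt m" "a = wmult s (wprod ws)" using Cons.prems wprod_Wt[of "s # ws"] by simp_all
      show "winv a \<in> Wt m" "wmult (winv (wprod ws)) s \<in> Wt m" using a w c by (simp_all add: Wt_closed)
      have "aff a \<circ> (aff s \<circ> aff (winv (wprod ws))) = aff (wprod ws) \<circ> (aff s \<circ> aff s) \<circ> aff (winv (wprod ws))"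
        by (simp add: a(2) aff_mult[OF c(1) w] comp_assoc)
      also have "\<dots> = id" using aff_winv(2)[OF w] ss by simp
      finally have "aff (winv a) \<circ> (aff a \<circ> (aff s \<circ> aff (winv (wprod ws)))) = aff (winv a)" by simp
      then show "aff (winv a) = aff (wmult (winv (wprod ws)) s)"
        using aff_winv(1)[OF a(1)] by (simp add: comp_assoc[symmetric] aff_mult[OF Wt_closed(1)[OF w] c(1)])
    qed
    then show ?case using Wgen_mult[OF Cons.IH[OF refl s(2)] Simple_simple_gen[OF s(1)]] by simp
  qed
qed

text \<open>Induction on the height of the root: a root that is not simple is made smaller by the simple
  reflection at one of its two ends.\<close>

lemma smaller_conj:
  assumes ab: "\<not> cg a b" "a + 1 < b"
  obtains c where "\<bar>rfl c (c + 1) b - rfl c (c + 1) a\<bar> < b - a"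
proof (cases "cg a (2 - b)")
  case False
  let ?r = "rfl (b - 1) (b - 1 + 1)"
  have n: "\<not> cg (b - 1) (b - 1 + 1)" by (rule not_cg_adj)
  have 1: "?r b = b - 1" using rfl_at(2)[OF n] by simp
  have nb: "\<not> cg a b" by (rule ab)
  have e: "1 - (b - 1) = 2 - b" by simp
  have 2: "?r a = a \<or> ?r a = a + 1"
    using nb False unfolding rfl_def by (auto simp: e)
  have "?r b \<noteq> ?r a" using AF_eq[OF rfl_AF[OF n]] ab by simp
  then show ?thesis using 1 2 ab(2) by (intro that[of "b - 1"]) auto
next
  \<comment> \<open>Here \<open>a\<close> is congruent to the dual of \<open>b - 1\<close>, so the
    reflection at the upper end would lower \<open>a\<close> together with \<open>b\<close>; the
    lower end is used instead.\<close>
  case True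
  let ?r = "rfl a (a + 1)"
  have n: "\<not> cg a (a + 1)" by (rule not_cg_adj)
  have 1: "?r a = a + 1" by simp
  obtain k where k: "a = 2 - b + k * N" using True by (rule cgE)
  have "\<not> cg b a" using ab cg_sym by blast
  moreover have "\<not> cg b (a + 1)"
  proof
    assume "cg b (a + 1)"
    then obtain l where "b = a + 1 + l * N" by (rule cgE)
    then have "2 * b + (- k - l) * N = 3" using k by (simp add: algebra_simps)
    moreover have "even (2 * b + (- k - l) * N)" using even_N by simp
    ultimately show False by simp
  qed
  moreover have "\<not> cg b (1 - a)"
  proof
    assume "cg b (1 - a)"
    then have "cg (1 - a) b" by (rule cg_sym)
    then have "cg a (1 - b)" by (simp add: cg_dual_swap)
    then have "cg (1 - b) (1 - b + 1)" using True unfolding cg_def by (simp add: algebra_simps)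
    then show False using not_cg_adj by blast
  qed
  moreover have "\<not> cg b (1 - (a + 1))"
  proof
    assume "cg b (1 - (a + 1))"
    then obtain l where "b = 1 - (a + 1) + l * N" by (rule cgE)
    then have "b = - a + l * N" by simp
    then have kl: "(k + - l) * N = - 2" using k by (simp add: algebra_simps)
    have "N dvd 2" using kl by (metis dvd_triv_right dvd_minus_iff)
    then have "N \<le> 2" by (rule zdvd_imp_le) simp
    then have "N = 2" using N_ge by simp
    then have "b = a + (1 - (a + 1)) * 2 + l * 2" "N = 2" using \<open>b = - a + l * N\<close> by simp_all
    then have "b = a + (1 - (a + 1) + l) * N" by simp
    then have "cg b a" unfolding cg_iff by blast
    then show False using \<open>\<not> cg b a\<close> by blast
  qed
  ultimately have 2: "?r b = b" by (simp add: rfl_def)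
  show ?thesis using 1 2 ab(2) by (intro that[of a]) simp
qed

lemma rfl_conj_simple:
  assumes "\<not> cg a b"
  shows "\<exists>u s. u \<in> Wgen \<and> s \<in> Simple m \<and> aff (wmult (wmult u s) (winv u)) = rfl a b"
  using assms
proof (induction "nat \<bar>b - a\<bar>" arbitrary: a b rule: less_induct)
  case less
  have main: "\<exists>u s. u \<in> Wgen \<and> s \<in> Simple m \<and> aff (wmult (wmult u s) (winv u)) = rfl a b"
    if ab: "\<not> cg a b" "a < b" and IH: "\<And>a' b'. nat \<bar>b' - a'\<bar> < nat \<bar>b - a\<bar> \<Longrightarrow> \<not> cg a' b' \<Longrightarrow>
      \<exists>u s. u \<in> Wgen \<and> s \<in> Simple m \<and> aff (wmult (wmult u s) (winv u)) = rfl a' b'" for a b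
  proof (cases "b = a + 1")
    case True
    obtain s where s: "s \<in> Simple m" "aff s = rfl a (a + 1)" by (rule Simple_ex)
    have o: "wone \<in> Wgen" unfolding Wgen_def by (auto intro!: exI[of _ "[]"])
    have "winv wone = wone" by (rule refl_winv) (simp_all add: wone_Wt aff_one)
    then have "wmult (wmult wone s) (winv wone) = s" using Simple_Wt[OF s(1)] by (simp add: Wt_one)
    then show ?thesis using s True o by (intro exI[of _ wone] exI[of _ s]) simp
  next
    case False
    then have "a + 1 < b" using ab(2) by simp
    from smaller_conj[OF ab(1) this] obtain c where c: "\<bar>rfl c (c + 1) b - rfl c (c + 1) a\<bar> < b - a" by blast
    obtain t where t: "t \<in> Simple m" "aff t = rfl c (c + 1)" by (rule Simple_ex)
    have tW: "t \<in> Wt m" by (rule Simple_Wt[OF t(1)])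
    let ?r = "rfl c (c + 1)"
    have rAF: "?r \<in> AF" by (rule rfl_AF[OF not_cg_adj(1)])
    have rr: "?r \<circ> ?r = id" by (rule rfl_o[OF not_cg_adj(1)])
    have n: "\<not> cg (?r a) (?r b)" using AF_cg[OF rAF] ab(1) by simp
    obtain u s where u: "u \<in> Wgen" "s \<in> Simple m" "aff (wmult (wmult u s) (winv u)) = rfl (?r a) (?r b)"
      using IH[OF _ n] c ab(2) by auto
    have uW: "u \<in> Wt m" and sW: "s \<in> Wt m" using u Wgen_Wt Simple_Wt by blast+
    have v: "wmult t u \<in> Wgen" by (rule Wgen_mult[OF Simple_simple_gen[OF t(1)] u(1)])
    have vW: "wmult t u \<in> Wt m" by (rule Wgen_Wt[OF v])
    have iv: "aff (winv (wmult t u)) = ?r \<circ> aff (winv u)"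
    proof -
      have "aff (winv (wmult t u)) \<circ> (aff u \<circ> ?r) \<circ> (?r \<circ> aff (winv u)) = ?r \<circ> aff (winv u)"
        using aff_winv(1)[OF vW] aff_mult[OF tW uW] t(2) by simp
      moreover have "aff (winv (wmult t u)) \<circ> (aff u \<circ> ?r) \<circ> (?r \<circ> aff (winv u)) =
          aff (winv (wmult t u)) \<circ> (aff u \<circ> (?r \<circ> ?r) \<circ> aff (winv u))" by (simp add: comp_assoc)
      ultimately show ?thesis unfolding rr using aff_winv(2)[OF uW] by simp
    qed
    have "aff (wmult (wmult (wmult t u) s) (winv (wmult t u))) = ?r \<circ> (aff (winv u) \<circ> aff s \<circ> aff u) \<circ> ?r"
      using t(2) tW uW sW vW iv by (simp add: aff_mult Wt_closed comp_assoc)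
    also have "aff (winv u) \<circ> aff s \<circ> aff u = rfl (?r a) (?r b)"
      using u(3) uW sW by (simp add: aff_mult Wt_closed comp_assoc)
    also have "?r \<circ> rfl (?r a) (?r b) \<circ> ?r = ?r \<circ> (?r \<circ> rfl a b)"
      by (simp only: rfl_conj'[OF rAF, of a b] comp_assoc)
    also have "\<dots> = rfl a b" using rr by (simp add: comp_assoc[symmetric])
    finally show ?thesis using v u(2) by blast
  qed
  show ?case
  proof (cases "a < b")
    case True
    then show ?thesis using main[OF less.prems] less.hyps by blast
  next
    case False
    have "a \<noteq> b" using less.prems by auto
    then have lt: "b < a" using False by simp
    have n: "\<not> cg b a" using less.prems cg_sym by blast
    have "\<exists>u s. u \<in> Wgen \<and> s \<in> Simple m \<and> aff (wmult (wmult u s) (winv u)) = rfl b a"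
    proof (rule main[OF n lt])
      fix a' b' assume "nat \<bar>b' - a'\<bar> < nat \<bar>a - b\<bar>" "\<not> cg a' b'"
      then show "\<exists>u s. u \<in> Wgen \<and> s \<in> Simple m \<and> aff (wmult (wmult u s) (winv u)) = rfl a' b'"
        using less.hyps[of b' a'] by (simp add: abs_minus_commute)
    qed
    then show ?thesis using rfl_swap[OF less.prems] by simp
  qed
qed

lemma rfl_simple_gen: assumes "w \<in> Wt m" "\<not> cg a b" "aff w = rfl a b" shows "w \<in> Wgen"
proof -
  obtain u s where u: "u \<in> Wgen" "s \<in> Simple m" "aff (wmult (wmult u s) (winv u)) = rfl a b"
    using rfl_conj_simple[OF assms(2)] by blast
  have "wmult (wmult u s) (winv u) \<in> Wgen" using u Wgen_mult Wgen_winv Simple_simple_gen by blast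
  moreover have "w = wmult (wmult u s) (winv u)" using assms u Wgen_Wt calculation by (intro aff_inj) simp_all
  ultimately show ?thesis by simp
qed

lemma Wa_eq: "Wa m = Wgen"
proof
  have R: "s \<in> Wgen" if "s \<in> Refl_all m" for s
    using that rfl_simple_gen aff_is_refl root_idxD(3) unfolding Refl_all_def by blast
  show "Wa m \<subseteq> Wgen"
  proof
    fix w assume "w \<in> Wa m"
    then show "w \<in> Wgen" unfolding Wa_def
    proof induction
      case gen_one show ?case unfolding Wgen_def by (auto intro!: exI[of _ "[]"])
    qed (use R Wgen_mult Wgen_winv in blast)+
  qed
  have S: "Simple m \<subseteq> Refl_all m" by (auto simp: Simple_def Refl_all_def is_wall_def)
  show "Wgen \<subseteq> Wa m"
  proof
    fix w assume "w \<in> Wgen"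
    then obtain ws where "w = wprod ws" "set ws \<subseteq> Simple m" by (auto simp: Wgen_def)
    then show "w \<in> Wa m"
    proof (induction ws arbitrary: w rule: rev_induct)
      case Nil
      then show ?case by (simp add: Wa_def gen_one)
    next
      case (snoc s ws)
      then have "w = wmult (wprod ws) s" by (simp add: wprod_append Wt_one Simple_Wt)
      moreover have "wprod ws \<in> Wa m" using snoc by simp
      ultimately show ?case using snoc.prems S unfolding Wa_def by (auto intro: gen_step)
    qed
  qed
qed

lemma Trefl_iff: "t \<in> Trefl m \<longleftrightarrow> t \<in> Wt m \<and> (\<exists>a b. \<not> cg a b \<and> aff t = rfl a b)"
proof
  assume "t \<in> Trefl m"
  then obtain u s where t: "t = wmult (wmult u s) (winv u)" and u: "u \<in> Wgen" and s: "s \<in> Simple m"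
    by (auto simp: Trefl_def Wa_eq)
  obtain c where c: "s \<in> Wt m" "aff s = rfl c (c + 1)" by (rule Simple_aff[OF s])
  have uW: "u \<in> Wt m" by (rule Wgen_Wt[OF u])
  let ?i = "aff (winv u)"
  have iAF: "?i \<in> AF" by (rule aff_AF[OF Wt_closed(1)[OF uW]])
  have "aff t = ?i \<circ> rfl c (c + 1) \<circ> aff u"
    using uW c by (simp add: t aff_mult Wt_closed comp_assoc)
  also have "\<dots> = rfl (?i c) (?i (c + 1)) \<circ> (?i \<circ> aff u)" by (simp only: rfl_conj'[OF iAF] comp_assoc)
  also have "\<dots> = rfl (?i c) (?i (c + 1))" using aff_winv(1)[OF uW] by simp
  finally have "aff t = rfl (?i c) (?i (c + 1))" .
  moreover have "\<not> cg (?i c) (?i (c + 1))" using AF_cg[OF iAF] not_cg_adj by simp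
  moreover have "t \<in> Wt m" using uW c by (simp add: t Wt_closed)
  ultimately show "t \<in> Wt m \<and> (\<exists>a b. \<not> cg a b \<and> aff t = rfl a b)" by blast
next
  assume "t \<in> Wt m \<and> (\<exists>a b. \<not> cg a b \<and> aff t = rfl a b)"
  then obtain a b where t: "t \<in> Wt m" and ab: "\<not> cg a b" "aff t = rfl a b" by blast
  obtain u s where u: "u \<in> Wgen" "s \<in> Simple m" "aff (wmult (wmult u s) (winv u)) = rfl a b"
    using rfl_conj_simple[OF ab(1)] by blast
  have "wmult (wmult u s) (winv u) \<in> Wt m" using u Wgen_mult Wgen_winv Simple_simple_gen Wgen_Wt by blast
  then have "t = wmult (wmult u s) (winv u)" using t ab(2) u(3) by (intro aff_inj) simp_all
  then show "t \<in> Trefl m" using u(1,2) unfolding Trefl_def Wa_eq by blast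
qed

subsection \<open>Length and Bruhat order\<close>

text \<open>Follow the pair through the letters of the word. The letter that first inverts its
  current image is, by \<open>rfl_adj_inversion\<close>, the reflection in that image, so deleting
  this letter amounts to composing with \<open>rfl a b\<close>.\<close>

lemma exchange:
  assumes "set ws \<subseteq> Simple m" "\<not> cg a b" "a < b" "aff (wprod ws) a > aff (wprod ws) b"
  shows "\<exists>vs. set vs \<subseteq> Simple m \<and> length vs < length ws \<and> aff (wprod vs) = aff (wprod ws) \<circ> rfl a b"
  using assms
proof (induction ws arbitrary: a b)
  case Nil
  then show ?case by (simp add: aff_one)
next
  case (Cons s ws)
  have s: "s \<in> Simple m" "set ws \<subseteq> Simple m" using Cons.prems by auto
  obtain c where c: "s \<in> Wt m" "aff s = rfl c (c + 1)" by (rule Simple_aff[OF s(1)])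
  have w: "wprod ws \<in> Wt m" by (rule wprod_Wt[OF s(2)])
  have e: "aff (wprod (s # ws)) = aff (wprod ws) \<circ> aff s" by (simp add: aff_mult[OF c(1) w])
  have sAF: "aff s \<in> AF" by (rule aff_AF[OF c(1)])
  show ?case
  proof (cases "aff s a > aff s b")
    case True
    then have "rfl a b = aff s" using rfl_adj_inversion[OF Cons.prems(3)] c(2) by simp
    then have "aff (wprod (s # ws)) \<circ> rfl a b = aff (wprod ws)"
      using rfl_o[OF Cons.prems(2)] by (simp only: e comp_assoc comp_id)
    then show ?thesis using s(2) by (intro exI[of _ ws]) simp
  next
    case False
    have n: "\<not> cg (aff s a) (aff s b)" using AF_cg[OF sAF] Cons.prems(2) by simp
    then have "aff s a \<noteq> aff s b" by auto
    then have lt: "aff s a < aff s b" using False by simp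
    obtain vs where vs: "set vs \<subseteq> Simple m" "length vs < length ws"
      "aff (wprod vs) = aff (wprod ws) \<circ> rfl (aff s a) (aff s b)"
      using Cons.IH[OF s(2) n lt] Cons.prems(4) unfolding e comp_apply by blast
    have "aff (wprod (s # vs)) = aff (wprod ws) \<circ> (rfl (aff s a) (aff s b) \<circ> aff s)"
      using aff_mult[OF c(1) wprod_Wt[OF vs(1)]] by (simp add: vs(3) comp_assoc)
    also have "\<dots> = aff (wprod (s # ws)) \<circ> rfl a b"
      by (simp only: e rfl_conj'[OF sAF, symmetric] comp_assoc)
    finally show ?thesis using vs s by (intro exI[of _ "s # vs"]) simp
  qed
qed

lemma coxlen_word:
  assumes "x \<in> Wgen" obtains ws where "set ws \<subseteq> Simple m" "wprod ws = x" "length ws = coxlen m x"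
proof -
  have "\<exists>n ws. length ws = n \<and> set ws \<subseteq> Simple m \<and> wprod ws = x" using assms by (auto simp: Wgen_def)
  from LeastI_ex[OF this] show ?thesis using that unfolding coxlen_def by blast
qed

lemma coxlen_le: "set ws \<subseteq> Simple m \<Longrightarrow> coxlen m (wprod ws) \<le> length ws"
  unfolding coxlen_def by (rule Least_le) blast

text \<open>\<open>(a, b)\<close> is an inversion of \<open>aff y\<close>, so
  \<open>exchange\<close> shortens a reduced word of \<open>y\<close> to a word of
  \<open>x\<close>.\<close>

lemma step_coxlen:
  assumes x: "x \<in> Wgen" and y: "y \<in> Wgen" and st: "step (aff x) (aff y)"
  shows "coxlen m x < coxlen m y"
proof -
  obtain a b where ab: "\<not> cg a b" "a < b" "aff x a < aff x b" "aff y = aff x \<circ> rfl a b"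
    using st by (auto simp: step_def)
  have "aff y a > aff y b" using ab by simp
  moreover obtain ws where ws: "set ws \<subseteq> Simple m" "wprod ws = y" "length ws = coxlen m y"
    by (rule coxlen_word[OF y])
  ultimately obtain vs where vs: "set vs \<subseteq> Simple m" "length vs < length ws" "aff (wprod vs) = aff y \<circ> rfl a b"
    using exchange[OF ws(1) ab(1,2)] by auto
  have "aff (wprod vs) = aff x" using vs(3) ab(4) rfl_o[OF ab(1)] by (simp add: comp_assoc)
  then have "wprod vs = x" using aff_inj[OF wprod_Wt[OF vs(1)] Wgen_Wt[OF x]] by simp
  then show ?thesis using coxlen_le[OF vs(1)] vs(2) ws(3) by simp
qed

text \<open>Conjugation by \<open>f\<close> moves the reflection to the arguments, where its pair is
  or is not an inversion. The length condition in \<open>bruhat_step\<close> then decides between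
  the two directions.\<close>

lemma rfl_step_cases:
  assumes f: "f \<in> AF" and cd: "\<not> cg c d" and g: "g = rfl c d \<circ> f"
  shows "step f g \<or> step g f"
proof -
  have inv: "f (inv f x) = x" for x using AF_bij[OF f] by (simp add: bij_is_surj surj_f_inv_f)
  have *: "step f g \<or> step g f" if ab: "\<not> cg a b" "a < b" and g: "g = f \<circ> rfl a b" for a b
  proof (cases "f a < f b")
    case True
    then show ?thesis using ab g by (auto simp: step_def)
  next
    case False
    then have "f b < f a" using AF_eq[OF f, of a b] ab by simp
    then have "g a < g b" using ab(1) by (simp add: g)
    moreover have "f = g \<circ> rfl a b" using rfl_o[OF ab(1)] by (simp add: g comp_assoc)
    ultimately have "step g f" unfolding step_def using ab by blast
    then show ?thesis ..
  qed
  define a b where "a = inv f c" and "b = inv f d"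
  have g': "g = f \<circ> rfl a b" unfolding rfl_conj'[OF f] by (simp add: a_def b_def inv g)
  have n: "\<not> cg a b" using cd AF_cg[OF f, of a b] by (simp add: a_def b_def inv)
  have "a \<noteq> b" using n by auto
  then consider "a < b" | "b < a" by linarith
  then show ?thesis
  proof cases
    case 2
    have "\<not> cg b a" using n cg_sym by blast
    then show ?thesis using *[OF _ 2] g' rfl_swap[OF n] by simp
  qed (rule *[OF n _ g'])
qed

lemma Trefl_simple_gen: "t \<in> Trefl m \<Longrightarrow> t \<in> Wgen" using Trefl_iff rfl_simple_gen by blast

lemma bruhat_imp:
  assumes "bruhat m x y" shows "x \<in> Wgen \<and> y \<in> Wgen \<and> step\<^sup>*\<^sup>* (aff x) (aff y)"
  using assms
proof induction
  case (bruhat_refl x)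
  then show ?case by (simp add: Wa_eq)
next
  case (bruhat_step x y t)
  then have y: "y \<in> Wgen" and x: "x \<in> Wgen" and st: "step\<^sup>*\<^sup>* (aff x) (aff y)" by auto
  have yW: "y \<in> Wt m" by (rule Wgen_Wt[OF y])
  obtain c d where t: "t \<in> Wt m" "\<not> cg c d" "aff t = rfl c d" using bruhat_step.hyps(2) Trefl_iff by blast
  have yt: "wmult y t \<in> Wgen" by (rule Wgen_mult[OF y Trefl_simple_gen[OF bruhat_step.hyps(2)]])
  have e: "aff (wmult y t) = rfl c d \<circ> aff y" using aff_mult[OF yW t(1)] t(3) by simp
  from rfl_step_cases[OF aff_AF[OF yW] t(2) e] show ?case
  proof
    assume "step (aff y) (aff (wmult y t))"
    then show ?thesis using st x yt by (meson rtranclp.rtrancl_into_rtrancl)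
  next
    assume "step (aff (wmult y t)) (aff y)"
    then have "coxlen m (wmult y t) < coxlen m y" by (rule step_coxlen[OF yt y])
    then show ?thesis using bruhat_step.hyps(3) by simp
  qed
qed

lemma step_refl:
  assumes y: "y \<in> Wt m" and st: "step (aff y) g"
  obtains t where "t \<in> Trefl m" "aff (wmult y t) = g"
proof -
  obtain a b where ab: "\<not> cg a b" "a < b" "aff y a < aff y b" "g = aff y \<circ> rfl a b"
    using st by (auto simp: step_def)
  have n: "\<not> cg (aff y a) (aff y b)" using AF_cg[OF aff_AF[OF y]] ab(1) by simp
  obtain t where t: "t \<in> Wt m" "aff t = rfl (aff y a) (aff y b)" by (rule aff_surj[OF rfl_AF[OF n]])
  have "aff (wmult y t) = g" using aff_mult[OF y t(1)] t(2) ab(4) rfl_conj'[OF aff_AF[OF y]] by simp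
  moreover have "t \<in> Trefl m" using t n Trefl_iff by blast
  ultimately show ?thesis by (rule that[rotated])
qed

lemma bruhat_if:
  assumes "step\<^sup>*\<^sup>* (aff x) g" and x: "x \<in> Wgen"
  shows "\<exists>y\<in>Wgen. aff y = g \<and> bruhat m x y"
  using assms(1)
proof induction
  case base
  then show ?case using x Wa_eq by (auto intro: bruhat_refl)
next
  case (step g h)
  then obtain y where y: "y \<in> Wgen" "aff y = g" "bruhat m x y" by blast
  obtain t where t: "t \<in> Trefl m" "aff (wmult y t) = h"
    using step_refl[OF Wgen_Wt[OF y(1)]] step.hyps(2) y(2) by blast
  have yt: "wmult y t \<in> Wgen" by (rule Wgen_mult[OF y(1) Trefl_simple_gen[OF t(1)]])
  have "coxlen m y < coxlen m (wmult y t)" using step_coxlen[OF y(1) yt] step.hyps(2) y(2) t(2) by simp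
  then show ?case using bruhat_step[OF y(3) t(1)] yt t(2) by blast
qed

section \<open>The stabilizer of the base alcove and the extended order\<close>

lemma mono_winv:
  assumes w: "w \<in> Wt m" and mono: "\<And>x y. x < y \<Longrightarrow> aff w x < aff w y" and xy: "x < y"
  shows "aff (winv w) x < aff (winv w) y"
proof (rule ccontr)
  assume "\<not> ?thesis"
  then have "aff (winv w) y = aff (winv w) x \<or> aff (winv w) y < aff (winv w) x" by linarith
  moreover have "aff w (aff (winv w) z) = z" for z using aff_winv(2)[OF w] by (metis comp_apply id_apply)
  ultimately show False using mono xy by (metis less_asym less_irrefl)
qed

text \<open>The lift of the single point \<open>pt p0\<close> of the alcove is strictly increasing
  and reflects the order, so the position of its image already decides whether \<open>aff w\<close>
  is increasing.\<close>

lemma Omega_iff: "w \<in> Omega m \<longleftrightarrow> w \<in> Wt m \<and> (\<forall>x y. x < y \<longrightarrow> aff w x < aff w y)"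
proof
  assume w: "w \<in> Omega m"
  then have wW: "w \<in> Wt m" and "act w (pt p0) \<in> Aalc m" using p0_Aalc by (auto simp: Omega_def)
  then show "w \<in> Wt m \<and> (\<forall>x y. x < y \<longrightarrow> aff w x < aff w y)"
    unfolding Aalc_iff lift_act[OF wW] pt_Vsp(2)[OF quasi_p0] by (simp add: p0_less)
next
  assume "w \<in> Wt m \<and> (\<forall>x y. x < y \<longrightarrow> aff w x < aff w y)"
  then have w: "w \<in> Wt m" and mono: "\<And>x y. x < y \<Longrightarrow> aff w x < aff w y" by auto
  let ?v = "winv w"
  have v: "?v \<in> Wt m" by (rule Wt_closed(1)[OF w])
  note mono' = mono_winv[OF w mono]
  have A: "act u X \<in> Aalc m" if "u \<in> Wt m" "\<And>x y. x < y \<Longrightarrow> aff u x < aff u y" "X \<in> Aalc m" for u X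
    using that by (auto simp: Aalc_iff lift_act act_Vsp)
  have "act w ` Aalc m = Aalc m"
  proof
    show "act w ` Aalc m \<subseteq> Aalc m" using A[OF w mono] by blast
    show "Aalc m \<subseteq> act w ` Aalc m"
    proof
      fix X assume X: "X \<in> Aalc m"
      then have XV: "X \<in> Vsp m" by (simp add: Aalc_iff)
      have "act w (act ?v X) = X"
        by (rule Vsp_eqI) (simp_all add: act_Vsp w v XV lift_act comp_assoc aff_winv)
      then show "X \<in> act w ` Aalc m" using A[OF v mono' X] by (metis image_eqI)
    qed
  qed
  then show "w \<in> Omega m" using w by (simp add: Omega_def)
qed

lemma Omega_winv: "w \<in> Omega m \<Longrightarrow> winv w \<in> Omega m"
  using mono_winv Wt_closed(1) unfolding Omega_iff by blast

lemma Omega_mult: "v \<in> Omega m \<Longrightarrow> w \<in> Omega m \<Longrightarrow> wmult v w \<in> Omega m"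
  by (auto simp: Omega_iff Wt_closed aff_mult)

lemma Omega_Wt: "w \<in> Omega m \<Longrightarrow> w \<in> Wt m" by (simp add: Omega_iff)

text \<open>Undoing an inversion lowers the displacement, a nonnegative integer; an element without
  inversions lies in \<open>Omega m\<close>.\<close>

lemma Wt_decomp: assumes "w \<in> Wt m" obtains x \<omega> where "x \<in> Wgen" "\<omega> \<in> Omega m" "w = wmult x \<omega>"
proof -
  have "\<exists>x \<omega>. x \<in> Wgen \<and> \<omega> \<in> Omega m \<and> w = wmult x \<omega>" using assms
  proof (induction "nat (displ (aff w))" arbitrary: w rule: less_induct)
    case less
    show ?case
    proof (cases "\<forall>x y. x < y \<longrightarrow> aff w x < aff w y")
      case True
      then have "w \<in> Omega m" using less.prems by (simp add: Omega_iff)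
      moreover have "wone \<in> Wgen" unfolding Wgen_def by (auto intro!: exI[of _ "[]"])
      ultimately show ?thesis using Wt_one(2)[OF less.prems] by (intro exI[of _ wone] exI[of _ w]) simp
    next
      case False
      then obtain x y where xy: "x < y" "\<not> aff w x < aff w y" by blast
      have wAF: "aff w \<in> AF" by (rule aff_AF[OF less.prems])
      have ne: "aff w y < aff w x" using xy AF_eq[OF wAF, of x y] by simp
      have n: "\<not> cg x y"
      proof
        assume "cg x y"
        then have "cg y x" by (rule cg_sym)
        then obtain k where "y = x + k * N" by (rule cgE)
        then show False using xy AF_shift[OF wAF, of x k] by simp
      qed
      obtain r where r: "r \<in> Wt m" "aff r = rfl x y" by (rule aff_surj[OF rfl_AF[OF n]])
      have rS: "r \<in> Wgen" by (rule rfl_simple_gen[OF r(1) n r(2)])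
      let ?v = "wmult r w"
      have v: "?v \<in> Wt m" "aff ?v = aff w \<circ> rfl x y" using r less.prems by (simp_all add: Wt_closed aff_mult)
      have "aff w = aff ?v \<circ> rfl x y" using v(2) rfl_o[OF n] by (simp add: comp_assoc)
      moreover have "aff ?v x < aff ?v y" using ne n by (simp add: v(2))
      ultimately have "step (aff ?v) (aff w)" unfolding step_def using n xy(1) by blast
      then have "displ (aff ?v) < displ (aff w)" by (rule displ_step[OF aff_AF[OF v(1)]])
      then have "nat (displ (aff ?v)) < nat (displ (aff w))" using displ_nonneg[of "aff ?v"] by linarith
      from less.hyps[OF this v(1)] obtain x' \<omega> where x': "x' \<in> Wgen" "\<omega> \<in> Omega m" "?v = wmult x' \<omega>" by blast
      have "wmult r ?v = wmult (wmult r r) w" using Wt_assoc[OF r(1) r(1) less.prems] by simp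
      also have "wmult r r = wone"
        by (rule aff_inj) (use r in \<open>simp_all add: Wt_closed wone_Wt aff_mult aff_one rfl_o[OF n]\<close>)
      finally have "w = wmult r ?v" using Wt_one(2)[OF less.prems] by simp
      also have "\<dots> = wmult (wmult r x') \<omega>"
        using Wt_assoc[OF r(1) Wgen_Wt[OF x'(1)] Omega_Wt[OF x'(2)]] x'(3) by simp
      finally show ?thesis using Wgen_mult[OF rS x'(1)] x'(2) by blast
    qed
  qed
  then show ?thesis using that by blast
qed

lemma step_mono:
  assumes "\<And>x y. x < y \<Longrightarrow> h x < h y" "step f g" shows "step (h \<circ> f) (h \<circ> g)"
  using assms by (auto simp: step_def comp_assoc)

lemma steps_mono:
  assumes "\<And>x y. x < y \<Longrightarrow> h x < h y" "step\<^sup>*\<^sup>* f g" shows "step\<^sup>*\<^sup>* (h \<circ> f) (h \<circ> g)"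
  using assms(2)
proof induction
  case (step g g')
  then show ?case using step_mono[OF assms(1)] by (meson rtranclp.rtrancl_into_rtrancl)
qed simp

text \<open>Composing with an increasing function on the value side preserves steps, so the factor
  \<open>\<omega>\<close> can be cancelled and restored.\<close>

lemma ext_le_iff:
  assumes w: "w \<in> Wt m" and w': "w' \<in> Wt m"
  shows "ext_le m w w' \<longleftrightarrow> step\<^sup>*\<^sup>* (aff w) (aff w')"
proof
  assume "ext_le m w w'"
  then obtain x x' \<omega> where o: "\<omega> \<in> Omega m" "w = wmult x \<omega>" "w' = wmult x' \<omega>" "bruhat m x x'"
    unfolding ext_le_def by blast
  then have b: "x \<in> Wgen" "x' \<in> Wgen" "step\<^sup>*\<^sup>* (aff x) (aff x')" using bruhat_imp by blast+
  have "step\<^sup>*\<^sup>* (aff \<omega> \<circ> aff x) (aff \<omega> \<circ> aff x')" using o(1) by (intro steps_mono[OF _ b(3)]) (simp add: Omega_iff)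
  then show "step\<^sup>*\<^sup>* (aff w) (aff w')" using o b by (simp add: aff_mult Wgen_Wt Omega_Wt)
next
  assume st: "step\<^sup>*\<^sup>* (aff w) (aff w')"
  obtain x \<omega> where x: "x \<in> Wgen" "\<omega> \<in> Omega m" "w = wmult x \<omega>" by (rule Wt_decomp[OF w])
  note oW = Omega_Wt[OF x(2)] and xW = Wgen_Wt[OF x(1)]
  have vO: "winv \<omega> \<in> Omega m" by (rule Omega_winv[OF x(2)])
  have "step\<^sup>*\<^sup>* (aff (winv \<omega>) \<circ> aff w) (aff (winv \<omega>) \<circ> aff w')"
    using vO by (intro steps_mono[OF _ st]) (simp add: Omega_iff)
  moreover have "aff (winv \<omega>) \<circ> aff w = aff x"
    using aff_winv(1)[OF oW] by (simp add: x(3) aff_mult[OF xW oW] comp_assoc[symmetric])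
  ultimately have "step\<^sup>*\<^sup>* (aff x) (aff (winv \<omega>) \<circ> aff w')" by simp
  then obtain y where y: "y \<in> Wgen" "aff y = aff (winv \<omega>) \<circ> aff w'" "bruhat m x y"
    using bruhat_if[OF _ x(1)] by blast
  have "w' = wmult y \<omega>"
  proof (rule aff_inj[OF w'])
    show "wmult y \<omega> \<in> Wt m" using Wgen_Wt[OF y(1)] oW by (rule Wt_closed(2))
    show "aff w' = aff (wmult y \<omega>)"
      using aff_winv(2)[OF oW] by (simp add: aff_mult[OF Wgen_Wt[OF y(1)] oW] y(2) comp_assoc[symmetric])
  qed
  then show "ext_le m w w'" unfolding ext_le_def Wa_eq using x y by blast
qed

lemma ext_len_ex:
  assumes "w \<in> Wt m" obtains x \<omega> where "x \<in> Wgen" "\<omega> \<in> Omega m" "w = wmult x \<omega>" "coxlen m x = ext_len m w"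
proof -
  have "\<exists>n x \<omega>. x \<in> Wa m \<and> \<omega> \<in> Omega m \<and> w = wmult x \<omega> \<and> coxlen m x = n"
    by (rule Wt_decomp[OF assms]) (unfold Wa_eq, blast)
  from LeastI_ex[OF this] show ?thesis using that unfolding ext_len_def Wa_eq by blast
qed

lemma ext_len_le: "x \<in> Wgen \<Longrightarrow> \<omega> \<in> Omega m \<Longrightarrow> ext_len m (wmult x \<omega>) \<le> coxlen m x"
  unfolding ext_len_def Wa_eq by (rule Least_le) blast

text \<open>Cancelling \<open>\<omega>\<close> from an optimal decomposition of \<open>w'\<close>
  leaves a step inside \<open>W_a\<close>, to which \<open>step_coxlen\<close> applies.\<close>

lemma ext_len_step:
  assumes w: "w \<in> Wt m" and w': "w' \<in> Wt m" and st: "step (aff w) (aff w')"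
  shows "ext_len m w < ext_len m w'"
proof -
  obtain x \<omega> where x: "x \<in> Wgen" "\<omega> \<in> Omega m" "w' = wmult x \<omega>" "coxlen m x = ext_len m w'" by (rule ext_len_ex[OF w'])
  note oW = Omega_Wt[OF x(2)] and xW = Wgen_Wt[OF x(1)]
  have vW: "winv \<omega> \<in> Wt m" by (rule Wt_closed(1)[OF oW])
  have vO: "winv \<omega> \<in> Omega m" by (rule Omega_winv[OF x(2)])
  define y where "y = wmult w (winv \<omega>)"
  have yW: "y \<in> Wt m" using w vW by (simp add: y_def Wt_closed)
  have "step (aff (winv \<omega>) \<circ> aff w) (aff (winv \<omega>) \<circ> aff w')"
    using vO by (intro step_mono[OF _ st]) (simp add: Omega_iff)
  moreover have "aff (winv \<omega>) \<circ> aff w' = aff x"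
    using aff_winv(1)[OF oW] by (simp add: x(3) aff_mult[OF xW oW] comp_assoc[symmetric])
  ultimately have yx: "step (aff y) (aff x)" by (simp add: y_def aff_mult[OF w vW])
  obtain a b where ab: "\<not> cg a b" "aff x = aff y \<circ> rfl a b" using yx by (auto simp: step_def)
  obtain r where r: "r \<in> Wt m" "aff r = rfl a b" by (rule aff_surj[OF rfl_AF[OF ab(1)]])
  have "y = wmult r x"
  proof (rule aff_inj[OF yW])
    show "wmult r x \<in> Wt m" using r xW by (simp add: Wt_closed)
    show "aff y = aff (wmult r x)" using rfl_o[OF ab(1)] by (simp add: aff_mult[OF r(1) xW] ab(2) r(2) comp_assoc)
  qed
  then have yS: "y \<in> Wgen" using Wgen_mult[OF rfl_simple_gen[OF r(1) ab(1) r(2)] x(1)] by simp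
  have "w = wmult y \<omega>"
    using Wt_assoc[OF w vW oW] wmult_winv(2)[OF oW] Wt_one(1)[OF w] by (simp add: y_def)
  then have "ext_len m w \<le> coxlen m y" using ext_len_le[OF yS x(2)] by simp
  also have "\<dots> < coxlen m x" by (rule step_coxlen[OF yS x(1) yx])
  finally show ?thesis using x(4) by simp
qed

lemma ext_len_Omega:
  assumes w: "w \<in> Wt m" and u: "u \<in> Omega m" shows "ext_len m (wmult w u) \<le> ext_len m w"
proof -
  obtain x \<omega> where x: "x \<in> Wgen" "\<omega> \<in> Omega m" "w = wmult x \<omega>" "coxlen m x = ext_len m w" by (rule ext_len_ex[OF w])
  have "wmult w u = wmult x (wmult \<omega> u)" using Wt_assoc[OF Wgen_Wt[OF x(1)] Omega_Wt[OF x(2)] Omega_Wt[OF u]] x(3) by simp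
  then show ?thesis using ext_len_le[OF x(1) Omega_mult[OF x(2) u]] x(4) by simp
qed

end

section \<open>Permissibility and minimal representatives of cosets\<close>

context gsp_face begin

text \<open>(P'2) at a single index determines \<open>c = 2\<close>, by
  \<open>sumV_dual\<close>.\<close>

lemma permissible_iff:
  assumes f: "f \<in> AF"
  shows "permissible f \<longleftrightarrow> (\<forall>i\<in>K. (\<forall>a. 0 \<le> V f i a \<and> V f i a \<le> 2) \<and> zeros f i \<le> s \<and> sumV f i = N)"
proof
  assume p: "permissible f"
  have "2 * sumV f i = 2 * N" for i by (rule sumV_dual[OF f]) (rule permissibleD(3)[OF p])
  then show "\<forall>i\<in>K. (\<forall>a. 0 \<le> V f i a \<and> V f i a \<le> 2) \<and> zeros f i \<le> s \<and> sumV f i = N"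
    using permissibleD(4-6)[OF p] by simp
next
  assume r: "\<forall>i\<in>K. (\<forall>a. 0 \<le> V f i a \<and> V f i a \<le> 2) \<and> zeros f i \<le> s \<and> sumV f i = N"
  obtain c where c: "\<And>a. f (1 - a) = c * N + 1 - f a" using f by (auto simp: AF_def)
  obtain i where i: "i \<in> K" using K_ne by blast
  have "2 * sumV f i = c * N" by (rule sumV_dual[OF f c])
  then have "c * N = 2 * N" using r i by simp
  then have "c = 2" using N_ge by simp
  then show "permissible f" using r c f by (auto simp: permissible_def selfdual_def)
qed

lemma permissible_cong:
  assumes "f \<in> AF" "g \<in> AF" and e: "\<And>i a. i \<in> K \<Longrightarrow> V f i a = V g i a"
  shows "permissible f \<longleftrightarrow> permissible g"
  unfolding permissible_iff[OF assms(1)] permissible_iff[OF assms(2)] by (simp add: e zeros_def sumV_def)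

lemma permissible_face_fix: assumes "f \<in> AF" "face_fix h" shows "permissible (h \<circ> f) \<longleftrightarrow> permissible f"
  by (rule permissible_cong) (use assms in \<open>simp_all add: face_fix_def AF_comp V_def\<close>)

lemma face_fix_inv: assumes "face_fix h" shows "face_fix (inv h)"
proof -
  have h: "h \<in> AF" "\<And>i a. i \<in> K \<Longrightarrow> Om i (h a) = Om i a" using assms by (auto simp: face_fix_def)
  have "h (inv h a) = a" for a using AF_bij[OF h(1)] by (simp add: bij_is_surj surj_f_inv_f)
  then have "Om i (inv h a) = Om i a" if "i \<in> K" for i a using h(2)[OF that, of "inv h a"] by simp
  then show ?thesis using AF_inv[OF h(1)] by (simp add: face_fix_def)
qed

lemma inv_comp_AF: assumes "h \<in> AF" shows "h \<circ> inv h = id" "inv h \<circ> h = id"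
  using AF_bij[OF assms] by (auto simp: bij_is_surj surj_f_inv_f bij_is_inj)

lemma permissible_steps_down: "step\<^sup>*\<^sup>* f g \<Longrightarrow> permissible g \<Longrightarrow> permissible f"
  by (induction rule: rtranclp_induct) (auto dest: permissible_step_down)

definition face_coset :: "elt \<Rightarrow> elt set" where
  "face_coset w = {z \<in> Wt m. \<exists>h. face_fix h \<and> aff z = h \<circ> aff w}"

definition minrep :: "elt set \<Rightarrow> elt \<Rightarrow> bool" where
  "minrep C w \<longleftrightarrow> w \<in> C \<and> (\<forall>u\<in>C. ext_len m w \<le> ext_len m u)"

lemma face_coset_self: "w \<in> Wt m \<Longrightarrow> w \<in> face_coset w"
  by (auto simp: face_coset_def face_fix_def AF_id intro!: exI[of _ id])

lemma minrep_ex: assumes "C \<noteq> {}" obtains w where "minrep C w"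
proof -
  obtain w0 where "w0 \<in> C" using assms by blast
  from ex_has_least_nat[of "\<lambda>w. w \<in> C", OF this, of "ext_len m"] show ?thesis using that unfolding minrep_def by blast
qed

text \<open>No \<open>Om i\<close> separates \<open>c\<close> and \<open>d\<close>, so
  \<open>rfl d c\<close> comes from \<open>W_I\<close>. If \<open>d\<close> were attained before
  \<open>c\<close>, exchanging these two values would give a step up to \<open>z\<close> from the
  same coset.\<close>

lemma no_descent_inv_less:
  assumes w: "w \<in> Wt m" and z: "z \<in> face_coset w"
    and nd: "\<And>y. y \<in> face_coset w \<Longrightarrow> \<not> step (aff y) (aff z)"
    and cd: "c < d" "\<And>i. i \<in> K \<Longrightarrow> Om i c = Om i d"
  shows "inv (aff z) c < inv (aff z) d"
proof (rule ccontr)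
  assume na: "\<not> ?thesis"
  define f a b where "f = aff z" and "a = inv f c" and "b = inv f d"
  obtain h where zW: "z \<in> Wt m" and h: "face_fix h" "aff z = h \<circ> aff w" using z by (auto simp: face_coset_def)
  have fAF: "f \<in> AF" unfolding f_def by (rule aff_AF[OF zW])
  have fi: "f (inv f x) = x" for x using AF_bij[OF fAF] by (simp add: bij_is_surj surj_f_inv_f)
  have fab: "f a = c" "f b = d" by (simp_all add: a_def b_def fi)
  have ba: "b < a" using na fab cd(1) by (cases "a = b") (auto simp: a_def b_def f_def)
  have n: "\<not> cg d c"
  proof
    assume "cg d c"
    then obtain k where k: "d = c + k * N" by (rule cgE)
    obtain i where "i \<in> K" using K_ne by blast
    then have "k = 0" using cd(2) k Om_shift[of i c k] by simp
    then show False using k cd(1) by simp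
  qed
  then have n': "\<not> cg b a" using AF_cg[OF fAF, of b a] fab by simp
  define g where "g = f \<circ> rfl b a"
  have g: "g = rfl d c \<circ> f" unfolding g_def rfl_conj'[OF fAF] fab ..
  have f: "f = g \<circ> rfl b a" using rfl_o[OF n'] by (simp add: g_def comp_assoc)
  have "g b < g a" using n' fab cd(1) by (simp add: g_def)
  then have st: "step g f" unfolding step_def using n' ba f by blast
  have gAF: "g \<in> AF" unfolding g_def by (rule AF_comp[OF fAF rfl_AF[OF n']])
  obtain y where y: "y \<in> Wt m" "aff y = g" by (rule aff_surj[OF gAF])
  have "face_fix (rfl d c)" using cd(2) by (intro face_fix_rfl[OF n]) simp
  then have "face_fix (rfl d c \<circ> h)" by (rule face_fix_comp[OF _ h(1)])
  then have "y \<in> face_coset w" using y g h(2) unfolding face_coset_def f_def by (auto simp: comp_assoc)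
  then show False using nd st y(2) unfolding f_def by blast
qed

text \<open>Write a minimal representative as \<open>aff z = h \<circ> aff x\<close>. Then
  \<open>h\<close> is increasing: on pairs separated by some \<open>Om i\<close> by
  \<open>face_fix_less\<close>, on the others because both inverses are increasing there. So
  \<open>x\<close> and \<open>z\<close> differ by an element of \<open>Omega m\<close>, and
  \<open>x\<close> is no longer than \<open>z\<close>.\<close>

lemma no_descent_minrep:
  assumes w: "w \<in> Wt m" and x: "x \<in> face_coset w"
    and nd: "\<And>y. y \<in> face_coset w \<Longrightarrow> \<not> step (aff y) (aff x)"
  shows "minrep (face_coset w) x"
proof -
  obtain z where z: "minrep (face_coset w) z" using minrep_ex face_coset_self[OF w] by blast
  then have zC: "z \<in> face_coset w" and zm: "\<And>u. u \<in> face_coset w \<Longrightarrow> ext_len m z \<le> ext_len m u" by (auto simp: minrep_def)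
  obtain h1 where xW: "x \<in> Wt m" and h1: "face_fix h1" "aff x = h1 \<circ> aff w" using x by (auto simp: face_coset_def)
  obtain h2 where zW: "z \<in> Wt m" and h2: "face_fix h2" "aff z = h2 \<circ> aff w" using zC by (auto simp: face_coset_def)
  have ndz: "\<not> step (aff y) (aff z)" if y: "y \<in> face_coset w" for y
  proof
    assume "step (aff y) (aff z)"
    then have "ext_len m y < ext_len m z" using y zW by (intro ext_len_step) (auto simp: face_coset_def)
    then show False using zm[OF y] by simp
  qed
  define h where "h = h2 \<circ> inv h1"
  have face_fix: "face_fix h" unfolding h_def by (rule face_fix_comp[OF h2(1) face_fix_inv[OF h1(1)]])
  then have hAF: "h \<in> AF" and hOm: "\<And>i a. i \<in> K \<Longrightarrow> Om i (h a) = Om i a" by (auto simp: face_fix_def)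
  have "inv h1 \<circ> h1 = id" using inv_comp_AF(2) h1(1) by (simp add: face_fix_def)
  then have zx: "aff z = h \<circ> aff x" unfolding h_def h1(2) h2(2) comp_assoc by (metis comp_assoc id_comp)
  note xAF = aff_AF[OF xW] and zAF = aff_AF[OF zW]
  have invz: "inv (aff z) (h c) = inv (aff x) c" for c
  proof -
    have "aff z (inv (aff x) c) = h c" using inv_comp_AF(1)[OF xAF] zx by (metis comp_apply id_apply)
    then show ?thesis using AF_bij[OF zAF] by (metis bij_inv_eq_iff)
  qed
  have mono: "h c < h d" if cd: "c < d" for c d
  proof (cases "\<exists>i\<in>K. Om i c \<noteq> Om i d")
    case True
    then show ?thesis using face_fix_less[OF face_fix _ _ cd] by blast
  next
    case False
    then have e: "\<And>i. i \<in> K \<Longrightarrow> Om i c = Om i d" by blast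
    have 1: "inv (aff x) c < inv (aff x) d" by (rule no_descent_inv_less[OF w x nd cd e])
    show ?thesis
    proof (rule ccontr)
      assume "\<not> ?thesis"
      moreover have "h c \<noteq> h d" using AF_eq[OF hAF] cd by simp
      ultimately have "h d < h c" by simp
      from no_descent_inv_less[OF w zC ndz this]
      have "inv (aff z) (h d) < inv (aff z) (h c)" by (simp add: hOm e)
      then show False using 1 invz by simp
    qed
  qed
  obtain u where u: "u \<in> Wt m" "aff u = h" by (rule aff_surj[OF hAF])
  have uO: "u \<in> Omega m" using u mono by (simp add: Omega_iff)
  have "z = wmult x u" by (rule aff_inj) (use zW xW u zx in \<open>simp_all add: Wt_closed aff_mult\<close>)
  then have "wmult z (winv u) = x"
    using Wt_assoc[OF xW u(1) Wt_closed(1)[OF u(1)]] wmult_winv(1)[OF u(1)] Wt_one(1)[OF xW] by simp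
  then have "ext_len m x \<le> ext_len m z" using ext_len_Omega[OF zW Omega_winv[OF uO]] by simp
  then show ?thesis using x zm unfolding minrep_def by (meson order_trans)
qed

text \<open>Take the shortest element of the coset below \<open>x\<close>: a descent inside the
  coset would be shorter and still below \<open>x\<close>.\<close>

lemma minrep_below:
  assumes w: "w \<in> Wt m" and x: "x \<in> face_coset w"
  obtains z where "minrep (face_coset w) z" "step\<^sup>*\<^sup>* (aff z) (aff x)"
proof -
  have "x \<in> face_coset w \<and> step\<^sup>*\<^sup>* (aff x) (aff x)" using x by simp
  from ex_has_least_nat[of "\<lambda>z. z \<in> face_coset w \<and> step\<^sup>*\<^sup>* (aff z) (aff x)", OF this, of "ext_len m"]
  obtain z where z: "z \<in> face_coset w" "step\<^sup>*\<^sup>* (aff z) (aff x)"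
    and zm: "\<And>y. y \<in> face_coset w \<Longrightarrow> step\<^sup>*\<^sup>* (aff y) (aff x) \<Longrightarrow> ext_len m z \<le> ext_len m y" by blast
  have "\<not> step (aff y) (aff z)" if y: "y \<in> face_coset w" for y
  proof
    assume st: "step (aff y) (aff z)"
    then have "ext_len m y < ext_len m z" using y z(1) by (intro ext_len_step) (auto simp: face_coset_def)
    moreover have "step\<^sup>*\<^sup>* (aff y) (aff x)" using st z(2) by (rule converse_rtranclp_into_rtranclp)
    ultimately show False using zm[OF y] by simp
  qed
  then show ?thesis using no_descent_minrep[OF w z(1)] z(2) that by blast
qed

lemma transl_AF:
  assumes t: "t \<in> Wt m" and st: "snd t = id"
  shows "aff t x = x + fst t (res x) * N" "V (aff t) i x = fst t (res x)"
proof -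
  show e: "aff t x = x + fst t (res x) * N" using res_quo(1)[of x] by (simp add: aff_def st algebra_simps)
  show "V (aff t) i x = fst t (res x)" by (simp add: V_def e Om_shift)
qed

text \<open>\<open>permissible_chain\<close> leaves the top representative free, so the chain can be
  made to end at a minimal representative of the translation's coset; at its lower end
  \<open>minrep_below\<close> descends to one in the coset of \<open>w\<close>.\<close>

lemma permissible_admissible:
  assumes w: "w \<in> Wt m" and p: "permissible (aff w)" and s2: "2 * s \<le> N"
    and T: "\<And>g. permissible g \<Longrightarrow> final g \<Longrightarrow> \<exists>t\<in>TT. t \<in> Wt m \<and> (\<forall>i\<in>K. \<forall>a. V (aff t) i a = V g i a)"
  shows "\<exists>t\<in>TT. \<exists>z y. t \<in> Wt m \<and> minrep (face_coset w) z \<and> minrep (face_coset t) y \<and> ext_le m z y"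
proof -
  obtain g where g: "permissible g" "final g"
    and ch: "\<And>h. face_fix h \<Longrightarrow> \<exists>h'. face_fix h' \<and> step\<^sup>*\<^sup>* (h' \<circ> aff w) (h \<circ> g)"
    using permissible_chain[OF p s2] by blast
  obtain t where t: "t \<in> TT" "t \<in> Wt m" "\<And>i a. i \<in> K \<Longrightarrow> V (aff t) i a = V g i a" using T[OF g] by blast
  note gAF = permissibleD(2)[OF g(1)] and tAF = aff_AF[OF t(2)]
  define h0 where "h0 = g \<circ> inv (aff t)"
  have h0: "face_fix h0"
  proof -
    have "Om i (h0 a) = Om i a" if "i \<in> K" for i a
    proof -
      have "aff t (inv (aff t) a) = a" using inv_comp_AF(1)[OF tAF] by (metis comp_apply id_apply)
      then show ?thesis using t(3)[OF that, of "inv (aff t) a"] by (simp add: V_def h0_def)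
    qed
    then show ?thesis using AF_comp[OF gAF AF_inv[OF tAF]] by (simp add: face_fix_def h0_def)
  qed
  have gt: "g = h0 \<circ> aff t" using inv_comp_AF(2)[OF tAF] by (simp add: h0_def comp_assoc)
  have tg: "aff t = inv h0 \<circ> g"
  proof -
    have "inv h0 \<circ> g = (inv h0 \<circ> h0) \<circ> aff t" by (simp add: gt comp_assoc)
    then show ?thesis using inv_comp_AF(2)[of h0] h0 by (simp add: face_fix_def)
  qed
  obtain y where y: "minrep (face_coset t) y" using minrep_ex face_coset_self[OF t(2)] by blast
  then obtain k where yW: "y \<in> Wt m" and k: "face_fix k" "aff y = k \<circ> aff t" by (auto simp: minrep_def face_coset_def)
  have "face_fix (k \<circ> inv h0)" by (rule face_fix_comp[OF k(1) face_fix_inv[OF h0]])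
  from ch[OF this] obtain h' where h': "face_fix h'" "step\<^sup>*\<^sup>* (h' \<circ> aff w) (aff y)"
    unfolding k(2) tg comp_assoc by blast
  have "h' \<circ> aff w \<in> AF" using h'(1) aff_AF[OF w] by (simp add: face_fix_def AF_comp)
  then obtain x where x: "x \<in> Wt m" "aff x = h' \<circ> aff w" by (rule aff_surj)
  then have xC: "x \<in> face_coset w" using h'(1) by (auto simp: face_coset_def)
  obtain z where z: "minrep (face_coset w) z" "step\<^sup>*\<^sup>* (aff z) (aff x)" by (rule minrep_below[OF w xC])
  have zW: "z \<in> Wt m" using z(1) by (auto simp: minrep_def face_coset_def)
  have "step\<^sup>*\<^sup>* (aff z) (aff y)" using z(2) h'(2) x(2) by simp
  then have "ext_le m z y" using ext_le_iff[OF zW yW] by simp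
  then show ?thesis using t y z by blast
qed

lemma admissible_permissible:
  assumes w: "w \<in> Wt m" and t: "t \<in> Wt m" and pt: "permissible (aff t)"
    and z: "z \<in> face_coset w" and y: "y \<in> face_coset t" and le: "ext_le m z y"
  shows "permissible (aff w)"
proof -
  obtain h1 where zW: "z \<in> Wt m" and h1: "face_fix h1" "aff z = h1 \<circ> aff w" using z by (auto simp: face_coset_def)
  obtain h2 where yW: "y \<in> Wt m" and h2: "face_fix h2" "aff y = h2 \<circ> aff t" using y by (auto simp: face_coset_def)
  have "permissible (aff y)" using pt permissible_face_fix[OF aff_AF[OF t] h2(1)] h2(2) by simp
  then have "permissible (aff z)" using permissible_steps_down le ext_le_iff[OF zW yW] by blast
  then show ?thesis using permissible_face_fix[OF aff_AF[OF w] h1(1)] h1(2) by simp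
qed

end

locale gsp_parahoric = affine_gsp +
  fixes s :: nat and I :: "nat set"
  assumes s_le: "s \<le> m" and I_ne: "I \<noteq> {}"

sublocale gsp_parahoric \<subseteq> gsp_face m "idx m I" "int s"
proof
  fix i k assume i: "i \<in> idx m I"
  have "(i + k * N) mod (2 * int m) = i mod (2 * int m)" by (simp add: N_def)
  then show "i + k * N \<in> idx m I" using i by (simp add: idx_def)
next
  fix i assume "i \<in> idx m I"
  then obtain a where a: "a \<in> I" "i mod (2 * int m) = int a mod (2 * int m) \<or> i mod (2 * int m) = (- int a) mod (2 * int m)"
    by (auto simp: idx_def)
  from a(2) have "(- i) mod (2 * int m) = int a mod (2 * int m) \<or> (- i) mod (2 * int m) = (- int a) mod (2 * int m)"
  proof
    assume "i mod (2 * int m) = int a mod (2 * int m)"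
    from mod_minus_cong[OF this] show ?thesis by simp
  next
    assume "i mod (2 * int m) = (- int a) mod (2 * int m)"
    from mod_minus_cong[OF this] show ?thesis by simp
  qed
  then show "- i \<in> idx m I" using a(1) by (auto simp: idx_def)
next
  show "idx m I \<noteq> {}" using I_ne by (auto simp: idx_def)
qed

section \<open>The vectors \<open>\<omega>\<^sub>i\<close> in coordinates and the orbit of
  \<open>\<mu>\<close>\<close>

context affine_gsp begin

lemma omega_vec_Om: assumes t: "t \<in> {1..2*m}" shows "omega_vec m i t = Om i (int t)"
proof -
  define b where "b = i div N"
  define c where "c = i mod N"
  have i: "i = N * b + c" by (simp add: b_def c_def)
  have c: "0 \<le> c" "c < N" using N_ge by (simp_all add: c_def)
  have t': "1 \<le> int t" "int t \<le> N" using t by (auto simp: N_def)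
  have "(i - int t) div N = (if int t \<le> c then b else b - 1)"
    by (rule div_N_eqI) (use i c t' in \<open>simp_all add: algebra_simps\<close>)
  then show ?thesis using t unfolding omega_vec_def Om_def b_def[symmetric] c_def[symmetric]
    by (simp add: N_def[symmetric] b_def[symmetric] c_def[symmetric])
qed

lemma actZ_omega:
  assumes w: "w \<in> Wt m" and t: "t \<in> {1..2*m}"
  shows "actZ w (omega_vec m i) t = Om i (aff w (int t))"
proof -
  have s: "snd w \<in> Sstar m" using w by (auto simp: Wt_def)
  have r: "inv (snd w) t \<in> {1..2*m}" by (rule SstarD(4)[OF SstarD(3)[OF s] t])
  have "aff w (int t) = int (inv (snd w) t) + fst w t * N" using t by (simp add: aff_def)
  then have "Om i (aff w (int t)) = Om i (int (inv (snd w) t)) + fst w t" by (simp only: Om_shift)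
  then show ?thesis using omega_vec_Om[OF r] by (simp add: actZ_def pvec_def)
qed

lemma V_actZ:
  assumes "w \<in> Wt m" "t \<in> {1..2*m}"
  shows "actZ w (omega_vec m i) t - omega_vec m i t = V (aff w) i (int t)"
  by (simp only: actZ_omega[OF assms] omega_vec_Om[OF assms(2)] V_def)

lemma sum_int: "(\<Sum>t=1..2*m. F (int t)) = (\<Sum>x\<in>{1..N}. F x :: 'b::comm_monoid_add)"
proof -
  have "int ` {1..2*m} = {1..N}" by (simp add: image_int_atLeastAtMost N_def)
  then show ?thesis using sum.reindex[of int "{1..2*m}" F] by simp
qed

lemma all_residues:
  assumes "\<And>a. F (a + N) = (F a :: bool)" shows "(\<forall>t\<in>{1..2*m}. F (int t)) \<longleftrightarrow> (\<forall>a. F a)"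
proof
  assume l: "\<forall>t\<in>{1..2*m}. F (int t)"
  show "\<forall>a. F a"
  proof
    fix a
    have "cg (int (res a)) a" using res_quo(2)[of a] by (simp add: cg_res)
    then have "F (int (res a)) = F a" by (rule periodic_cg[of F, OF assms])
    then show "F a" using l res_quo(2)[of a] by blast
  qed
qed simp

lemma card_zeros:
  "int (card {t \<in> {1..2*m}. V f i (int t) = 0}) = zeros f i"
proof -
  have "int (card {t \<in> {1..2*m}. V f i (int t) = 0}) = (\<Sum>t\<in>{t \<in> {1..2*m}. V f i (int t) = 0}. 1)" by simp
  also have "\<dots> = (\<Sum>t=1..2*m. if V f i (int t) = 0 then 1 else 0)" by (rule sum.inter_filter) simp
  also have "\<dots> = (\<Sum>x\<in>{1..N}. if V f i x = 0 then 1 else 0)" by (rule sum_int[of "\<lambda>x. if V f i x = 0 then 1 else 0"])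
  finally show ?thesis by (simp add: zeros_def zeta_def)
qed

lemma mu_vec_dual:
  assumes "s \<le> m" "t \<in> {1..2*m}" shows "mu_vec m s (dual m t) = 2 - mu_vec m s t"
proof -
  have t: "1 \<le> t" "t \<le> 2 * m" using assms(2) by auto
  then have d: "1 \<le> dual m t" "dual m t \<le> s \<longleftrightarrow> 2 * m - s < t" "dual m t \<le> 2 * m - s \<longleftrightarrow> s < t"
    using assms(1) unfolding dual_def by linarith+
  have "s \<le> 2 * m - s" using assms(1) by linarith
  then show ?thesis using t d(1) unfolding mu_vec_def
    by (cases "t \<le> s"; cases "t \<le> 2 * m - s") (simp_all add: d not_le[symmetric])
qed

text \<open>Half of the permutation is chosen freely, duality forces the rest.\<close>

lemma mu_orbit:
  fixes \<nu> :: "nat \<Rightarrow> int"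
  assumes s: "s \<le> m" and v: "\<And>t. t \<in> {1..2*m} \<Longrightarrow> \<nu> t \<in> {0, 1, 2}"
    and d: "\<And>t. t \<in> {1..2*m} \<Longrightarrow> \<nu> (dual m t) = 2 - \<nu> t"
    and c: "card {t \<in> {1..2*m}. \<nu> t = 0} = s"
  shows "\<exists>\<sigma>\<in>Sstar m. \<forall>t\<in>{1..2*m}. pvec \<sigma> (mu_vec m s) t = \<nu> t"
proof -
  define A where "A = {t \<in> {1..2*m}. \<nu> t = 2}"
  define B where "B = {t \<in> {1..m}. \<nu> t = 1}"
  have fin: "finite A" "finite B" by (simp_all add: A_def B_def)
  have "bij_betw (dual m) {t \<in> {1..2*m}. \<nu> t = 0} A"
    by (rule bij_betw_byWitness[where f' = "dual m"]) (use dual_in d in \<open>auto simp: A_def\<close>)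
  from bij_betw_same_card[OF this] have cA: "card A = s" using c by simp
  \<comment> \<open>Duality matches the zeros of the first half with the twos of the second half, so
    the first half has as many entries other than 1 as there are twos altogether.\<close>
  have cB: "card B = m - s"
  proof -
    have "bij_betw (dual m) {t \<in> {1..m}. \<nu> t = 0} {t \<in> {m+1..2*m}. \<nu> t = 2}"
      by (rule bij_betw_byWitness[where f' = "dual m"]) (use dual_in d in \<open>auto simp: dual_def\<close>)
    then have 1: "card {t \<in> {1..m}. \<nu> t = 0} = card {t \<in> {m+1..2*m}. \<nu> t = 2}" by (rule bij_betw_same_card)
    have "A = {t \<in> {1..m}. \<nu> t = 2} \<union> {t \<in> {m+1..2*m}. \<nu> t = 2}" by (auto simp: A_def)
    then have 2: "s = card {t \<in> {1..m}. \<nu> t = 2} + card {t \<in> {m+1..2*m}. \<nu> t = 2}"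
      using cA card_Un_disjoint[of "{t \<in> {1..m}. \<nu> t = 2}" "{t \<in> {m+1..2*m}. \<nu> t = 2}"] by fastforce
    have "{1..m} = ({t \<in> {1..m}. \<nu> t = 2} \<union> {t \<in> {1..m}. \<nu> t = 0}) \<union> B"
    proof -
      have "\<nu> t = 0 \<or> \<nu> t = 1 \<or> \<nu> t = 2" if "t \<in> {1..m}" for t using v[of t] that by auto
      then show ?thesis unfolding B_def by blast
    qed
    from arg_cong[OF this, of card] have "m = card (({t \<in> {1..m}. \<nu> t = 2} \<union> {t \<in> {1..m}. \<nu> t = 0}) \<union> B)" by simp
    also have "\<dots> = card ({t \<in> {1..m}. \<nu> t = 2} \<union> {t \<in> {1..m}. \<nu> t = 0}) + card B"
      by (rule card_Un_disjoint) (auto simp: B_def)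
    also have "card ({t \<in> {1..m}. \<nu> t = 2} \<union> {t \<in> {1..m}. \<nu> t = 0}) = card {t \<in> {1..m}. \<nu> t = 2} + card {t \<in> {1..m}. \<nu> t = 0}"
      by (rule card_Un_disjoint) auto
    finally show ?thesis using 1 2 by simp
  qed
  have "card {1..s} = card A" "card {s+1..m} = card B" using cA cB by simp_all
  then obtain h1 h2 where h1: "bij_betw h1 {1..s} A" and h2: "bij_betw h2 {s+1..m} B"
    using finite_same_card_bij[OF finite_atLeastAtMost fin(1)] finite_same_card_bij[OF finite_atLeastAtMost fin(2)]
    by meson
  \<comment> \<open>\<open>A \<union> B\<close> contains exactly one member of each dual pair.
    \<open>k\<close> sends the places where \<open>\<mu>\<close> is 2 to \<open>A\<close> and those
    of the first half where it is 1 to \<open>B\<close>.\<close>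
  define k where "k t = (if t \<le> s then h1 t else h2 t)" for t
  have kA: "k t \<in> A" if "t \<in> {1..m}" "t \<le> s" for t
    using bij_betwE[OF h1] that by (simp add: k_def)
  have kB: "k t \<in> B" if "t \<in> {1..m}" "\<not> t \<le> s" for t
    using bij_betwE[OF h2] that by (simp add: k_def)
  have AB: "A \<inter> B = {}" "A \<union> B \<subseteq> {1..2*m}" by (auto simp: A_def B_def)
  have k: "bij_betw k ({1..s} \<union> {s+1..m}) (A \<union> B)"
  proof (rule bij_betw_combine[OF _ _ AB(1)])
    show "bij_betw k {1..s} A" using h1 by (rule bij_betw_cong[THEN iffD1, rotated]) (simp add: k_def)
    show "bij_betw k {s+1..m} B" using h2 by (rule bij_betw_cong[THEN iffD1, rotated]) (simp add: k_def)
  qed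
  have "{1..s} \<union> {s+1..m} = {1..m}" using s by auto
  then have k: "bij_betw k {1..m} (A \<union> B)" using k by simp
  have kin: "k t \<in> {1..2*m}" if "t \<in> {1..m}" for t using bij_betwE[OF k] that AB(2) by blast
  have disj: "(A \<union> B) \<inter> dual m ` (A \<union> B) = {}"
  proof -
    have "dual m t \<notin> A \<union> B" if t: "t \<in> A \<union> B" for t
    proof -
      have "t \<in> {1..2*m}" using t AB(2) by blast
      then have "\<nu> (dual m t) = 2 - \<nu> t" by (rule d)
      moreover have "dual m t \<notin> {1..m}" if "t \<in> {1..m}" using that by (auto simp: dual_def)
      ultimately show ?thesis using t by (auto simp: A_def B_def)
    qed
    then show ?thesis by blast
  qed
  have dl: "dual m t \<in> {1..m}" if "t \<in> {m+1..2*m}" for t using that by (auto simp: dual_def)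
  have split: "t \<in> {1..m} \<or> t \<in> {m+1..2*m}" if "t \<in> {1..2*m}" for t using that by auto
  have cov: "(A \<union> B) \<union> dual m ` (A \<union> B) = {1..2*m}"
  proof
    show "(A \<union> B) \<union> dual m ` (A \<union> B) \<subseteq> {1..2*m}" using AB(2) dual_in(1) by blast
    have "t \<in> A \<union> B \<or> dual m t \<in> A \<union> B" if t: "t \<in> {1..2*m}" for t
      using v[OF t] d[OF t] dual_in(1)[OF t] split[OF t] dl[of t] t unfolding A_def B_def by auto
    then show "{1..2*m} \<subseteq> (A \<union> B) \<union> dual m ` (A \<union> B)" using dual_in(2) by (metis UnCI image_eqI subsetI)
  qed
  define \<tau> where "\<tau> t = (if t \<in> {1..m} then k t else if t \<in> {m+1..2*m} then dual m (k (dual m t)) else t)" for t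
  have "bij_betw \<tau> ({1..m} \<union> {m+1..2*m}) ((A \<union> B) \<union> dual m ` (A \<union> B))"
  proof (rule bij_betw_combine[OF _ _ disj])
    show "bij_betw \<tau> {1..m} (A \<union> B)" using k by (rule bij_betw_cong[THEN iffD1, rotated]) (simp add: \<tau>_def)
    have "bij_betw (dual m) {m+1..2*m} {1..m}"
      by (rule bij_betw_byWitness[where f' = "dual m"]) (auto simp: dual_def)
    moreover have "inj_on (dual m) (A \<union> B)" using AB(2) dual_in(2) by (metis inj_onI subsetD)
    then have "bij_betw (dual m) (A \<union> B) (dual m ` (A \<union> B))" by (rule inj_on_imp_bij_betw)
    ultimately have "bij_betw (dual m \<circ> (k \<circ> dual m)) {m+1..2*m} (dual m ` (A \<union> B))"
      using k bij_betw_trans by metis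
    then show "bij_betw \<tau> {m+1..2*m} (dual m ` (A \<union> B))"
      by (rule bij_betw_cong[THEN iffD1, rotated]) (simp add: \<tau>_def)
  qed
  moreover have "{1..m} \<union> {m+1..2*m} = {1..2*m}" by auto
  ultimately have "bij_betw \<tau> {1..2*m} {1..2*m}" using cov by simp
  then have p: "\<tau> permutes {1..2*m}" by (rule bij_imp_permutes) (auto simp: \<tau>_def)
  have td: "\<tau> (dual m t) = dual m (\<tau> t)" if t: "t \<in> {1..2*m}" for t
    using split[OF t]
  proof
    assume t1: "t \<in> {1..m}"
    then have "dual m t \<in> {m+1..2*m}" by (auto simp: dual_def)
    then show ?thesis using t1 dual_in(2)[OF t] by (simp add: \<tau>_def)
  next
    assume t2: "t \<in> {m+1..2*m}"
    then show ?thesis using dl[OF t2] dual_in(2)[OF kin[OF dl[OF t2]]] by (simp add: \<tau>_def)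
  qed
  have ts: "\<tau> \<in> Sstar m" using p td by (simp add: Sstar_def)
  have nu: "\<nu> (\<tau> t) = mu_vec m s t" if t: "t \<in> {1..2*m}" for t
  proof -
    have *: "\<nu> (k t) = mu_vec m s t" if "t \<in> {1..m}" for t
    proof (cases "t \<le> s")
      case True
      then show ?thesis using kA[OF that True] that by (simp add: A_def mu_vec_def)
    next
      case False
      then show ?thesis using kB[OF that False] that s by (simp add: B_def mu_vec_def)
    qed
    note md = mu_vec_dual[OF s]
    show ?thesis using split[OF t]
    proof
      assume t2: "t \<in> {m+1..2*m}"
      have "\<nu> (\<tau> t) = 2 - mu_vec m s (dual m t)"
        using d[OF kin[OF dl[OF t2]]] *[OF dl[OF t2]] t2 by (simp add: \<tau>_def)
      then show ?thesis using md[OF t] by simp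
    qed (simp add: \<tau>_def *)
  qed
  have "pvec \<tau> (mu_vec m s) t = \<nu> t" if t: "t \<in> {1..2*m}" for t
    using nu[OF SstarD(4)[OF SstarD(3)[OF ts] t]] SstarD(7)[OF ts] by (simp add: pvec_def)
  then show ?thesis using ts by blast
qed

end

section \<open>Cosets, permissibility and admissibility as defined in the statement\<close>

context gsp_parahoric begin

abbreviation transl where "transl \<sigma> \<equiv> (pvec \<sigma> (mu_vec m s), id :: nat \<Rightarrow> nat)"

lemma WI_iff: "u \<in> WI m I \<longleftrightarrow> u \<in> Wt m \<and> face_fix (aff u)"
proof (cases "u \<in> Wt m")
  case u: True
  have "actZ u (omega_vec m i) = omega_vec m i \<longleftrightarrow> (\<forall>a. Om i (aff u a) = Om i a)" for i
  proof -
    have out: "actZ u (omega_vec m i) t = omega_vec m i t" if "t \<notin> {1..2*m}" for t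
    proof -
      have s: "snd u \<in> Sstar m" "fst u \<in> Xs m" using u by (auto simp: Wt_def)
      have "inv (snd u) t = t" by (rule permutes_not_in[OF SstarD(1)[OF SstarD(3)[OF s(1)]] that])
      moreover have "fst u t = 0" using s(2) that unfolding Xs_iff by blast
      ultimately show ?thesis by (simp add: actZ_def pvec_def)
    qed
    have "actZ u (omega_vec m i) = omega_vec m i \<longleftrightarrow> (\<forall>t\<in>{1..2*m}. actZ u (omega_vec m i) t = omega_vec m i t)"
      (is "?l \<longleftrightarrow> ?r")
    proof
      assume r: ?r
      show ?l
      proof
        fix t show "actZ u (omega_vec m i) t = omega_vec m i t" using r out by (cases "t \<in> {1..2*m}") blast+
      qed
    qed simp
    also have "\<dots> \<longleftrightarrow> (\<forall>t\<in>{1..2*m}. V (aff u) i (int t) = 0)"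
      by (rule ball_cong[OF refl]) (simp only: V_actZ[OF u, symmetric] right_minus_eq)
    also have "\<dots> \<longleftrightarrow> (\<forall>a. V (aff u) i a = 0)"
      by (rule all_residues[of "\<lambda>a. V (aff u) i a = 0"]) (simp add: V_N[OF aff_AF[OF u]])
    finally show ?thesis by (simp add: V_def)
  qed
  then show ?thesis using u aff_AF[OF u] by (simp add: WI_def face_fix_def)
qed (simp add: WI_def)

lemma coset_eq: assumes w: "w \<in> Wt m" shows "coset m I w = face_coset w"
proof
  show "coset m I w \<subseteq> face_coset w"
    using w by (auto simp: coset_def face_coset_def WI_iff Wt_closed aff_mult)
  show "face_coset w \<subseteq> coset m I w"
  proof
    fix z assume "z \<in> face_coset w"
    then obtain h where z: "z \<in> Wt m" and h: "face_fix h" "aff z = h \<circ> aff w" by (auto simp: face_coset_def)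
    obtain u where u: "u \<in> Wt m" "aff u = h" using aff_surj h(1) by (auto simp: face_fix_def)
    have "z = wmult w u" by (rule aff_inj) (use z u w h in \<open>simp_all add: Wt_closed aff_mult\<close>)
    moreover have "u \<in> WI m I" using u h by (simp add: WI_iff)
    ultimately show "z \<in> coset m I w" by (auto simp: coset_def)
  qed
qed

lemma minrep_eq: "is_minrep m C z \<longleftrightarrow> minrep C z"
  by (simp only: is_minrep_def minrep_def)

lemma wedge_iff: assumes w: "w \<in> Wt m" shows "wedge_permissible m s I w \<longleftrightarrow> permissible (aff w)"
proof -
  note wAF = aff_AF[OF w]
  have "(let v = (\<lambda>t. actZ w (omega_vec m i) t - omega_vec m i t) in
       (\<forall>t\<in>{1..2*m}. 0 \<le> v t \<and> v t \<le> 2) \<and> (\<Sum>t=1..2*m. v t) = 2 * int m \<and> card {t\<in>{1..2*m}. v t = 0} \<le> s)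
     \<longleftrightarrow> (\<forall>a. 0 \<le> V (aff w) i a \<and> V (aff w) i a \<le> 2) \<and> zeros (aff w) i \<le> int s \<and> sumV (aff w) i = N" for i
  proof -
    let ?v = "\<lambda>t. actZ w (omega_vec m i) t - omega_vec m i t"
    have 1: "(\<forall>t\<in>{1..2*m}. 0 \<le> ?v t \<and> ?v t \<le> 2) \<longleftrightarrow> (\<forall>a. 0 \<le> V (aff w) i a \<and> V (aff w) i a \<le> 2)"
    proof -
      have "(\<forall>t\<in>{1..2*m}. 0 \<le> ?v t \<and> ?v t \<le> 2) \<longleftrightarrow>
          (\<forall>t\<in>{1..2*m}. 0 \<le> V (aff w) i (int t) \<and> V (aff w) i (int t) \<le> 2)"
        by (rule ball_cong[OF refl]) (simp only: V_actZ[OF w])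
      also have "\<dots> \<longleftrightarrow> (\<forall>a. 0 \<le> V (aff w) i a \<and> V (aff w) i a \<le> 2)"
        by (rule all_residues[of "\<lambda>a. 0 \<le> V (aff w) i a \<and> V (aff w) i a \<le> 2"]) (simp only: V_N[OF wAF])
      finally show ?thesis .
    qed
    have "(\<Sum>t=1..2*m. ?v t) = (\<Sum>t=1..2*m. V (aff w) i (int t))" using V_actZ[OF w] by (intro sum.cong) auto
    then have 2: "(\<Sum>t=1..2*m. ?v t) = sumV (aff w) i" unfolding sumV_def by (simp only: sum_int)
    have "{t\<in>{1..2*m}. ?v t = 0} = {t\<in>{1..2*m}. V (aff w) i (int t) = 0}"
      by (rule Collect_cong) (use V_actZ[OF w] in metis)
    then have 3: "int (card {t\<in>{1..2*m}. ?v t = 0}) = zeros (aff w) i" using card_zeros by simp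
    show ?thesis unfolding Let_def 1 2 using 3 by (auto simp: N_def)
  qed
  then show ?thesis unfolding wedge_permissible_def permissible_iff[OF wAF] by simp
qed

lemma transl_Wt: assumes "\<sigma> \<in> Sstar m" shows "(transl \<sigma>) \<in> Wt m"
proof -
  note md = mu_vec_dual[OF s_le]
  have "pvec \<sigma> (mu_vec m s) t = 0" if "t \<notin> {1..2*m}" for t
  proof -
    have "inv \<sigma> t = t" by (rule permutes_not_in[OF SstarD(1)[OF SstarD(3)[OF assms]] that])
    then show ?thesis using that s_le by (auto simp: pvec_def mu_vec_def)
  qed
  moreover have "pvec \<sigma> (mu_vec m s) (dual m t) = 2 - pvec \<sigma> (mu_vec m s) t" if "t \<in> {1..2*m}" for t
    using SstarD(5)[OF SstarD(3)[OF assms] that] md[OF SstarD(4)[OF SstarD(3)[OF assms] that]] by (simp add: pvec_def)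
  ultimately have "pvec \<sigma> (mu_vec m s) \<in> Xs m" unfolding Xs_iff by blast
  then show ?thesis using id_Sstar by (simp add: Wt_def)
qed

lemma transl_perm: assumes \<sigma>: "\<sigma> \<in> Sstar m" shows "permissible (aff (transl \<sigma>))"
proof -
  let ?t = "transl \<sigma>"
  note tW = transl_Wt[OF \<sigma>]
  note iS = SstarD(3)[OF \<sigma>]
  have V: "V (aff ?t) i a = mu_vec m s (inv \<sigma> (res a))" for i a using transl_AF(2)[OF tW] by (simp add: pvec_def)
  have b: "mu_vec m s t \<in> {0, 1, 2}" for t by (simp add: mu_vec_def)
  have z: "zeros (aff ?t) i = int s" for i
  proof -
    have "bij_betw (inv \<sigma>) {t \<in> {1..2*m}. mu_vec m s (inv \<sigma> t) = 0} {t \<in> {1..2*m}. mu_vec m s t = 0}"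
      by (rule bij_betw_byWitness[where f' = \<sigma>]) (use SstarD(4)[OF iS] SstarD(4,6,7)[OF \<sigma>] in auto)
    then have "card {t \<in> {1..2*m}. mu_vec m s (inv \<sigma> t) = 0} = card {t \<in> {1..2*m}. mu_vec m s t = 0}"
      by (rule bij_betw_same_card)
    also have "{t \<in> {1..2*m}. mu_vec m s t = 0} = {2*m - s + 1..2*m}"
      using s_le by (auto simp: mu_vec_def split: if_splits)
    also have "card \<dots> = s" using s_le by simp
    finally have c: "card {t \<in> {1..2*m}. mu_vec m s (inv \<sigma> t) = 0} = s" .
    have "{t \<in> {1..2*m}. V (aff ?t) i (int t) = 0} = {t \<in> {1..2*m}. mu_vec m s (inv \<sigma> t) = 0}" by (auto simp: V)
    then show ?thesis using card_zeros[of "aff ?t" i] c by simp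
  qed
  note md = mu_vec_dual[OF s_le]
  have "aff ?t (1 - x) = 2 * N + 1 - aff ?t x" for x
  proof -
    have "mu_vec m s (inv \<sigma> (res (1 - x))) = 2 - mu_vec m s (inv \<sigma> (res x))"
      using SstarD(5)[OF iS res_quo(2)[of x]] md[OF SstarD(4)[OF iS res_quo(2)[of x]]] by (simp add: res_dual)
    moreover have "aff ?t y = y + mu_vec m s (inv \<sigma> (res y)) * N" for y
      using transl_AF(1)[OF tW] by (simp add: pvec_def)
    ultimately show ?thesis by (simp only: left_diff_distrib)
  qed
  then have "selfdual 2 (aff ?t)" using aff_AF[OF tW] by (simp add: selfdual_def)
  moreover have "0 \<le> V (aff ?t) i a \<and> V (aff ?t) i a \<le> 2" for i a using b[of "inv \<sigma> (res a)"] unfolding V by auto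
  ultimately show ?thesis unfolding permissible_def using z by simp
qed

text \<open>Independence of the index removes the sign change of \<open>i\<close> from the duality
  of \<open>V\<close>. What remains is a vector with dual entries adding up to 2 and with
  \<open>s\<close> zeros, to which \<open>mu_orbit\<close> applies.\<close>

lemma final_transl:
  assumes g: "permissible g" and f: "final g"
  shows "\<exists>\<sigma>\<in>Sstar m. \<forall>i\<in>idx m I. \<forall>a. V (aff (transl \<sigma>)) i a = V g i a"
proof -
  obtain i where i: "i \<in> idx m I" using K_ne by blast
  define \<nu> where "\<nu> t = V g i (int t)" for t
  have const: "V g j a = V g i a" if "j \<in> idx m I" for j a using f that i unfolding final_def by blast
  have v: "\<nu> t \<in> {0, 1, 2}" for t using permissibleD(4,5)[OF g i, of "int t"] by (auto simp: \<nu>_def)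
  have d: "\<nu> (dual m t) = 2 - \<nu> t" if "t \<in> {1..2*m}" for t
  proof -
    have "int (dual m t) = 1 - int t + 1 * N" using dual_in(3)[OF that] by simp
    then have "\<nu> (dual m t) = V g i (1 - int t)" by (simp only: \<nu>_def V_shift[OF permissibleD(2)[OF g]])
    also have "\<dots> = 2 - V g (- i) (int t)" by (rule V_dual'[of g "int t" 2 i, OF permissibleD(3)[OF g]])
    finally show ?thesis using const[OF K_minus[OF i], of "int t"] by (simp only: \<nu>_def)
  qed
  have c: "card {t \<in> {1..2*m}. \<nu> t = 0} = s"
  proof -
    have "zeros g i = int s" using f i unfolding final_def by blast
    then show ?thesis using card_zeros[of g i] by (simp add: \<nu>_def)
  qed
  obtain \<sigma> where \<sigma>: "\<sigma> \<in> Sstar m" "\<forall>t\<in>{1..2*m}. pvec \<sigma> (mu_vec m s) t = \<nu> t"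
    using mu_orbit[OF s_le v d c] by blast
  have "V (aff (transl \<sigma>)) j a = V g j a" if j: "j \<in> idx m I" for j a
  proof -
    have "V (aff (transl \<sigma>)) j a = V g i (int (res a))"
      using transl_AF(2)[OF transl_Wt[OF \<sigma>(1)]] \<sigma>(2) res_quo(2)[of a] by (simp add: \<nu>_def)
    also have "\<dots> = V g i a"
      by (rule periodic_cg[of "V g i", OF V_N[OF permissibleD(2)[OF g]]]) (use res_quo(2)[of a] in \<open>simp add: cg_res\<close>)
    finally show ?thesis using const[OF j] by simp
  qed
  then show ?thesis using \<sigma>(1) by blast
qed

lemma wedge_permissible_iff_admissible:
  assumes w: "w \<in> Wt m"
  shows "wedge_permissible m s I w \<longleftrightarrow> mu_admissible m s I (coset m I w)"
proof
  assume "wedge_permissible m s I w"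
  then have p: "permissible (aff w)" using wedge_iff[OF w] by simp
  have "2 * int s \<le> N" using s_le by (simp add: N_def)
  have "\<exists>t\<in>transl ` Sstar m. \<exists>z y.
      t \<in> Wt m \<and> minrep (face_coset w) z \<and> minrep (face_coset t) y \<and> ext_le m z y"
  proof (rule permissible_admissible[OF w p \<open>2 * int s \<le> N\<close>])
    fix g assume "permissible g" "final g"
    then obtain \<sigma> where "\<sigma> \<in> Sstar m" "\<forall>i\<in>idx m I. \<forall>a. V (aff (transl \<sigma>)) i a = V g i a"
      using final_transl by blast
    then show "\<exists>t\<in>transl ` Sstar m.
        t \<in> Wt m \<and> (\<forall>i\<in>idx m I. \<forall>a. V (aff t) i a = V g i a)"
      using transl_Wt by blast
  qed
  then obtain \<sigma> z y where \<sigma>: "\<sigma> \<in> Sstar m" and "minrep (face_coset w) z"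
    "minrep (face_coset (transl \<sigma>)) y" "ext_le m z y" by blast
  then show "mu_admissible m s I (coset m I w)"
    unfolding mu_admissible_def coset_le_def minrep_eq coset_eq[OF w]
    by (intro bexI[OF _ \<sigma>] exI[of _ z] exI[of _ y]) (simp add: coset_eq[OF transl_Wt[OF \<sigma>]])
next
  assume "mu_admissible m s I (coset m I w)"
  then obtain \<sigma> z y where \<sigma>: "\<sigma> \<in> Sstar m" and "minrep (coset m I w) z"
    "minrep (coset m I (transl \<sigma>)) y" and le: "ext_le m z y"
    unfolding mu_admissible_def coset_le_def minrep_eq by blast
  then have "z \<in> face_coset w" "y \<in> face_coset (transl \<sigma>)"
    using coset_eq[OF w] coset_eq[OF transl_Wt[OF \<sigma>]] by (auto simp: minrep_def)
  then have "permissible (aff w)" by (rule admissible_permissible[OF w transl_Wt[OF \<sigma>] transl_perm[OF \<sigma>] _ _ le])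
  then show "wedge_permissible m s I w" using wedge_iff[OF w] by simp
qed

end

theorem theorem6p1p1:
  fixes m s :: nat and I :: "nat set" and w :: elt
  assumes "1 \<le> m" and "s \<le> m" and "I \<subseteq> {0..m}" and "I \<noteq> {}"
    and "w \<in> Wt m"
  shows "wedge_permissible m s I w \<longleftrightarrow> mu_admissible m s I (coset m I w)"
proof -
  interpret gsp_parahoric m s I using assms by unfold_locales auto
  show ?thesis by (rule wedge_permissible_iff_admissible[OF assms(5)])
qed

end
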